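(* Let $G=\langle a\rangle$ be a cyclic group that is isomorphic to $Z_{2^n}$ with $n\geqslant 3$, and let $H=\mathrm{Hol}(G)=G_R\rtimes\mathrm{Aut}(G)$ be the holomorph of $G$, viewed as a permutation group on $G$. Suppose that $R$ is a subgroup of $H$. Then $R$ is regular if and only if, up to conjugacy, exactly one of the following holds: (1) $R=G_R$; (2) $R=\langle ay^{2^{t}}\rangle\cong Z_{2^{n}}$ for $0\leqslant t\leqslant n-3$, and $R\cap G_R=\langle a^{2^{n-t-2}}\rangle$; (3) $R=\langle a^{2}, ax\rangle\cong D_{2^{n}}$; (4) $R=\langle a^{2}, axy^{2^{n-3}}\rangle\cong Q_{2^{n}}$; (5) $R=\langle a^{2\cdot 5^{-1}}y\rangle\times \langle ax\rangle$ and $R\cap G_R=\langle a^{2^{n-1}}\rangle$; (6) $R=\langle a^{2\cdot 5^{-1}+2^{n-2}}y\rangle \rtimes \langle ax\rangle$ with $R\cap G_R=\langle a^{2^{n-1}}\rangle$, and $R\cong M_{n}(2)$; (7) $R=\langle a^{2}y^{2^{n-3}}\rangle\rtimes \langle ax\rangle$ with $R\cap G_R=\langle a^{4}\rangle$, and $R\cong QD_{2^{n}}$.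
   Context: $Z_m$ denotes the cyclic group of order $m$. For $g\in G$, $g_R:u\mapsto ug$ and $G_R=\{g_R\mid g\in G\}$; an element $g\in G$ is also used to denote the corresponding element $g_R$ of $G_R$. $\mathrm{Aut}(G)=\langle x\rangle\times\langle y\rangle$ where $x:a\mapsto a^{-1}$ and $y:a\mapsto a^{5}$. Permutations act on the right and are composed from left to right, so $a^{\alpha}x^{\beta}y^{\gamma}\in \mathrm{Hol}(G)$ maps $a^{\epsilon}$ to $(a^{\epsilon+\alpha})^{x^{\beta}y^{\gamma}}$. Conjugacy is conjugacy in $H$. Here $5^{-1}$ is the inverse of $5$ in the multiplicative group of integers modulo $2^n$. Groups of order $2^n$: $D_{2^n}$ (dihedral), $QD_{2^n}$ (quasidihedral) and $M_n(2)$ are the groups with a cyclic subgroup $\langle\sigma\rangle$ of index two (so $\sigma$ has order $2^{n-1}$) and an involution $\tau\notin\langle\sigma\rangle$ such that, respectively, $\sigma^\tau=\sigma^{-1}$, $\sigma^\tau=\sigma^{2^{n-2}-1}$, $\sigma^\tau=\sigma^{2^{n-2}+1}$. The generalised quaternion group is $Q_{2^n}=\langle \sigma,\tau\mid \sigma^{2^{n-1}}=\tau^4=1,\ \sigma^{2^{n-2}}=\tau^2,\ \sigma^\tau=\sigma^{-1}\rangle$.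
   Formalization: The quasidihedral group QD_{2^n} is taken to exist only for n ≥ 4, so item (7) cannot occur for n = 3; with the displayed relation at n = 3, QD_8 would be Z_4 × Z_2 and items (5) and (7) would both hold for the same R. *)

theory Defs
  imports "HOL-Algebra.Algebra" "HOL-Number_Theory.Modular_Inverse"
begin

text \<open>
  Permutations of \<open>S\<close> as in \<^const>\<open>BijGroup\<close>, but composed from left to right, so that
  \<open>f \<otimes> g\<close> is first \<open>f\<close>, then \<open>g\<close> (whereas \<^const>\<open>BijGroup\<close> composes from right to left).
\<close>
definition right_sym :: "'a set \<Rightarrow> ('a \<Rightarrow> 'a) monoid" where
  "right_sym S =
    \<lparr>carrier = Bij S,
     monoid.mult = \<lambda>f \<in> Bij S. \<lambda>g \<in> Bij S. compose S g f,
     one = \<lambda>u \<in> S. u\<rparr>"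

definition right_translation :: "('a, 'b) monoid_scheme \<Rightarrow> 'a \<Rightarrow> 'a \<Rightarrow> 'a" where
  "right_translation G g = (\<lambda>u \<in> carrier G. u \<otimes>\<^bsub>G\<^esub> g)"

definition right_regular :: "('a, 'b) monoid_scheme \<Rightarrow> ('a \<Rightarrow> 'a) set" where
  "right_regular G = right_translation G ` carrier G"

definition Hol :: "('a, 'b) monoid_scheme \<Rightarrow> ('a \<Rightarrow> 'a) monoid" where
  "Hol G = (right_sym (carrier G))
     \<lparr>carrier := right_regular G <#>\<^bsub>right_sym (carrier G)\<^esub> auto G\<rparr>"

text \<open>Regular = transitive with trivial point stabilisers.\<close>
definition regular_on :: "('a \<Rightarrow> 'a) set \<Rightarrow> 'a set \<Rightarrow> bool" where
  "regular_on R S \<longleftrightarrow>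
     (\<forall>u\<in>S. \<forall>v\<in>S. \<exists>f\<in>R. f u = v) \<and>
     (\<forall>u\<in>S. \<forall>f\<in>R. f u = u \<longrightarrow> f = (\<lambda>w\<in>S. w))"

definition conjugate_set :: "('a, 'b) monoid_scheme \<Rightarrow> 'a \<Rightarrow> 'a set \<Rightarrow> 'a set" where
  "conjugate_set H h R = (\<lambda>r. inv\<^bsub>H\<^esub> h \<otimes>\<^bsub>H\<^esub> r \<otimes>\<^bsub>H\<^esub> h) ` R"

definition internal_semidirect ::
    "('a, 'b) monoid_scheme \<Rightarrow> 'a set \<Rightarrow> 'a set \<Rightarrow> 'a set \<Rightarrow> bool" where
  "internal_semidirect H R N K \<longleftrightarrow>
     N \<lhd> H\<lparr>carrier := R\<rparr> \<and> subgroup K (H\<lparr>carrier := R\<rparr>) \<and>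
     N \<inter> K = {\<one>\<^bsub>H\<^esub>} \<and> N <#>\<^bsub>H\<^esub> K = R"

definition internal_direct ::
    "('a, 'b) monoid_scheme \<Rightarrow> 'a set \<Rightarrow> 'a set \<Rightarrow> 'a set \<Rightarrow> bool" where
  "internal_direct H R N K \<longleftrightarrow>
     N \<lhd> H\<lparr>carrier := R\<rparr> \<and> K \<lhd> H\<lparr>carrier := R\<rparr> \<and>
     N \<inter> K = {\<one>\<^bsub>H\<^esub>} \<and> N <#>\<^bsub>H\<^esub> K = R"

definition cyclic_index_two_with :: "nat \<Rightarrow> int \<Rightarrow> ('a, 'b) monoid_scheme \<Rightarrow> bool" where
  "cyclic_index_two_with n k K \<longleftrightarrow>
     group K \<and> order K = 2 ^ n \<and>
     (\<exists>\<sigma>\<in>carrier K. \<exists>\<tau>\<in>carrier K.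
        card (rcosets\<^bsub>K\<^esub> (generate K {\<sigma>})) = 2 \<and>
        \<tau> \<notin> generate K {\<sigma>} \<and> group.ord K \<tau> = 2 \<and>
        inv\<^bsub>K\<^esub> \<tau> \<otimes>\<^bsub>K\<^esub> \<sigma> \<otimes>\<^bsub>K\<^esub> \<tau> = \<sigma> [^]\<^bsub>K\<^esub> k)"

definition is_dihedral :: "nat \<Rightarrow> ('a, 'b) monoid_scheme \<Rightarrow> bool" where
  "is_dihedral n K \<longleftrightarrow> cyclic_index_two_with n (- 1) K"

text \<open>
  Quasidihedral groups exist from order 16 on. For \<open>n = 3\<close> the relation would read
  \<open>\<sigma>\<^sup>\<tau> = \<sigma>\<close> and describe the abelian group of type (4, 2), hence the usual bound.
\<close>
definition is_quasidihedral :: "nat \<Rightarrow> ('a, 'b) monoid_scheme \<Rightarrow> bool" where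
  "is_quasidihedral n K \<longleftrightarrow> 4 \<le> n \<and> cyclic_index_two_with n (2 ^ (n - 2) - 1) K"

definition is_modular :: "nat \<Rightarrow> ('a, 'b) monoid_scheme \<Rightarrow> bool" where
  "is_modular n K \<longleftrightarrow> cyclic_index_two_with n (2 ^ (n - 2) + 1) K"

text \<open>
  Groups presented by generators and relations: words in the generators and their formal
  inverses, modulo free cancellation and the relations \<open>l = r\<close> for \<open>(l, r)\<close> in \<open>rels\<close>.
\<close>
datatype 'g letter = Gen 'g | Inv 'g

inductive rewrite_step ::
    "('g letter list \<times> 'g letter list) set \<Rightarrow> 'g letter list \<Rightarrow> 'g letter list \<Rightarrow> bool"
  for rels where
  "rewrite_step rels (u @ [Gen g, Inv g] @ v) (u @ v)"
| "rewrite_step rels (u @ [Inv g, Gen g] @ v) (u @ v)"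
| "(l, r) \<in> rels \<Longrightarrow> rewrite_step rels (u @ l @ v) (u @ r @ v)"

definition word_rel ::
    "('g letter list \<times> 'g letter list) set \<Rightarrow> ('g letter list \<times> 'g letter list) set" where
  "word_rel rels = {(u, v). equivclp (rewrite_step rels) u v}"

definition presented_group ::
    "('g letter list \<times> 'g letter list) set \<Rightarrow> 'g letter list set monoid" where
  "presented_group rels =
    \<lparr>carrier = UNIV // word_rel rels,
     monoid.mult = \<lambda>A B. \<Union>u\<in>A. \<Union>v\<in>B. word_rel rels `` {u @ v},
     one = word_rel rels `` {[]}\<rparr>"

datatype quaternion_gen = Sigma_gen | Tau_gen

definition generalised_quaternion :: "nat \<Rightarrow> quaternion_gen letter list set monoid" where
  "generalised_quaternion n = presented_group
    {(replicate (2 ^ (n - 1)) (Gen Sigma_gen), []),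
     (replicate 4 (Gen Tau_gen), []),
     (replicate (2 ^ (n - 2)) (Gen Sigma_gen), replicate 2 (Gen Tau_gen)),
     ([Inv Tau_gen, Gen Sigma_gen, Gen Tau_gen], [Inv Sigma_gen])}"

end

(*
  Every element of the holomorph is an affine map a^k |-> a^(u k + c) of Z/2^n with u odd.  A subgroup R
  is regular iff for each c there is exactly one u, modulo 2^n, such that R contains the map (c, u).  If u = 1 mod 4,
  the powers of (c, u) have translation parts c (1 + u + ... + u^(k-1)), and this geometric sum has
  the same 2-adic valuation as k; hence (c, u) with c odd generates a regular cyclic group, and with c = 2 mod 4
  it is simply transitive on the even residues.

  So if R contains some (c, u) with c odd and u = 1 mod 4, it is cyclic: types (1) and (2).  Otherwise
  the maps with even c form a cyclic subgroup generated by g = (2, w), w = 1 mod 4, and R is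
  generated by g and f = (1, v), v = 3 mod 4.  The commutator of g and f is a translation by an odd multiple of
  2v - 1 - w; that it lies in the group generated by g forces w = 1 mod 2^(n-1) or w = 5 mod 8,
  and scaling by units brings R into one of the forms (3) to (7).

  Conjugation preserves the set of multipliers u and commutativity, and these two invariants separate
  the seven types.
*)
theory Submission
  imports Defs
begin

section \<open>Geometric sums modulo powers of two\<close>

text \<open>Why so few values of \<open>w\<close> survive: write \<open>w = 1 + 2 ^ s * r\<close>
  with \<open>r\<close> odd and \<open>2 \<le> s\<close>. As
  \<open>w ^ k - 1 = (w - 1) * geo w k\<close>, a power of \<open>(2, w)\<close> is a translation
  only if \<open>2 ^ (n - s)\<close> divides the geometric sum, so the translations among these
  powers are the multiples of \<open>2 ^ (n + 1 - s)\<close>. If \<open>3 \<le> s\<close> and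
  \<open>v\<close> is 3 modulo 4, then \<open>2 * v - 1 - w\<close> is 4 modulo 8, which forces
  \<open>n - 1 \<le> s\<close>; what remains is \<open>s = 2\<close>, \<open>s = n - 1\<close> and
  \<open>s = n\<close>. The valuation argument needs \<open>u\<close> to be 1 modulo 4: if
  \<open>u\<close> is 3 modulo 4, the factor \<open>1 + u\<close> may contain a high power of two.
  Noncyclic groups are therefore split into a cyclic part with even translations and one further
  coset. The normal forms are reached by scaling alone, which sends \<open>(c, u)\<close> to
  \<open>(s * c, u)\<close>, and by replacing generators with suitable powers. At
  \<open>n = 3\<close> the types 6 and 7 are empty, so several arguments need
  \<open>4 \<le> n\<close> and have to produce it from the situation at hand.\<close>

definition geo :: "int \<Rightarrow> nat \<Rightarrow> int" where
  "geo u k = (\<Sum>i<k. u ^ i)"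

lemma geo_0 [simp]: "geo u 0 = 0"
  by (simp add: geo_def)

lemma geo_Suc: "geo u (Suc k) = geo u k + u ^ k"
  by (simp add: geo_def)

lemma geo_1 [simp]: "geo u 1 = 1" "geo u (Suc 0) = 1"
  by (simp_all add: geo_def)

lemma geo_one [simp]: "geo 1 k = int k"
  by (simp add: geo_def)

lemma geo_add: "geo u (i + j) = geo u i + u ^ i * geo u j"
  by (induction j) (simp_all add: geo_Suc power_add algebra_simps)

lemma geo_Suc': "geo u (Suc k) = 1 + u * geo u k"
  using geo_add[of u 1 k] by simp

lemma power_eq_geo: "u ^ k = 1 + (u - 1) * geo u k"
proof (induction k)
  case (Suc k)
  have "u ^ Suc k = u ^ k + (u - 1) * u ^ k"
    by (simp add: algebra_simps)
  then show ?case
    using Suc by (simp add: geo_Suc distrib_left)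
qed simp

lemma geo_cong: "[u = 1] (mod m) \<Longrightarrow> [geo u k = int k] (mod m)"
proof (induction k)
  case (Suc k)
  then have "[geo u k + u ^ k = int k + 1] (mod m)"
    using cong_add[OF _ cong_pow[of u 1 m k]] by simp
  then show ?case
    by (simp add: geo_Suc add.commute)
qed simp

lemma even_geo_iff: "odd u \<Longrightarrow> even (geo u k) \<longleftrightarrow> even k"
  by (induction k) (auto simp: geo_Suc)

lemma odd_if_mod_4: "u mod 4 = 1 \<Longrightarrow> odd (u :: int)"
  by presburger

lemma power_mod_4: "u mod 4 = 1 \<Longrightarrow> (u ^ k :: int) mod 4 = 1"
  using power_mod[of u 4 k] by simp

text \<open>Halving \<open>k\<close> costs exactly one factor of two:
  \<open>geo u (l + l) = (1 + u ^ l) * geo u l\<close>, and \<open>1 + u ^ l\<close> is twice an odd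
  number because \<open>u ^ l\<close> is 1 modulo 4.\<close>

lemma pow2_dvd_geo_iff:
  assumes "u mod 4 = 1"
  shows "2 ^ j dvd geo u k \<longleftrightarrow> 2 ^ j dvd k"
proof (induction j arbitrary: k)
  case (Suc j)
  show ?case
  proof (cases "even k")
    case True
    then obtain l where k: "k = l + l"
      by (metis evenE mult_2)
    have "(1 + u ^ l) mod 4 = 2"
      using power_mod_4[OF assms, of l] by presburger
    define o' where "o' = (1 + u ^ l) div 2"
    have o': "1 + u ^ l = 2 * o'" "odd o'"
      using \<open>(1 + u ^ l) mod 4 = 2\<close> unfolding o'_def by presburger+
    have "geo u k = (1 + u ^ l) * geo u l"
      by (simp add: k geo_add algebra_simps)
    then have "geo u k = 2 * (o' * geo u l)"
      by (simp add: o'(1))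
    then have "2 ^ Suc j dvd geo u k \<longleftrightarrow> 2 ^ j dvd o' * geo u l"
      by simp
    also have "\<dots> \<longleftrightarrow> 2 ^ j dvd geo u l"
      using o'(2) by (intro coprime_dvd_mult_right_iff) auto
    finally show ?thesis
      using Suc[of l] by (simp add: k flip: mult_2)
  next
    case False
    then have "odd (geo u k)"
      using even_geo_iff odd_if_mod_4[OF assms] by blast
    with False show ?thesis
      by (metis dvd_mult_left power_Suc)
  qed
qed simp

lemma geo_pow2:
  assumes "u mod 4 = 1"
  obtains e where "odd e" "geo u (2 ^ n) = 2 ^ n * e"
proof -
  have "2 ^ n dvd geo u (2 ^ n)"
    by (simp add: pow2_dvd_geo_iff[OF assms])
  then obtain e where e: "geo u (2 ^ n) = 2 ^ n * e" ..
  have "\<not> 2 ^ Suc n dvd geo u (2 ^ n)"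
    unfolding pow2_dvd_geo_iff[OF assms] by (auto dest: dvd_imp_le)
  then have "odd e"
    by (auto simp: e)
  with e show ?thesis
    using that by blast
qed

text \<open>Lifting in the style of Hensel: if \<open>k\<close> is a solution modulo
  \<open>2 ^ n\<close>, then \<open>k\<close> or \<open>k + 2 ^ n\<close> is one modulo
  \<open>2 ^ Suc n\<close>.\<close>

lemma geo_surj:
  assumes "u mod 4 = 1"
  shows "\<exists>k. [geo u k = d] (mod 2 ^ n)"
proof (induction n)
  case (Suc n)
  then obtain k where k: "2 ^ n dvd geo u k - d"
    by (auto simp: cong_iff_dvd_diff)
  then obtain b where b: "geo u k - d = 2 ^ n * b" ..
  show ?case
  proof (cases "even b")
    case True
    then have "2 ^ Suc n dvd geo u k - d"
      by (auto simp: b)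
    then show ?thesis
      by (auto simp: cong_iff_dvd_diff)
  next
    case False
    obtain e where e: "odd e" "geo u (2 ^ n) = 2 ^ n * e"
      using geo_pow2[OF assms] by blast
    \<comment> \<open>Passing to \<open>k + 2 ^ n\<close> adds the odd number
      \<open>u ^ k * e\<close> to the quotient \<open>b\<close> and so repairs its parity.\<close>
    have "geo u (k + 2 ^ n) - d = 2 ^ n * (b + u ^ k * e)"
      using b e(2) by (simp add: geo_add algebra_simps)
    moreover have "even (b + u ^ k * e)"
      using False e(1) odd_if_mod_4[OF assms] by simp
    ultimately have "2 ^ Suc n dvd geo u (k + 2 ^ n) - d"
      by auto
    then show ?thesis
      by (auto simp: cong_iff_dvd_diff)
  qed
qed auto

section \<open>Linear congruences and powers of units modulo powers of two\<close>

lemma cong_mult_odd_cancel: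
  assumes "odd (r :: int)"
  shows "[r * b = r * c] (mod 2 ^ n) \<longleftrightarrow> [b = c] (mod 2 ^ n)"
  using assms by (intro cong_mult_lcancel) auto

text \<open>Oddness of the inverse is recorded because the inverse will itself serve as a
  multiplier; the congruence yields it only for positive \<open>n\<close>, hence the separate
  case.\<close>

lemma odd_inverse_mod_pow2:
  assumes "odd (r :: int)"
  obtains r' where "odd r'" "[r * r' = 1] (mod 2 ^ n)" 
proof (cases "n = 0")
  case False
  from assms have "coprime r (2 ^ n)" by auto
  then obtain r' where r': "[r * r' = 1] (mod 2 ^ n)"
    using cong_solve_coprime_int by blast
  then have "[r * r' = 1] (mod 2)"
    using False by (meson cong_dvd_modulus dvd_power gr0I)
  then have "odd r'"
    by (auto simp: cong_def dest: even_mult_iff[THEN iffD2])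
  then show ?thesis using r' that by blast
qed (use that[of 1] in auto)

lemma cong_mult_odd_solve:
  assumes "odd (r :: int)"
  obtains e where "[r * e = d] (mod 2 ^ n)"
proof -
  obtain r' where "[r * r' = 1] (mod 2 ^ n)"
    using odd_inverse_mod_pow2[OF assms] by blast
  then have "[r * r' * d = 1 * d] (mod 2 ^ n)"
    by (rule cong_scalar_right)
  then show ?thesis using that[of "r' * d"] by (simp add: mult.assoc)
qed

text \<open>Since \<open>(1 + 2 ^ s * r) ^ k\<close> is \<open>1 + 2 ^ s * r\<close> times a
  geometric sum in the second term, it suffices to hit one value of that sum. In group terms, the
  units that are 1 modulo \<open>2 ^ s\<close> form a cyclic group, generated by any unit of exactly
  this level.\<close>

lemma pow2_power_cong_surj:
  assumes "odd r" "2 \<le> s" "2 ^ s dvd v - 1"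
  shows "\<exists>k. [(1 + 2 ^ s * r) ^ k = (v :: int)] (mod 2 ^ n)"
proof -
  have "(4 :: int) dvd 2 ^ s"
    using le_imp_power_dvd[OF assms(2), of "2 :: int"] by simp
  then have w: "(1 + 2 ^ s * r) mod 4 = 1"
    using dvd_mult2[of 4 "2 ^ s" r] by presburger
  obtain e where e: "v - 1 = 2 ^ s * e"
    using assms(3) ..
  obtain d where d: "[r * d = e] (mod 2 ^ n)"
    using cong_mult_odd_solve[OF assms(1)] by blast
  obtain k where k: "[geo (1 + 2 ^ s * r) k = d] (mod 2 ^ n)"
    using geo_surj[OF w] by blast
  have "[r * geo (1 + 2 ^ s * r) k = e] (mod 2 ^ n)"
    using cong_trans[OF cong_scalar_left[OF k] d] .
  then have "[1 + 2 ^ s * (r * geo (1 + 2 ^ s * r) k) = 1 + 2 ^ s * e] (mod 2 ^ n)"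
    by (intro cong_add cong_scalar_left) auto
  then show ?thesis
    using e by (intro exI[of _ k]) (simp add: power_eq_geo[of _ k] mult.assoc algebra_simps)
qed

lemma pow2_decompose:
  assumes "(d :: int) \<noteq> 0"
  obtains s r where "d = 2 ^ s * r" "odd r"
proof -
  have "\<not> is_unit (2 :: int)"
    by simp
  then obtain r where "d = 2 ^ multiplicity 2 d * r" "odd r"
    using multiplicity_decompose'[of d 2] assms by blast
  then show ?thesis
    using that by blast
qed

text \<open>The exponent of two in \<open>5 ^ 2 ^ t - 1\<close> is exactly \<open>t + 2\<close>.
  Letting \<open>t\<close> run from \<open>0\<close> to \<open>n - 3\<close> thus realises every
  exponent from \<open>2\<close> to \<open>n - 1\<close>, which is the range of type 2.\<close>

lemma five_power_pow2:
  obtains r where "odd r" "(5 :: int) ^ (2 ^ t) = 1 + 2 ^ (t + 2) * r"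
proof -
  obtain r where "odd r" "geo 5 (2 ^ t) = 2 ^ t * r"
    by (rule geo_pow2[of 5 t]) auto
  then show ?thesis
    using that power_eq_geo[of 5 "2 ^ t"] by simp
qed

section \<open>Words and the presentation of the generalised quaternion group\<close>

lemma rewrite_step_context:
  assumes "rewrite_step rels u v"
  shows "rewrite_step rels (l @ u @ r) (l @ v @ r)"
  using assms
proof cases
  case (1 b g c)
  then show ?thesis
    using rewrite_step.intros(1)[of rels "l @ b" g "c @ r"] by simp
next
  case (2 b g c)
  then show ?thesis
    using rewrite_step.intros(2)[of rels "l @ b" g "c @ r"] by simp
next
  case (3 p q b c)
  then show ?thesis
    using rewrite_step.intros(3)[of p q rels "l @ b" "c @ r"] by simp
qed

lemma word_rel_context:
  assumes "(u, v) \<in> word_rel rels"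
  shows "(l @ u @ r, l @ v @ r) \<in> word_rel rels"
proof -
  have "equivclp (rewrite_step rels) u v"
    using assms by (simp add: word_rel_def)
  then have "equivclp (rewrite_step rels) (l @ u @ r) (l @ v @ r)"
  proof (induction rule: equivclp_induct)
    case (step v w)
    then show ?case
      by (meson rewrite_step_context equivclp_into_equivclp)
  qed simp
  then show ?thesis by (simp add: word_rel_def)
qed

text \<open>The class of a word is the fibre of \<open>f\<close> through it, so \<open>s \<mapsto> f\<^sup>-\<^sup>1(s)\<close> is the isomorphism.\<close>
lemma iso_presented_group:
  assumes "group K"
    and hom: "\<And>u v. f (u @ v) = f u \<otimes>\<^bsub>K\<^esub> f v"
    and range: "range f = carrier K"
    and kernel: "\<And>u v. f u = f v \<longleftrightarrow> (u, v) \<in> word_rel rels"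
  shows "K \<cong> presented_group rels"
proof (rule is_isoI, rule isoI)
  let ?P = "presented_group rels"
  have "class": "word_rel rels `` {u} = {v. f v = f u}" for u
    using kernel[of u] by (auto dest: sym)
  have carrier: "carrier ?P = (\<lambda>s. {u. f u = s}) ` carrier K"
    unfolding presented_group_def by (auto simp: quotient_def "class" simp flip: range)
  show "(\<lambda>s. {u. f u = s}) \<in> hom K ?P"
  proof (rule homI)
    fix s t assume "s \<in> carrier K" "t \<in> carrier K"
    then obtain u v where "s = f u" "t = f v"
      using range by (metis rangeE)
    then show "{w. f w = s \<otimes>\<^bsub>K\<^esub> t} = {u. f u = s} \<otimes>\<^bsub>?P\<^esub> {u. f u = t}"
      by (auto simp: presented_group_def "class" hom)
  qed (simp add: carrier)
  show "bij_betw (\<lambda>s. {u. f u = s}) (carrier K) (carrier ?P)"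
    unfolding carrier
  proof (rule inj_on_imp_bij_betw, rule inj_onI)
    fix s t assume "s \<in> carrier K" "t \<in> carrier K" "{u. f u = s} = {u. f u = t}"
    then show "s = t"
      using range by (metis (mono_tags, lifting) imageE mem_Collect_eq)
  qed
qed

section \<open>Evaluation of words in a group\<close>

primrec letter_eval :: "('a, 'b) monoid_scheme \<Rightarrow> ('g \<Rightarrow> 'a) \<Rightarrow> 'g letter \<Rightarrow> 'a" where
  "letter_eval K \<phi> (Gen g) = \<phi> g"
| "letter_eval K \<phi> (Inv g) = inv\<^bsub>K\<^esub> \<phi> g"

definition word_eval :: "('a, 'b) monoid_scheme \<Rightarrow> ('g \<Rightarrow> 'a) \<Rightarrow> 'g letter list \<Rightarrow> 'a" where
  "word_eval K \<phi> w = foldr (\<lambda>l s. letter_eval K \<phi> l \<otimes>\<^bsub>K\<^esub> s) w \<one>\<^bsub>K\<^esub>"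

context group
begin

lemma word_eval_Nil [simp]: "word_eval G \<phi> [] = \<one>"
  by (simp add: word_eval_def)

lemma word_eval_Cons [simp]: "word_eval G \<phi> (l # w) = letter_eval G \<phi> l \<otimes> word_eval G \<phi> w"
  by (simp add: word_eval_def)

context
  fixes \<phi> :: "'g \<Rightarrow> 'a"
  assumes \<phi>: "\<And>g. \<phi> g \<in> carrier G"
begin

lemma letter_eval_closed [simp]: "letter_eval G \<phi> l \<in> carrier G"
  using \<phi> by (cases l) auto

lemma word_eval_closed [simp]: "word_eval G \<phi> w \<in> carrier G"
  by (induction w) auto

lemma word_eval_append: "word_eval G \<phi> (u @ v) = word_eval G \<phi> u \<otimes> word_eval G \<phi> v"
  by (induction u) (auto simp: m_assoc)

lemma word_eval_replicate: "word_eval G \<phi> (replicate k (Gen g)) = \<phi> g [^] k"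
proof (induction k)
  case (Suc k)
  then show ?case
    using nat_pow_Suc2[OF \<phi>, of g k] by simp
qed simp

lemma word_eval_word_rel:
  assumes rels: "\<And>l r. (l, r) \<in> rels \<Longrightarrow> word_eval G \<phi> l = word_eval G \<phi> r"
    and "(u, v) \<in> word_rel rels"
  shows "word_eval G \<phi> u = word_eval G \<phi> v"
proof -
  have step: "word_eval G \<phi> u = word_eval G \<phi> v" if "rewrite_step rels u v" for u v
    using that
    by cases (auto simp: word_eval_append \<phi> rels inv_solve_left m_assoc[symmetric]
        simp flip: m_assoc)
  have "equivclp (rewrite_step rels) u v"
    using assms(2) by (simp add: word_rel_def)
  then show ?thesis
    by (induction rule: equivclp_induct) (auto dest: step)
qed

end

end


section \<open>Normal forms for the quaternion presentation\<close>

locale quaternion_words =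
  fixes n :: nat
  assumes n: "2 \<le> n"
begin

abbreviation "S \<equiv> Gen Sigma_gen"
abbreviation "T \<equiv> Gen Tau_gen"

definition "quaternion_rels =
    {(replicate (2 ^ (n - 1)) S, []),
     (replicate 4 T, []),
     (replicate (2 ^ (n - 2)) S, replicate 2 T),
     ([Inv Tau_gen, S, T], [Inv Sigma_gen])}"

definition word_equiv (infix "\<doteq>" 50) where
  "u \<doteq> v \<longleftrightarrow> (u, v) \<in> word_rel quaternion_rels"

lemma word_equiv_refl [simp, intro]: "u \<doteq> u"
  by (simp add: word_equiv_def word_rel_def)

lemma word_equiv_sym: "u \<doteq> v \<Longrightarrow> v \<doteq> u"
  by (auto simp: word_equiv_def word_rel_def intro: equivclp_sym)

lemma word_equiv_trans [trans]: "u \<doteq> v \<Longrightarrow> v \<doteq> w \<Longrightarrow> u \<doteq> w"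
  by (auto simp: word_equiv_def word_rel_def intro: equivclp_trans)

lemma word_equiv_context: "u \<doteq> v \<Longrightarrow> l @ u @ r \<doteq> l @ v @ r"
  unfolding word_equiv_def by (rule word_rel_context)

lemma word_equiv_append: "u \<doteq> u' \<Longrightarrow> v \<doteq> v' \<Longrightarrow> u @ v \<doteq> u' @ v'"
  using word_equiv_context[of u u' "[]" v] word_equiv_context[of v v' u' "[]"] word_equiv_trans
  by fastforce

lemma word_equiv_step: "rewrite_step quaternion_rels u v \<Longrightarrow> u \<doteq> v"
  by (simp add: word_equiv_def word_rel_def r_into_equivclp)

lemma word_equiv_rel: "(u, v) \<in> quaternion_rels \<Longrightarrow> u \<doteq> v"
  using rewrite_step.intros(3)[of u v quaternion_rels "[]" "[]"] by (simp add: word_equiv_step)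

lemma word_equiv_cancel: "[Gen g, Inv g] \<doteq> []" "[Inv g, Gen g] \<doteq> []"
  using rewrite_step.intros(1)[of quaternion_rels "[]" g "[]"]
    rewrite_step.intros(2)[of quaternion_rels "[]" g "[]"] by (simp_all add: word_equiv_step)

text \<open>A generator of finite order has its inverse among its positive powers, so collecting a
  word only has to deal with \<open>Gen\<close> letters.\<close>

lemma inv_letter_equiv:
  assumes "replicate (Suc k) (Gen g) \<doteq> []"
  shows "[Inv g] \<doteq> replicate k (Gen g)"
proof -
  have "[Inv g] \<doteq> [Inv g] @ replicate (Suc k) (Gen g)"
    using word_equiv_append[OF word_equiv_refl[of "[Inv g]"] word_equiv_sym[OF assms]] by simp
  also have "\<dots> = [Inv g, Gen g] @ replicate k (Gen g)"
    by simp
  also have "\<dots> \<doteq> [] @ replicate k (Gen g)"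
    by (intro word_equiv_append word_equiv_cancel) auto
  finally show ?thesis by simp
qed

lemma Inv_Sigma_equiv: "[Inv Sigma_gen] \<doteq> replicate (2 ^ (n - 1) - 1) S"
  by (rule inv_letter_equiv) (simp add: word_equiv_rel quaternion_rels_def del: replicate_Suc)

lemma Inv_Tau_equiv: "[Inv Tau_gen] \<doteq> replicate 3 T"
  by (rule inv_letter_equiv) (simp add: word_equiv_rel quaternion_rels_def del: replicate_Suc)

lemma Tau_Tau_equiv: "[T, T] \<doteq> replicate (2 ^ (n - 2)) S"
proof -
  have "(replicate (2 ^ (n - 2)) S, [T, T]) \<in> quaternion_rels"
    by (simp add: quaternion_rels_def numeral_2_eq_2)
  then show ?thesis by (rule word_equiv_sym[OF word_equiv_rel])
qed

text \<open>The relator says \<open>S T = T S^-1\<close>, whereas collection has to move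
  \<open>S\<close> to the left across \<open>T\<close>. Multiplying by \<open>S^-1\<close> on the
  left and by \<open>S\<close> on the right gives \<open>T S = S^-1 T\<close>, and
  \<open>S^-1\<close> is then written as a positive power.\<close>

lemma Tau_Sigma_equiv: "[T, S] \<doteq> replicate (2 ^ (n - 1) - 1) S @ [T]"
proof -
  have "[S, T] \<doteq> [T] @ [Inv Tau_gen, S, T]"
    using word_equiv_append[OF word_equiv_sym[OF word_equiv_cancel(1)[of Tau_gen]]
      word_equiv_refl[of "[S, T]"]] by simp
  also have "\<dots> \<doteq> [T] @ [Inv Sigma_gen]"
    by (rule word_equiv_append[OF word_equiv_refl word_equiv_rel]) (simp add: quaternion_rels_def)
  finally have *: "[S, T] \<doteq> [T, Inv Sigma_gen]" by simp
  have "[T, S] \<doteq> [Inv Sigma_gen, S] @ [T, S]"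
    using word_equiv_append[OF word_equiv_sym[OF word_equiv_cancel(2)[of Sigma_gen]]
      word_equiv_refl[of "[T, S]"]] by simp
  also have "\<dots> \<doteq> [Inv Sigma_gen] @ [T, Inv Sigma_gen] @ [S]"
    using word_equiv_context[OF *, of "[Inv Sigma_gen]" "[S]"] by simp
  also have "\<dots> \<doteq> [Inv Sigma_gen, T] @ []"
    using word_equiv_append[OF word_equiv_refl[of "[Inv Sigma_gen, T]"]
      word_equiv_cancel(2)[of Sigma_gen]] by simp
  also have "\<dots> \<doteq> replicate (2 ^ (n - 1) - 1) S @ [T]"
    using word_equiv_append[OF Inv_Sigma_equiv word_equiv_refl[of "[T]"]] by simp
  finally show ?thesis .
qed

text \<open>Only the exponent of \<open>T\<close> is bounded here; that of \<open>S\<close> may grow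
  during collection and is reduced modulo \<open>2 ^ (n - 1)\<close> once, at the very end.\<close>

definition "has_normal_form w \<longleftrightarrow> (\<exists>i j. j < 2 \<and> w \<doteq> replicate i S @ replicate j T)"

lemma has_normal_formI:
  "j < 2 \<Longrightarrow> w \<doteq> replicate i S @ replicate j T \<Longrightarrow> has_normal_form w"
  unfolding has_normal_form_def by blast

lemma has_normal_form_equiv: "w \<doteq> v \<Longrightarrow> has_normal_form v \<Longrightarrow> has_normal_form w"
  unfolding has_normal_form_def using word_equiv_trans by blast

lemma has_normal_form_Gen:
  assumes "has_normal_form w"
  shows "has_normal_form (w @ [Gen g])"
proof -
  obtain i j where j: "j < 2" and w: "w \<doteq> replicate i S @ replicate j T"
    using assms by (auto simp: has_normal_form_def)
  have w': "w @ [Gen g] \<doteq> replicate i S @ replicate j T @ [Gen g]"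
    using word_equiv_append[OF w word_equiv_refl[of "[Gen g]"]] by simp
  consider "j = 0" "g = Sigma_gen" | "j = 0" "g = Tau_gen" | "j = 1" "g = Sigma_gen"
    | "j = 1" "g = Tau_gen"
    using j by (cases g) linarith+
  then have "has_normal_form (replicate i S @ replicate j T @ [Gen g])"
  proof cases
    case 1
    then show ?thesis
      by (intro has_normal_formI[of 0 _ "Suc i"]) (simp_all add: replicate_append_same)
  next
    case 2
    then show ?thesis
      by (intro has_normal_formI[of 1 _ i]) simp_all
  next
    case 3
    then show ?thesis
      using word_equiv_append[OF word_equiv_refl[of "replicate i S"] Tau_Sigma_equiv]
      by (intro has_normal_formI[of 1 _ "i + (2 ^ (n - 1) - 1)"])
        (simp_all add: replicate_add del: add_diff_assoc)
  next
    case 4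
    then show ?thesis
      using word_equiv_append[OF word_equiv_refl[of "replicate i S"] Tau_Tau_equiv]
      by (intro has_normal_formI[of 0 _ "i + 2 ^ (n - 2)"]) (simp_all add: replicate_add)
  qed
  then show ?thesis
    using has_normal_form_equiv[OF w'] by blast
qed

lemma has_normal_form_replicate:
  "has_normal_form w \<Longrightarrow> has_normal_form (w @ replicate k (Gen g))"
proof (induction k)
  case (Suc k)
  then show ?case
    using has_normal_form_Gen[of "w @ replicate k (Gen g)" g] by (simp add: replicate_append_same)
qed simp

lemma has_normal_form: "has_normal_form w"
proof (induction w rule: rev_induct)
  case Nil
  show ?case
    by (rule has_normal_formI[of 0 _ 0]) simp_all
next
  case (snoc l w)
  obtain k g where "[l] \<doteq> replicate k (Gen g)"
  proof (cases l)
    case (Gen g)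
    then show ?thesis using that[of 1 g] by simp
  next
    case (Inv g)
    then show ?thesis using that Inv_Sigma_equiv Inv_Tau_equiv by (cases g) auto
  qed
  then have "w @ [l] \<doteq> w @ replicate k (Gen g)"
    by (intro word_equiv_append) auto
  then show ?case
    using has_normal_form_equiv has_normal_form_replicate snoc by blast
qed

lemma normal_form:
  obtains i j where "i < 2 ^ (n - 1)" "j < 2" "w \<doteq> replicate i S @ replicate j T"
proof -
  let ?N = "2 ^ (n - 1) :: nat"
  obtain i j where j: "j < 2" and w: "w \<doteq> replicate i S @ replicate j T"
    using has_normal_form[of w] by (auto simp: has_normal_form_def)
  have mult: "replicate (?N * k) S \<doteq> []" for k
  proof (induction k)
    case (Suc k)
    have "replicate ?N S \<doteq> []"
      by (intro word_equiv_rel) (simp add: quaternion_rels_def)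
    then have "replicate ?N S @ replicate (?N * k) S \<doteq> [] @ []"
      using Suc by (intro word_equiv_append)
    then show ?case by (simp add: replicate_add)
  qed simp
  have "replicate i S = replicate (?N * (i div ?N)) S @ replicate (i mod ?N) S"
    by (metis replicate_add mult_div_mod_eq)
  also have "\<dots> \<doteq> [] @ replicate (i mod ?N) S"
    by (intro word_equiv_append mult) simp
  finally have "replicate i S @ replicate j T \<doteq> replicate (i mod ?N) S @ replicate j T"
    by (intro word_equiv_append) auto
  from word_equiv_trans[OF w this] j show ?thesis
    by (intro that[of "i mod ?N" j]) auto
qed

end

text \<open>There are at most \<open>2 ^ n\<close> normal forms, and their values in
  \<open>G\<close> are distinct: the exponent of \<open>\<tau>\<close> is determined by the coset of
  the subgroup generated by \<open>\<sigma>\<close>, and then that of \<open>\<sigma>\<close> by its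
  order. Hence words with equal values have equal normal forms, and evaluation induces an
  isomorphism.\<close>

lemma (in group) iso_generalised_quaternion:
  assumes n: "2 \<le> n" and [simp]: "\<sigma> \<in> carrier G" "\<tau> \<in> carrier G"
    and ord: "ord \<sigma> = 2 ^ (n - 1)" and square: "\<tau> \<otimes> \<tau> = \<sigma> [^] (2 ^ (n - 2) :: nat)"
    and conj: "inv \<tau> \<otimes> \<sigma> \<otimes> \<tau> = inv \<sigma>" and notin: "\<tau> \<notin> generate G {\<sigma>}"
    and carrier: "carrier G \<subseteq> range (\<lambda>i::nat. \<sigma> [^] i) \<union> range (\<lambda>i::nat. \<sigma> [^] i \<otimes> \<tau>)"
  shows "G \<cong> generalised_quaternion n"
proof -
  interpret quaternion_words n by standard (use n in simp)
  define \<phi> where "\<phi> = case_quaternion_gen \<sigma> \<tau>"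
  have \<phi>: "\<phi> g \<in> carrier G" for g
    by (cases g) (auto simp: \<phi>_def)
  let ?f = "word_eval G \<phi>"
  note eval = word_eval_append[of \<phi>, OF \<phi>] word_eval_replicate[of \<phi>, OF \<phi>]
  have N: "2 ^ (n - Suc 0) = 2 ^ (n - 2) + (2 ^ (n - 2) :: nat)"
    using n by (metis Suc_diff_Suc diff_Suc_1 mult_2 numeral_2_eq_2 power_Suc Suc_le_lessD)
  \<comment> \<open>Obtained by squaring \<open>square\<close>, since twice
    \<open>2 ^ (n - 2)\<close> is the order of \<open>\<sigma>\<close>.\<close>
  have \<tau>4: "\<tau> [^] (4 :: nat) = \<one>"
  proof -
    have "\<tau> [^] (4 :: nat) = (\<tau> \<otimes> \<tau>) \<otimes> (\<tau> \<otimes> \<tau>)"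
      by (simp add: numeral_eq_Suc m_assoc)
    also have "\<dots> = \<sigma> [^] ord \<sigma>"
      by (simp add: square nat_pow_mult ord N)
    finally show ?thesis by simp
  qed
  have pow: "?f (replicate k S) = \<sigma> [^] k" "?f (replicate k T) = \<tau> [^] k" for k
    by (simp_all add: eval) (simp_all add: \<phi>_def)
  have rels: "?f u = ?f v" if "(u, v) \<in> quaternion_rels" for u v
  proof -
    have "?f (replicate (2 ^ (n - 1)) S) = ?f []"
      using pow_ord_eq_1[of \<sigma>] by (simp add: pow ord)
    moreover have "?f (replicate 4 T) = ?f []"
      by (simp only: pow \<tau>4 word_eval_Nil)
    moreover have "?f (replicate (2 ^ (n - 2)) S) = ?f (replicate 2 T)"
      unfolding pow square[symmetric] by (simp add: numeral_2_eq_2)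
    moreover have "?f [Inv Tau_gen, S, T] = ?f [Inv Sigma_gen]"
      using conj by (simp add: \<phi>_def m_assoc)
    ultimately show ?thesis
      using that unfolding quaternion_rels_def by blast
  qed
  have nf: "?f (replicate i S @ replicate j T) = \<sigma> [^] i \<otimes> \<tau> [^] j" for i j
    by (simp only: eval(1) pow)
  have inj: "i = k \<and> j = l" if eq: "\<sigma> [^] i \<otimes> \<tau> [^] j = \<sigma> [^] k \<otimes> \<tau> [^] l"
    and less: "i < 2 ^ (n - 1)" "j < 2" "k < 2 ^ (n - 1)" "l < 2" for i j k l :: nat
  proof -
    have gen: "\<sigma> [^] i \<in> generate G {\<sigma>}" for i :: nat
      unfolding generate_pow[OF assms(2)] by (auto simp flip: int_pow_int)
    have sub: "subgroup (generate G {\<sigma>}) G"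
      by (simp add: generate_is_subgroup)
    have notin': "\<sigma> [^] i \<otimes> \<tau> \<notin> generate G {\<sigma>}" for i :: nat
    proof
      assume "\<sigma> [^] i \<otimes> \<tau> \<in> generate G {\<sigma>}"
      then have "inv (\<sigma> [^] i) \<otimes> (\<sigma> [^] i \<otimes> \<tau>) \<in> generate G {\<sigma>}"
        using subgroup.m_closed[OF sub subgroup.m_inv_closed[OF sub gen]] by blast
      then show False
        using notin by (simp flip: m_assoc)
    qed
    have "j = l"
    proof (rule ccontr)
      assume "j \<noteq> l"
      then consider "j = 0" "l = 1" | "j = 1" "l = 0"
        using less(2,4) by linarith
      then show False
        using eq notin'[of i] notin'[of k] gen[of i] gen[of k] by cases auto
    qed
    then have "\<sigma> [^] i = \<sigma> [^] k"
      using eq by (simp add: r_cancel)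
    then have "int i mod int (2 ^ (n - 1)) = int k mod int (2 ^ (n - 1))"
      using int_pow_eq[of \<sigma> "int i" "int k"] by (simp add: int_pow_int ord mod_eq_dvd_iff dvd_diff_commute)
    then have "i = k"
      using less by (simp flip: zmod_int of_nat_power)
    with \<open>j = l\<close> show ?thesis by simp
  qed
  have kernel: "?f u = ?f v \<longleftrightarrow> (u, v) \<in> word_rel quaternion_rels" for u v
  proof
    assume eq: "?f u = ?f v"
    obtain i j where i: "i < 2 ^ (n - 1)" "j < 2" "u \<doteq> replicate i S @ replicate j T"
      by (rule normal_form)
    obtain k l where k: "k < 2 ^ (n - 1)" "l < 2" "v \<doteq> replicate k S @ replicate l T"
      by (rule normal_form)
    have "?f u = \<sigma> [^] i \<otimes> \<tau> [^] j" "?f v = \<sigma> [^] k \<otimes> \<tau> [^] l"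
      using i(3) k(3) word_eval_word_rel[of \<phi> quaternion_rels, OF \<phi> rels] nf
      unfolding word_equiv_def by metis+
    then have "i = k \<and> j = l"
      using eq by (intro inj i k) simp
    then have "u \<doteq> v"
      using i(3) k(3) word_equiv_sym word_equiv_trans by blast
    then show "(u, v) \<in> word_rel quaternion_rels"
      by (simp add: word_equiv_def)
  qed (use word_eval_word_rel[of \<phi> quaternion_rels, OF \<phi> rels] in blast)
  have "range ?f = carrier G"
  proof (intro equalityI subsetI)
    fix s assume "s \<in> carrier G"
    then consider i :: nat where "s = \<sigma> [^] i" | i :: nat where "s = \<sigma> [^] i \<otimes> \<tau>"
      using carrier by blast
    then show "s \<in> range ?f"
    proof cases
      case 1
      then have "s = ?f (replicate i S @ replicate 0 T)"
        unfolding nf by simp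
      then show ?thesis by blast
    next
      case 2
      then have "s = ?f (replicate i S @ replicate 1 T)"
        unfolding nf by simp
      then show ?thesis by blast
    qed
  qed (auto simp: \<phi>)
  then have "G \<cong> presented_group quaternion_rels"
    using kernel eval(1) by (intro iso_presented_group[where f = ?f]) auto
  then show ?thesis
    by (simp add: generalised_quaternion_def quaternion_rels_def)
qed

section \<open>Subgroups generated by one element\<close>

lemma (in group) generate_iso_integer_mod_group:
  assumes x: "x \<in> carrier G" and ord: "ord x = m" and m: "0 < m"
  shows "G\<lparr>carrier := generate G {x}\<rparr> \<cong> integer_mod_group m"
proof -
  let ?K = "G\<lparr>carrier := generate G {x}\<rparr>"
  have carrier: "carrier (integer_mod_group m) = {0..<int m}"
    using m by (simp add: carrier_integer_mod_group)
  have pow_mod: "x [^] (i mod int m) = x [^] i" for i :: int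
    using x ord by (simp add: int_pow_eq dvd_minus_mod)
  have inj: "i = j" if "i \<in> {0..<int m}" "j \<in> {0..<int m}" "x [^] i = x [^] j" for i j :: int
    using that x ord by (auto simp: int_pow_eq mod_eq_dvd_iff[symmetric])
  have "(\<lambda>i::int. x [^] i) \<in> hom (integer_mod_group m) ?K"
    using x by (intro homI) (auto simp: generate_pow pow_mod int_pow_mult)
  moreover have "bij_betw (\<lambda>i::int. x [^] i) (carrier (integer_mod_group m)) (carrier ?K)"
    unfolding carrier
  proof (rule bij_betw_imageI)
    show "inj_on (\<lambda>i::int. x [^] i) {0..<int m}"
      using inj by (rule inj_onI)
    show "(\<lambda>i::int. x [^] i) ` {0..<int m} = carrier ?K"
    proof (intro equalityI subsetI)
      fix y assume "y \<in> carrier ?K"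
      then obtain i :: int where "y = x [^] i"
        using x by (auto simp: generate_pow)
      then have "y = x [^] (i mod int m)"
        by (simp add: pow_mod)
      then show "y \<in> (\<lambda>i::int. x [^] i) ` {0..<int m}"
        using m by (intro image_eqI) auto
    qed (use x in \<open>auto simp: generate_pow\<close>)
  qed
  ultimately have "integer_mod_group m \<cong> ?K"
    by (intro is_isoI isoI)
  then show ?thesis
    by (simp add: group.iso_sym)
qed

lemma (in group) generate_involution:
  assumes f: "f \<in> carrier G" and "f \<otimes> f = \<one>"
  shows "generate G {f} = {\<one>, f}"
proof
  have "inv f = f"
    using inv_unique'[OF f f] assms(2) by simp
  then have "subgroup {\<one>, f} G"
    using assms by (intro subgroupI) auto
  then show "generate G {f} \<subseteq> {\<one>, f}"
    by (intro generate_subgroup_incl) auto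
qed (auto intro: generate.intros)

section \<open>The holomorph as a group of affine maps\<close>

locale cyclic_two_group = group G for G (structure) +
  fixes a :: 'a and n :: nat
  assumes a_closed [simp]: "a \<in> carrier G"
    and carrier_generate: "carrier G = generate G {a}"
    and iso_integer_mod: "G \<cong> integer_mod_group (2 ^ n)"
    and n: "3 \<le> n"
begin

lemma card_carrier: "card (carrier G) = 2 ^ n"
  using iso_same_card[OF iso_integer_mod] by (simp add: carrier_integer_mod_group)

lemma ord_a: "ord a = 2 ^ n"
  using generate_pow_card[OF a_closed] card_carrier carrier_generate by simp

lemma pow_eq_iff: "a [^] (i :: int) = a [^] j \<longleftrightarrow> [i = j] (mod 2 ^ n)"
  by (simp add: int_pow_eq ord_a cong_iff_dvd_diff dvd_diff_commute)

lemma carrier_pow: "carrier G = range (\<lambda>i :: int. a [^] i)"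
  unfolding carrier_generate generate_pow[OF a_closed] by blast

lemma carrier_cases:
  assumes "g \<in> carrier G"
  obtains k :: int where "g = a [^] k"
  using assms unfolding carrier_pow by blast

text \<open>The parameters are plain integers, determined only modulo \<open>2 ^ n\<close>, so
  computations in the holomorph become integer arithmetic. Putting the translation last makes
  \<open>c\<close> readable as the exponent of the image of \<open>\<one>\<close>.\<close>

definition aff :: "int \<Rightarrow> int \<Rightarrow> 'a \<Rightarrow> 'a" where
  "aff c u = (\<lambda>g\<in>carrier G. g [^] u \<otimes> a [^] c)"

lemma aff_pow: "aff c u (a [^] (k :: int)) = a [^] (u * k + c)"
  by (simp add: aff_def int_pow_pow int_pow_mult mult.commute)

lemma aff_one: "aff c u \<one> = a [^] c"
  using aff_pow[of c u 0] by simp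

lemma aff_closed: "g \<in> carrier G \<Longrightarrow> aff c u g \<in> carrier G"
  by (simp add: aff_def)

lemma aff_extensional: "aff c u \<in> extensional (carrier G)"
  by (simp add: aff_def)

lemma extensional_eq_aff:
  assumes "f \<in> extensional (carrier G)" "\<And>k :: int. f (a [^] k) = a [^] (u * k + c)"
  shows "f = aff c u"
proof (rule extensionalityI[OF assms(1) aff_extensional])
  fix g assume "g \<in> carrier G"
  then show "f g = aff c u g"
    by (elim carrier_cases) (simp add: assms(2) aff_pow)
qed

lemma aff_eq_iff:
  "aff c u = aff d v \<longleftrightarrow> [c = d] (mod 2 ^ n) \<and> [u = v] (mod 2 ^ n)"
proof
  assume eq: "aff c u = aff d v"
  have "[c = d] (mod 2 ^ n)"
    using arg_cong[OF eq, of "\<lambda>f. f \<one>"] by (simp add: aff_one pow_eq_iff)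
  moreover have "[u + c = v + d] (mod 2 ^ n)"
    using arg_cong[OF eq, of "\<lambda>f. f (a [^] (1 :: int))"]
    by (simp only: aff_pow pow_eq_iff mult_1_right)
  ultimately show "[c = d] (mod 2 ^ n) \<and> [u = v] (mod 2 ^ n)"
    using cong_diff[of "u + c" "v + d" "2 ^ n" c d] by simp
next
  assume "[c = d] (mod 2 ^ n) \<and> [u = v] (mod 2 ^ n)"
  then show "aff c u = aff d v"
    by (intro extensional_eq_aff aff_extensional)
      (auto simp: aff_pow pow_eq_iff intro!: cong_add cong_mult)
qed

lemma compose_aff: "compose (carrier G) (aff d v) (aff c u) = aff (v * c + d) (u * v)"
proof (rule extensional_eq_aff)
  fix k :: int
  show "compose (carrier G) (aff d v) (aff c u) (a [^] k) = a [^] (u * v * k + (v * c + d))"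
    by (simp add: compose_eq aff_pow) (simp add: algebra_simps)
qed (rule compose_extensional)

lemma aff_0_1: "aff 0 1 = (\<lambda>g\<in>carrier G. g)"
  by (simp add: aff_def cong: restrict_cong)

lemma aff_Bij:
  assumes "odd u"
  shows "aff c u \<in> Bij (carrier G)"
proof -
  obtain v where v: "[u * v = 1] (mod 2 ^ n)"
    using odd_inverse_mod_pow2[OF assms] by blast
  have "[v * c + - v * c = 0] (mod 2 ^ n)" "[u * (- v * c) + c = 0] (mod 2 ^ n)"
    using cong_diff[OF cong_refl[of c] cong_scalar_right[OF v, of c]]
    by (simp_all add: algebra_simps)
  then have "compose (carrier G) (aff (- v * c) v) (aff c u) = aff 0 1"
    "compose (carrier G) (aff c u) (aff (- v * c) v) = aff 0 1"
    using v by (auto simp: compose_aff aff_eq_iff mult.commute simp del: mult_minus_left)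
  moreover define g' where "g' = aff (- v * c) v"
  ultimately have inverse: "g' (aff c u g) = g" "aff c u (g' g) = g" if "g \<in> carrier G" for g
    using that by (auto simp: aff_0_1 compose_def fun_eq_iff restrict_def dest!: spec[of _ g])
  have "bij_betw (aff c u) (carrier G) (carrier G)"
    using aff_closed[of _ "- v * c" v] unfolding g'_def[symmetric]
    by (intro bij_betw_byWitness[of _ g']) (auto simp: inverse aff_closed)
  then show ?thesis
    by (simp add: Bij_def aff_extensional)
qed

lemma auto_eq_aff:
  assumes "f \<in> auto G" "f a = a [^] (u :: int)"
  shows "f = aff 0 u" "odd u"
proof -
  have hom: "f \<in> hom G G" and Bij: "f \<in> Bij (carrier G)"
    using assms(1) by (auto simp: auto_def)
  have f: "f (a [^] k) = a [^] (u * k)" for k :: int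
  proof -
    interpret f: group_hom G G f
      using hom by unfold_locales
    show ?thesis
      by (simp add: f.hom_int_pow assms(2) int_pow_pow)
  qed
  then show "f = aff 0 u"
    using Bij by (intro extensional_eq_aff) (auto simp: Bij_def)
  show "odd u"
  proof
    \<comment> \<open>For even \<open>u\<close> the nontrivial element with exponent
      \<open>2 ^ (n - 1)\<close> would have the same image as the identity, against
      injectivity.\<close>
    assume "even u"
    then obtain v where "u = 2 * v" ..
    moreover have "(2 :: int) * 2 ^ (n - 1) = 2 ^ n"
      using n by (simp flip: power_Suc)
    ultimately have "u * 2 ^ (n - 1) = v * 2 ^ n"
      by (simp add: algebra_simps)
    then have "f (a [^] (2 ^ (n - 1) :: int)) = f (a [^] (0 :: int))"
      unfolding f by (simp add: pow_eq_iff cong_0_iff del: int_pow_0)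
    then have "a [^] (2 ^ (n - 1) :: int) = a [^] (0 :: int)"
      using Bij unfolding Bij_def bij_betw_def by (auto dest!: inj_onD)
    then have "(2 :: int) ^ n dvd 2 ^ (n - 1)"
      by (simp add: pow_eq_iff cong_0_iff del: int_pow_0)
    then show False
      using n by (auto dest!: zdvd_imp_le)
  qed
qed

lemma auto_eq: "auto G = {aff 0 u | u. odd u}"
proof (intro equalityI subsetI)
  fix f assume f: "f \<in> auto G"
  then have "f a \<in> carrier G"
    by (auto simp: auto_def hom_def)
  then obtain u :: int where "f a = a [^] u"
    by (rule carrier_cases)
  then show "f \<in> {aff 0 u | u. odd u}"
    using auto_eq_aff[OF f] by blast
next
  fix f assume "f \<in> {aff 0 u | u. odd u}"
  then obtain u where u: "f = aff 0 u" "odd u"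
    by blast
  have "aff 0 u \<in> hom G G"
  proof (rule homI)
    fix g h assume "g \<in> carrier G" "h \<in> carrier G"
    then show "aff 0 u (g \<otimes> h) = aff 0 u g \<otimes> aff 0 u h"
      by (elim carrier_cases) (simp add: aff_pow distrib_left flip: int_pow_mult)
  qed (rule aff_closed)
  then show "f \<in> auto G"
    using u aff_Bij by (simp add: auto_def)
qed

lemma right_translation_eq_aff: "right_translation G (a [^] (c :: int)) = aff c 1"
  by (simp add: right_translation_def aff_def cong: restrict_cong)

lemma right_regular_eq: "right_regular G = range (\<lambda>c. aff c 1)"
  unfolding right_regular_def carrier_pow image_image by (simp add: right_translation_eq_aff)

lemma mult_aff [simp]:
  assumes "odd u" "odd v"
  shows "aff c u \<otimes>\<^bsub>Hol G\<^esub> aff d v = aff (v * c + d) (u * v)"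
  using assms by (simp add: Hol_def right_sym_def aff_Bij compose_aff)

lemma carrier_Hol: "carrier (Hol G) = {aff c u | c u. odd u}"
proof -
  have "aff c 1 \<otimes>\<^bsub>right_sym (carrier G)\<^esub> aff 0 u = aff (u * c) u" if "odd u" for c u
    using that by (simp add: right_sym_def aff_Bij compose_aff)
  then have "(\<Union>u\<in>{u. odd u}. {aff c 1 \<otimes>\<^bsub>right_sym (carrier G)\<^esub> aff 0 u}) = (\<Union>u\<in>{u. odd u}. {aff (u * c) u})" for c
    by (intro SUP_cong) auto
  moreover have "auto G = aff 0 ` {u. odd u}"
    by (auto simp: auto_eq)
  ultimately have "carrier (Hol G) = (\<Union>c. \<Union>u\<in>{u. odd u}. {aff (u * c) u})"
    by (simp add: Hol_def set_mult_def right_regular_eq)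
  then have *: "carrier (Hol G) = {aff (u * c) u | c u. odd u}"
    by auto
  show ?thesis
  proof (intro equalityI subsetI)
    fix f assume "f \<in> {aff c u | c u. odd u}"
    then obtain c u where f: "f = aff c u" "odd u"
      by blast
    \<comment> \<open>The automorphism acts after the translation and multiplies its exponent by
      \<open>u\<close>; this \<open>d\<close> compensates for it.\<close>
    obtain d where "[u * d = c] (mod 2 ^ n)"
      using cong_mult_odd_solve[OF f(2)] by blast
    then have "f = aff (u * d) u"
      by (simp add: f aff_eq_iff cong_sym)
    then show "f \<in> carrier (Hol G)"
      using f(2) unfolding * by blast
  qed (auto simp: *)
qed

lemma one_Hol: "\<one>\<^bsub>Hol G\<^esub> = aff 0 1"
  by (simp add: Hol_def right_sym_def aff_0_1)

lemma aff_in_Hol [simp]: "odd u \<Longrightarrow> aff c u \<in> carrier (Hol G)"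
  by (auto simp: carrier_Hol)

lemma Hol_cases:
  assumes "f \<in> carrier (Hol G)"
  obtains c u where "f = aff c u" "odd u"
  using assms by (auto simp: carrier_Hol)

lemma inverse_aff:
  assumes "odd u"
  obtains v where "odd v" "[u * v = 1] (mod 2 ^ n)"
    "aff (- v * c) v \<otimes>\<^bsub>Hol G\<^esub> aff c u = \<one>\<^bsub>Hol G\<^esub>"
proof -
  obtain v where v: "odd v" "[u * v = 1] (mod 2 ^ n)"
    using odd_inverse_mod_pow2[OF assms] by blast
  have "[u * (- v * c) + c = 0] (mod 2 ^ n)"
    using cong_diff[OF cong_refl[of c] cong_scalar_right[OF v(2), of c]]
    by (simp add: algebra_simps)
  then show ?thesis
    using v assms that by (simp add: one_Hol aff_eq_iff mult.commute del: mult_minus_left)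
qed

sublocale Hol: group "Hol G"
proof (rule groupI)
  fix f g assume "f \<in> carrier (Hol G)" "g \<in> carrier (Hol G)"
  then show "f \<otimes>\<^bsub>Hol G\<^esub> g \<in> carrier (Hol G)"
    by (elim Hol_cases) simp
next
  fix f g h assume "f \<in> carrier (Hol G)" "g \<in> carrier (Hol G)" "h \<in> carrier (Hol G)"
  then show "f \<otimes>\<^bsub>Hol G\<^esub> g \<otimes>\<^bsub>Hol G\<^esub> h = f \<otimes>\<^bsub>Hol G\<^esub> (g \<otimes>\<^bsub>Hol G\<^esub> h)"
    by (elim Hol_cases) (simp add: algebra_simps)
next
  fix f assume f: "f \<in> carrier (Hol G)"
  then show "\<one>\<^bsub>Hol G\<^esub> \<otimes>\<^bsub>Hol G\<^esub> f = f"
    by (elim Hol_cases) (simp add: one_Hol)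
  from f show "\<exists>g\<in>carrier (Hol G). g \<otimes>\<^bsub>Hol G\<^esub> f = \<one>\<^bsub>Hol G\<^esub>"
    by (elim Hol_cases) (metis inverse_aff aff_in_Hol)
qed (simp add: one_Hol)

lemma nat_pow_aff:
  assumes "odd u"
  shows "aff c u [^]\<^bsub>Hol G\<^esub> (k :: nat) = aff (c * geo u k) (u ^ k)"
  using assms by (induction k) (simp_all add: one_Hol geo_Suc' algebra_simps)

lemma inv_aff:
  assumes "odd u" "odd v" "[u * v = 1] (mod 2 ^ n)"
  shows "inv\<^bsub>Hol G\<^esub> (aff c u) = aff (- v * c) v"
proof (rule Hol.inv_equality)
  have "[u * (- v * c) + c = 0] (mod 2 ^ n)"
    using cong_diff[OF cong_refl[of c] cong_scalar_right[OF assms(3), of c]]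
    by (simp add: algebra_simps)
  then show "aff (- v * c) v \<otimes>\<^bsub>Hol G\<^esub> aff c u = \<one>\<^bsub>Hol G\<^esub>"
    using assms by (simp add: one_Hol aff_eq_iff mult.commute del: mult_minus_left)
qed (use assms in auto)

section \<open>Regularity and conjugation\<close>

lemma Hol_mult_apply:
  assumes "f \<in> carrier (Hol G)" "g \<in> carrier (Hol G)" "p \<in> carrier G"
  shows "(f \<otimes>\<^bsub>Hol G\<^esub> g) p = g (f p)"
proof -
  obtain c u d v where "f = aff c u" "odd u" "g = aff d v" "odd v"
    using assms by (elim Hol_cases)
  moreover obtain k :: int where "p = a [^] k"
    using assms(3) by (rule carrier_cases)
  ultimately show ?thesis
    by (simp add: aff_pow) (simp add: algebra_simps)
qed

lemma Hol_closed: "f \<in> carrier (Hol G) \<Longrightarrow> p \<in> carrier G \<Longrightarrow> f p \<in> carrier G"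
  by (elim Hol_cases) (simp add: aff_closed)

lemma Hol_inv_apply:
  assumes "f \<in> carrier (Hol G)" "p \<in> carrier G"
  shows "(inv\<^bsub>Hol G\<^esub> f) (f p) = p" "f ((inv\<^bsub>Hol G\<^esub> f) p) = p"
  using Hol_mult_apply[of f "inv\<^bsub>Hol G\<^esub> f" p] Hol_mult_apply[of "inv\<^bsub>Hol G\<^esub> f" f p] assms
  by (simp_all add: one_Hol aff_0_1)

definition covering :: "('a \<Rightarrow> 'a) set \<Rightarrow> bool" where
  "covering R \<longleftrightarrow> (\<forall>c. \<exists>u. odd u \<and> aff c u \<in> R)"

text \<open>Only the stabiliser of \<open>\<one>\<close> is constrained. For a covering subgroup
  this carries over to all points by conjugation.\<close>

definition semiregular :: "('a \<Rightarrow> 'a) set \<Rightarrow> bool" where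
  "semiregular R \<longleftrightarrow> (\<forall>u. odd u \<longrightarrow> aff 0 u \<in> R \<longrightarrow> [u = 1] (mod 2 ^ n))"

text \<open>Testing at \<open>\<one>\<close> is enough: reaching every point from one point gives
  transitivity, and the stabilisers of points in one orbit are conjugate.\<close>

lemma regular_on_iff:
  assumes R: "subgroup R (Hol G)"
  shows "regular_on R (carrier G) \<longleftrightarrow> covering R \<and> semiregular R"
proof
  assume reg: "regular_on R (carrier G)"
  have "\<exists>u. odd u \<and> aff c u \<in> R" for c
  proof -
    obtain f where f: "f \<in> R" "f \<one> = a [^] c"
      using reg one_closed int_pow_closed[OF a_closed] unfolding regular_on_def by blast
    then obtain d u where du: "f = aff d u" "odd u"
      using subgroup.mem_carrier[OF R] by (metis Hol_cases)
    then have "f = aff c u"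
      using f(2) by (simp add: aff_eq_iff aff_one pow_eq_iff)
    then show ?thesis
      using f(1) du by blast
  qed
  moreover have "[u = 1] (mod 2 ^ n)" if "aff 0 u \<in> R" for u
  proof -
    have "aff 0 u \<one> = \<one>"
      by (simp add: aff_one)
    then have "aff 0 u = aff 0 1"
      using reg that unfolding regular_on_def aff_0_1 by blast
    then show ?thesis
      by (simp add: aff_eq_iff)
  qed
  ultimately show "covering R \<and> semiregular R"
    by (auto simp: covering_def semiregular_def)
next
  assume *: "covering R \<and> semiregular R"
  note mem = subgroup.mem_carrier[OF R]
  show "regular_on R (carrier G)"
    unfolding regular_on_def
  proof (intro conjI ballI impI)
    fix p q assume p: "p \<in> carrier G" and q: "q \<in> carrier G"
    then obtain i j :: int where ij: "p = a [^] i" "q = a [^] j"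
      by (elim carrier_cases)
    obtain u v where u: "odd u" "aff i u \<in> R" and v: "odd v" "aff j v \<in> R"
      using * unfolding covering_def by blast
    have "(inv\<^bsub>Hol G\<^esub> (aff i u)) p = \<one>"
      using Hol_inv_apply(1)[of "aff i u" \<one>] u by (simp add: aff_one ij)
    then have "(inv\<^bsub>Hol G\<^esub> (aff i u) \<otimes>\<^bsub>Hol G\<^esub> aff j v) p = q"
      using u v p by (simp add: Hol_mult_apply aff_one ij)
    moreover have "inv\<^bsub>Hol G\<^esub> (aff i u) \<otimes>\<^bsub>Hol G\<^esub> aff j v \<in> R"
      using R u v by (simp add: subgroup.m_closed subgroup.m_inv_closed)
    ultimately show "\<exists>f\<in>R. f p = q" by blast
  next
    fix p f assume p: "p \<in> carrier G" and f: "f \<in> R" "f p = p"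
    obtain i :: int where i: "p = a [^] i"
      using p by (rule carrier_cases)
    obtain u where u: "odd u" "aff i u \<in> R"
      using * unfolding covering_def by blast
    obtain d w where w: "f = aff d w" "odd w"
      using mem f by (metis Hol_cases)
    \<comment> \<open>Conjugating by a map that sends \<open>\<one>\<close> to \<open>p\<close>
      moves \<open>f\<close> into the stabiliser of \<open>\<one>\<close>.\<close>
    define h where "h = aff i u \<otimes>\<^bsub>Hol G\<^esub> f \<otimes>\<^bsub>Hol G\<^esub> inv\<^bsub>Hol G\<^esub> (aff i u)"
    have h: "h \<in> R"
      using R u f by (simp add: h_def subgroup.m_closed subgroup.m_inv_closed)
    have "h \<one> = \<one>"
      using Hol_inv_apply(1)[of "aff i u" \<one>] u f mem[OF f(1)]
      by (simp add: h_def Hol_mult_apply aff_one i[symmetric] Hol_closed)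
    obtain e z where e: "h = aff e z" "odd z"
      using mem h by (metis Hol_cases)
    then have "h = aff 0 z"
      using \<open>h \<one> = \<one>\<close> pow_eq_iff[of e 0] by (simp add: aff_eq_iff aff_one)
    then have "h = \<one>\<^bsub>Hol G\<^esub>"
      using * h \<open>odd z\<close> unfolding semiregular_def by (simp add: one_Hol aff_eq_iff)
    then have "f = \<one>\<^bsub>Hol G\<^esub>"
      using u mem[OF f(1)] Hol.inv_solve_right'[of "\<one>\<^bsub>Hol G\<^esub>" "aff i u \<otimes>\<^bsub>Hol G\<^esub> f" "aff i u"]
      by (simp add: h_def)
    then show "f = (\<lambda>w\<in>carrier G. w)"
      by (simp add: one_Hol aff_0_1)
  qed
qed

lemma semiregular_unique:
  assumes "subgroup R (Hol G)" "semiregular R" "odd u" "odd v" "aff c u \<in> R" "aff c v \<in> R"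
  shows "[u = v] (mod 2 ^ n)"
proof -
  obtain v' where v': "odd v'" "[v * v' = 1] (mod 2 ^ n)"
    using odd_inverse_mod_pow2[OF assms(4)] by blast
  have "aff c u \<otimes>\<^bsub>Hol G\<^esub> inv\<^bsub>Hol G\<^esub> (aff c v) = aff 0 (u * v')"
    using assms v' by (simp add: inv_aff)
  then have "aff 0 (u * v') \<in> R"
    using assms by (metis subgroup.m_closed subgroup.m_inv_closed)
  then have "[u * v' = 1] (mod 2 ^ n)"
    using assms(2,3) v'(1) by (simp add: semiregular_def)
  then have "[v' * u = v' * v] (mod 2 ^ n)"
    using v'(2) by (metis cong_sym cong_trans mult.commute)
  then show ?thesis
    using v'(1) by (simp add: cong_mult_odd_cancel)
qed

text \<open>\<open>R\<close> has at most one element for each translation part, and \<open>T\<close>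
  supplies one for each. So a regular subgroup equals any covering set found inside it, without
  counting and without knowing in advance that the set is a subgroup.\<close>

lemma covering_subset_eq:
  assumes "subgroup R (Hol G)" "semiregular R" "T \<subseteq> R" "covering T"
  shows "T = R"
proof (intro equalityI subsetI)
  fix f assume f: "f \<in> R"
  then obtain c u where u: "f = aff c u" "odd u"
    using assms(1) by (metis Hol_cases subgroup.mem_carrier)
  obtain v where v: "odd v" "aff c v \<in> T"
    using assms(4) unfolding covering_def by blast
  then have "[u = v] (mod 2 ^ n)"
    using semiregular_unique[of R u v c] assms f u by blast
  then show "f \<in> T"
    using v u by (metis aff_eq_iff cong_refl)
qed (use assms in blast)

lemma covering_mono: "covering T \<Longrightarrow> T \<subseteq> R \<Longrightarrow> covering R"
  unfolding covering_def by blast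

lemma card_regular:
  assumes "subgroup R (Hol G)" "regular_on R (carrier G)"
  shows "card R = 2 ^ n"
proof -
  have "bij_betw (\<lambda>f. f \<one>) R (carrier G)"
  proof (rule bij_betw_imageI)
    show "inj_on (\<lambda>f. f \<one>) R"
    proof (rule inj_onI)
      fix f g assume fg: "f \<in> R" "g \<in> R" "f \<one> = g \<one>"
      then obtain c u d v where *: "f = aff c u" "odd u" "g = aff d v" "odd v"
        using assms(1) by (metis Hol_cases subgroup.mem_carrier)
      then have "[c = d] (mod 2 ^ n)"
        using fg(3) by (simp add: aff_one pow_eq_iff)
      then have g: "g = aff c v"
        using * by (simp add: aff_eq_iff cong_sym)
      then have "[u = v] (mod 2 ^ n)"
        using semiregular_unique[of R u v c] * fg assms regular_on_iff by blast
      then show "f = g"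
        by (simp add: * g[unfolded *] aff_eq_iff)
    qed
    show "(\<lambda>f. f \<one>) ` R = carrier G"
    proof (intro equalityI subsetI)
      fix p assume "p \<in> carrier G"
      then obtain f where "f \<in> R" "f \<one> = p"
        using assms(2) unfolding regular_on_def by blast
      then show "p \<in> (\<lambda>f. f \<one>) ` R" by blast
    qed (use Hol_closed subgroup.mem_carrier[OF assms(1)] in auto)
  qed
  then show ?thesis
    using bij_betw_same_card card_carrier by metis
qed

section \<open>Conjugation and its invariants\<close>

lemma conj_aff:
  assumes "odd s" "odd u"
  shows "inv\<^bsub>Hol G\<^esub> (aff t s) \<otimes>\<^bsub>Hol G\<^esub> aff c u \<otimes>\<^bsub>Hol G\<^esub> aff t s = aff (s * c + (1 - u) * t) u"
proof -
  have "aff c u \<otimes>\<^bsub>Hol G\<^esub> aff t s = aff t s \<otimes>\<^bsub>Hol G\<^esub> aff (s * c + (1 - u) * t) u"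
    using assms by (simp add: algebra_simps)
  then show ?thesis
    using assms by (simp add: Hol.m_assoc Hol.inv_solve_left')
qed

abbreviation conjugate :: "('a \<Rightarrow> 'a) \<Rightarrow> ('a \<Rightarrow> 'a) set \<Rightarrow> ('a \<Rightarrow> 'a) set" where
  "conjugate \<equiv> conjugate_set (Hol G)"

lemma conj_inv:
  assumes "h \<in> carrier (Hol G)" "R \<subseteq> carrier (Hol G)"
  shows "conjugate (inv\<^bsub>Hol G\<^esub> h) (conjugate h R) = R"
proof -
  have "h \<otimes>\<^bsub>Hol G\<^esub> (inv\<^bsub>Hol G\<^esub> h \<otimes>\<^bsub>Hol G\<^esub> r \<otimes>\<^bsub>Hol G\<^esub> h) \<otimes>\<^bsub>Hol G\<^esub> inv\<^bsub>Hol G\<^esub> h = r" if "r \<in> R" for r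
  proof -
    have [simp]: "r \<in> carrier (Hol G)" "h \<in> carrier (Hol G)"
      using that assms by auto
    have "h \<otimes>\<^bsub>Hol G\<^esub> (inv\<^bsub>Hol G\<^esub> h \<otimes>\<^bsub>Hol G\<^esub> r \<otimes>\<^bsub>Hol G\<^esub> h) = r \<otimes>\<^bsub>Hol G\<^esub> h"
      by (simp flip: Hol.m_assoc)
    then show ?thesis
      by (simp add: Hol.m_assoc)
  qed
  then show ?thesis
    using assms by (simp add: conjugate_set_def image_image)
qed

lemma subgroup_conj:
  assumes h: "h \<in> carrier (Hol G)" and R: "subgroup R (Hol G)"
  shows "subgroup (conjugate h R) (Hol G)"
proof (rule Hol.subgroupI)
  note [simp] = subgroup.mem_carrier[OF R] h
  show "conjugate h R \<subseteq> carrier (Hol G)"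
    by (auto simp: conjugate_set_def)
  show "conjugate h R \<noteq> {}"
    using subgroup.one_closed[OF R] by (auto simp: conjugate_set_def)
  fix f assume "f \<in> conjugate h R"
  then obtain r where r: "r \<in> R" "f = inv\<^bsub>Hol G\<^esub> h \<otimes>\<^bsub>Hol G\<^esub> r \<otimes>\<^bsub>Hol G\<^esub> h"
    by (auto simp: conjugate_set_def)
  then have "inv\<^bsub>Hol G\<^esub> f = inv\<^bsub>Hol G\<^esub> h \<otimes>\<^bsub>Hol G\<^esub> inv\<^bsub>Hol G\<^esub> r \<otimes>\<^bsub>Hol G\<^esub> h"
    by (simp add: Hol.inv_mult_group Hol.m_assoc)
  then show "inv\<^bsub>Hol G\<^esub> f \<in> conjugate h R"
    using r subgroup.m_inv_closed[OF R] by (auto simp: conjugate_set_def)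
  fix g assume "g \<in> conjugate h R"
  then obtain s where s: "s \<in> R" "g = inv\<^bsub>Hol G\<^esub> h \<otimes>\<^bsub>Hol G\<^esub> s \<otimes>\<^bsub>Hol G\<^esub> h"
    by (auto simp: conjugate_set_def)
  have "h \<otimes>\<^bsub>Hol G\<^esub> (inv\<^bsub>Hol G\<^esub> h \<otimes>\<^bsub>Hol G\<^esub> (s \<otimes>\<^bsub>Hol G\<^esub> h)) = s \<otimes>\<^bsub>Hol G\<^esub> h"
    using s by (simp flip: Hol.m_assoc)
  then have "f \<otimes>\<^bsub>Hol G\<^esub> g = inv\<^bsub>Hol G\<^esub> h \<otimes>\<^bsub>Hol G\<^esub> (r \<otimes>\<^bsub>Hol G\<^esub> s) \<otimes>\<^bsub>Hol G\<^esub> h"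
    using r s by (simp add: Hol.m_assoc)
  then show "f \<otimes>\<^bsub>Hol G\<^esub> g \<in> conjugate h R"
    using r s subgroup.m_closed[OF R] by (auto simp: conjugate_set_def)
qed

lemma regular_conj:
  assumes h: "h \<in> carrier (Hol G)" and R: "subgroup R (Hol G)" and reg: "regular_on R (carrier G)"
  shows "regular_on (conjugate h R) (carrier G)"
  unfolding regular_on_def
proof (intro conjI ballI impI)
  note mem = subgroup.mem_carrier[OF R]
  have apply_conj: "(inv\<^bsub>Hol G\<^esub> h \<otimes>\<^bsub>Hol G\<^esub> r \<otimes>\<^bsub>Hol G\<^esub> h) p = h (r ((inv\<^bsub>Hol G\<^esub> h) p))"
    if "r \<in> R" "p \<in> carrier G" for r p
    using that h by (simp add: Hol_mult_apply mem Hol_closed)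
  {
    fix p q assume p: "p \<in> carrier G" and q: "q \<in> carrier G"
    then have "(inv\<^bsub>Hol G\<^esub> h) p \<in> carrier G" "(inv\<^bsub>Hol G\<^esub> h) q \<in> carrier G"
      using h by (simp_all add: Hol_closed)
    then obtain r where r: "r \<in> R" "r ((inv\<^bsub>Hol G\<^esub> h) p) = (inv\<^bsub>Hol G\<^esub> h) q"
      using reg unfolding regular_on_def by blast
    then have "(inv\<^bsub>Hol G\<^esub> h \<otimes>\<^bsub>Hol G\<^esub> r \<otimes>\<^bsub>Hol G\<^esub> h) p = q"
      using apply_conj p q h by (simp add: Hol_inv_apply)
    with r(1) show "\<exists>f\<in>conjugate h R. f p = q"
      by (auto simp: conjugate_set_def)
  }
  fix p f assume p: "p \<in> carrier G" and f: "f \<in> conjugate h R" "f p = p"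
  then obtain r where r: "r \<in> R" "f = inv\<^bsub>Hol G\<^esub> h \<otimes>\<^bsub>Hol G\<^esub> r \<otimes>\<^bsub>Hol G\<^esub> h"
    by (auto simp: conjugate_set_def)
  have p': "(inv\<^bsub>Hol G\<^esub> h) p \<in> carrier G"
    using h p by (simp add: Hol_closed)
  have "h (r ((inv\<^bsub>Hol G\<^esub> h) p)) = p"
    using apply_conj[OF r(1) p] f r by simp
  then have "r ((inv\<^bsub>Hol G\<^esub> h) p) = (inv\<^bsub>Hol G\<^esub> h) p"
    using Hol_inv_apply(1)[OF h, of "r ((inv\<^bsub>Hol G\<^esub> h) p)"] Hol_closed[OF mem[OF r(1)] p'] by simp
  then have "r = \<one>\<^bsub>Hol G\<^esub>"
    using reg r(1) p' unfolding regular_on_def one_Hol aff_0_1 by blast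
  then have "f = \<one>\<^bsub>Hol G\<^esub>"
    using r h by simp
  then show "f = (\<lambda>w\<in>carrier G. w)"
    by (simp add: one_Hol aff_0_1)
qed

lemma aff_mem_conj:
  assumes "odd s" "odd u" "aff c u \<in> R"
  shows "aff (s * c + (1 - u) * t) u \<in> conjugate (aff t s) R"
  using assms conj_aff[of s u t c] unfolding conjugate_set_def by force

text \<open>The multipliers are kept as integers: the set is a union of residue classes modulo
  \<open>2 ^ n\<close>, so one can ask directly whether it contains \<open>- 1\<close> or
  \<open>5\<close>.\<close>

definition linear_parts :: "('a \<Rightarrow> 'a) set \<Rightarrow> int set" where
  "linear_parts R = {u. odd u \<and> (\<exists>c. aff c u \<in> R)}"

lemma linear_parts_conj:
  assumes h: "h \<in> carrier (Hol G)" and R: "R \<subseteq> carrier (Hol G)"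
  shows "linear_parts (conjugate h R) = linear_parts R"
proof -
  have sub: "linear_parts R \<subseteq> linear_parts (conjugate h R)" if "h \<in> carrier (Hol G)" for h R
    using that by (elim Hol_cases) (auto simp: linear_parts_def intro: aff_mem_conj)
  have "inv\<^bsub>Hol G\<^esub> h \<in> carrier (Hol G)"
    using h by simp
  from sub[OF this, of "conjugate h R"] sub[OF h, of R] show ?thesis
    unfolding conj_inv[OF h R] by blast
qed

definition commuting :: "('a \<Rightarrow> 'a) set \<Rightarrow> bool" where
  "commuting R \<longleftrightarrow> (\<forall>f\<in>R. \<forall>g\<in>R. f \<otimes>\<^bsub>Hol G\<^esub> g = g \<otimes>\<^bsub>Hol G\<^esub> f)"

lemma commuting_conj:
  assumes h: "h \<in> carrier (Hol G)" and R: "R \<subseteq> carrier (Hol G)"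
  shows "commuting (conjugate h R) \<longleftrightarrow> commuting R"
proof -
  have mult: "(inv\<^bsub>Hol G\<^esub> h \<otimes>\<^bsub>Hol G\<^esub> r \<otimes>\<^bsub>Hol G\<^esub> h) \<otimes>\<^bsub>Hol G\<^esub> (inv\<^bsub>Hol G\<^esub> h \<otimes>\<^bsub>Hol G\<^esub> s \<otimes>\<^bsub>Hol G\<^esub> h)
      = inv\<^bsub>Hol G\<^esub> h \<otimes>\<^bsub>Hol G\<^esub> (r \<otimes>\<^bsub>Hol G\<^esub> s) \<otimes>\<^bsub>Hol G\<^esub> h"
    if [simp]: "r \<in> carrier (Hol G)" "s \<in> carrier (Hol G)" for r s
  proof -
    have "h \<otimes>\<^bsub>Hol G\<^esub> (inv\<^bsub>Hol G\<^esub> h \<otimes>\<^bsub>Hol G\<^esub> (s \<otimes>\<^bsub>Hol G\<^esub> h)) = s \<otimes>\<^bsub>Hol G\<^esub> h"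
      using h by (simp flip: Hol.m_assoc)
    then show ?thesis
      using h by (simp add: Hol.m_assoc)
  qed
  have "commuting (conjugate h R) \<longleftrightarrow> (\<forall>r\<in>R. \<forall>s\<in>R. inv\<^bsub>Hol G\<^esub> h \<otimes>\<^bsub>Hol G\<^esub> (r \<otimes>\<^bsub>Hol G\<^esub> s) \<otimes>\<^bsub>Hol G\<^esub> h
      = inv\<^bsub>Hol G\<^esub> h \<otimes>\<^bsub>Hol G\<^esub> (s \<otimes>\<^bsub>Hol G\<^esub> r) \<otimes>\<^bsub>Hol G\<^esub> h)"
    using R by (simp add: commuting_def conjugate_set_def mult subset_iff)
  also have "\<dots> \<longleftrightarrow> commuting R"
    unfolding commuting_def
  proof (intro ball_cong refl)
    fix r s assume "r \<in> R" "s \<in> R"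
    then have rs: "r \<otimes>\<^bsub>Hol G\<^esub> s \<in> carrier (Hol G)" "s \<otimes>\<^bsub>Hol G\<^esub> r \<in> carrier (Hol G)"
      using R by auto
    then show "inv\<^bsub>Hol G\<^esub> h \<otimes>\<^bsub>Hol G\<^esub> (r \<otimes>\<^bsub>Hol G\<^esub> s) \<otimes>\<^bsub>Hol G\<^esub> h
      = inv\<^bsub>Hol G\<^esub> h \<otimes>\<^bsub>Hol G\<^esub> (s \<otimes>\<^bsub>Hol G\<^esub> r) \<otimes>\<^bsub>Hol G\<^esub> h \<longleftrightarrow> r \<otimes>\<^bsub>Hol G\<^esub> s = s \<otimes>\<^bsub>Hol G\<^esub> r"
      using h Hol.m_closed[OF Hol.inv_closed[OF h] rs(1)] Hol.m_closed[OF Hol.inv_closed[OF h] rs(2)]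
      by (metis Hol.r_cancel Hol.l_cancel Hol.inv_closed)
  qed
  finally show ?thesis .
qed

section \<open>Cyclic subgroups and their two-coset extensions\<close>

text \<open>Finiteness makes element orders positive, so that a cyclic subgroup consists of natural
  powers, the form that \<open>geo\<close> describes.\<close>

lemma finite_Hol: "finite (carrier (Hol G))"
proof -
  have "carrier (Hol G) \<subseteq> (\<lambda>(c, u). aff c u) ` ({0..<2 ^ n} \<times> {0..<2 ^ n})"
  proof
    fix f assume "f \<in> carrier (Hol G)"
    then obtain c u where "f = aff c u"
      by (rule Hol_cases)
    then have "f = aff (c mod 2 ^ n) (u mod 2 ^ n)"
      by (simp add: aff_eq_iff)
    then show "f \<in> (\<lambda>(c, u). aff c u) ` ({0..<2 ^ n} \<times> {0..<2 ^ n})"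
      by (auto intro!: image_eqI[of _ _ "(c mod 2 ^ n, u mod 2 ^ n)"])
  qed
  then show ?thesis
    by (rule finite_subset) simp
qed

lemma generate_aff:
  assumes "odd u"
  shows "generate (Hol G) {aff c u} = {aff (c * geo u k) (u ^ k) | k :: nat. True}"
proof -
  have "Hol.ord (aff c u) \<noteq> 0"
    using Hol.ord_ge_1[OF finite_Hol aff_in_Hol[OF assms]] by (metis not_one_le_zero)
  then show ?thesis
    using assms by (auto simp: Hol.generate_pow_nat nat_pow_aff)
qed

lemma cong_mod_4:
  assumes "[u = v] (mod 2 ^ n)"
  shows "u mod 4 = v mod (4 :: int)"
proof -
  have "(4 :: int) dvd 2 ^ n"
    using le_imp_power_dvd[of 2 n "2 :: int"] n by simp
  with assms show ?thesis
    by (meson cong_def cong_dvd_modulus)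
qed

lemma cong_even_iff:
  assumes "[c = d] (mod 2 ^ n)"
  shows "even c \<longleftrightarrow> even (d :: int)"
  using cong_mod_4[OF assms] by presburger

lemma mem_generate_translation:
  assumes "j \<le> n"
  shows "aff d v \<in> generate (Hol G) {aff (2 ^ j) 1} \<longleftrightarrow> 2 ^ j dvd d \<and> [v = 1] (mod 2 ^ n)"
proof
  have dvd: "(2 :: int) ^ j dvd 2 ^ n"
    using assms by (rule le_imp_power_dvd)
  {
    assume "aff d v \<in> generate (Hol G) {aff (2 ^ j) 1}"
    then obtain k where "[d = 2 ^ j * int k] (mod 2 ^ n)" "[v = 1] (mod 2 ^ n)"
      by (auto simp: generate_aff aff_eq_iff)
    then show "2 ^ j dvd d \<and> [v = 1] (mod 2 ^ n)"
      using dvd cong_dvd_iff[OF cong_dvd_modulus[OF _ dvd]] by (metis dvd_triv_left)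
  }
  assume "2 ^ j dvd d \<and> [v = 1] (mod 2 ^ n)"
  then obtain b where b: "d = 2 ^ j * b" "[v = 1] (mod 2 ^ n)"
    by (auto elim: dvdE)
  have "[2 ^ j * b = 2 ^ j * int (nat (b mod 2 ^ n))] (mod 2 ^ n)"
    by (intro cong_scalar_left) (simp add: cong_def)
  then have "aff d v = aff (2 ^ j * geo 1 (nat (b mod 2 ^ n))) (1 ^ nat (b mod 2 ^ n))"
    using b by (simp add: aff_eq_iff)
  then show "aff d v \<in> generate (Hol G) {aff (2 ^ j) 1}"
    unfolding generate_aff[OF odd_one] by blast
qed

text \<open>A power of the generator is a translation iff \<open>2 ^ s * r' * geo w k\<close>
  vanishes modulo \<open>2 ^ n\<close>, that is, iff \<open>2 ^ (n - s)\<close> divides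
  \<open>geo w k\<close>; its translation part \<open>2 ^ e * r * geo w k\<close> then runs through
  the stated multiples. All intersections with \<open>right_regular G\<close> for nontrivial
  multipliers rest on this, with \<open>e = 0\<close> for cyclic groups and \<open>e = 1\<close> for
  the even part of the others.\<close>

lemma mem_generate_unipotent:
  assumes "odd r" "odd r'" "2 \<le> s" "s \<le> n" "e \<le> s" and w: "w = 1 + 2 ^ s * r'"
  shows "aff d 1 \<in> generate (Hol G) {aff (2 ^ e * r) w} \<longleftrightarrow> 2 ^ (e + n - s) dvd d"
proof -
  have "(4 :: int) dvd 2 ^ s"
    using le_imp_power_dvd[OF assms(3), of "2 :: int"] by simp
  then have w4: "w mod 4 = 1"
    using dvd_mult2[of 4 "2 ^ s" r'] unfolding w by presburger
  have pow: "[w ^ k = 1] (mod 2 ^ n) \<longleftrightarrow> 2 ^ (n - s) dvd geo w k" for k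
  proof -
    have "w - 1 = 2 ^ s * r'"
      by (simp add: w)
    then have "w ^ k - 1 = 2 ^ s * (r' * geo w k)"
      using power_eq_geo[of w k] by simp
    moreover have "(2 :: int) ^ n = 2 ^ s * 2 ^ (n - s)"
      using assms(4) by (simp flip: power_add)
    ultimately have "[w ^ k = 1] (mod 2 ^ n) \<longleftrightarrow> 2 ^ s * 2 ^ (n - s) dvd 2 ^ s * (r' * geo w k)"
      by (simp add: cong_iff_dvd_diff)
    also have "\<dots> \<longleftrightarrow> 2 ^ (n - s) dvd r' * geo w k"
      by simp
    also have "\<dots> \<longleftrightarrow> 2 ^ (n - s) dvd geo w k"
      using assms(2) by (intro coprime_dvd_mult_right_iff) auto
    finally show ?thesis .
  qed
  have exp: "(2 :: int) ^ (e + n - s) = 2 ^ e * 2 ^ (n - s)"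
    using assms(4) by (simp flip: power_add)
  show ?thesis
  proof
    assume "aff d 1 \<in> generate (Hol G) {aff (2 ^ e * r) w}"
    then obtain k where k: "[d = 2 ^ e * r * geo w k] (mod 2 ^ n)" "[w ^ k = 1] (mod 2 ^ n)"
      using odd_if_mod_4[OF w4] by (auto simp: generate_aff aff_eq_iff cong_sym)
    then have "2 ^ (n - s) dvd geo w k"
      using pow by blast
    then have "2 ^ (e + n - s) dvd 2 ^ e * r * geo w k"
      unfolding exp by (intro mult_dvd_mono) auto
    \<comment> \<open>Here \<open>e \<le> s\<close> matters: the divisor divides the modulus, so
      divisibility does not depend on the representative of \<open>d\<close>.\<close>
    moreover have "(2 :: int) ^ (e + n - s) dvd 2 ^ n"
      using assms(5) by (intro le_imp_power_dvd) simp
    ultimately show "2 ^ (e + n - s) dvd d"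
      using k(1) by (meson cong_dvd_iff cong_dvd_modulus)
  next
    assume "2 ^ (e + n - s) dvd d"
    then obtain b where b: "d = 2 ^ e * (2 ^ (n - s) * b)"
      unfolding exp by (auto simp: mult.assoc elim: dvdE)
    obtain d' where d': "[r * d' = b] (mod 2 ^ n)"
      using cong_mult_odd_solve[OF assms(1)] by blast
    obtain k where k: "[geo w k = 2 ^ (n - s) * d'] (mod 2 ^ n)"
      using geo_surj[OF w4] by blast
    have "[2 ^ e * r * geo w k = 2 ^ e * r * (2 ^ (n - s) * d')] (mod 2 ^ n)"
      by (intro cong_scalar_left k)
    also have "2 ^ e * r * (2 ^ (n - s) * d') = 2 ^ e * (2 ^ (n - s) * (r * d'))"
      by (simp add: algebra_simps)
    also have "[\<dots> = d] (mod 2 ^ n)"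
      unfolding b by (intro cong_scalar_left d')
    finally have "[2 ^ e * r * geo w k = d] (mod 2 ^ n)" .
    moreover have "[w ^ k = 1] (mod 2 ^ n)"
      unfolding pow using k le_imp_power_dvd[of "n - s" n "2 :: int"]
      by (meson cong_dvd_iff cong_dvd_modulus diff_le_self dvd_triv_left)
    ultimately have "aff d 1 = aff (2 ^ e * r * geo w k) (w ^ k)"
      by (simp add: aff_eq_iff cong_sym)
    then show "aff d 1 \<in> generate (Hol G) {aff (2 ^ e * r) w}"
      using odd_if_mod_4[OF w4] by (auto simp: generate_aff)
  qed
qed

context
  fixes r w :: int
  assumes r: "odd r" and w: "w mod 4 = 1"
begin

lemma odd_w [simp]: "odd w"
  using w by (rule odd_if_mod_4)

lemma covering_cyclic: "covering (generate (Hol G) {aff r w})"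
  unfolding covering_def
proof
  fix c
  obtain d where d: "[r * d = c] (mod 2 ^ n)"
    using cong_mult_odd_solve[OF r] by blast
  obtain k where "[geo w k = d] (mod 2 ^ n)"
    using geo_surj[OF w] by blast
  then have "aff c (w ^ k) = aff (r * geo w k) (w ^ k)"
    using cong_trans[OF cong_scalar_left d] by (simp add: aff_eq_iff cong_sym)
  then show "\<exists>u. odd u \<and> aff c u \<in> generate (Hol G) {aff r w}"
    by (intro exI[of _ "w ^ k"]) (auto simp: generate_aff)
qed

text \<open>If a power fixes \<open>\<one>\<close>, then \<open>2 ^ n\<close> divides its geometric
  sum, which is a factor of \<open>w ^ k - 1\<close>.\<close>

lemma semiregular_cyclic: "semiregular (generate (Hol G) {aff r w})"
  unfolding semiregular_def
proof (intro allI impI)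
  fix u assume "aff 0 u \<in> generate (Hol G) {aff r w}"
  then obtain k where k: "[0 = r * geo w k] (mod 2 ^ n)" "[u = w ^ k] (mod 2 ^ n)"
    by (auto simp: generate_aff aff_eq_iff)
  then have "2 ^ n dvd geo w k"
    using r by (simp add: cong_sym_eq[of 0] cong_0_iff coprime_dvd_mult_right_iff)
  then have "[w ^ k = 1] (mod 2 ^ n)"
    by (simp add: cong_iff_dvd_diff power_eq_geo[of w k])
  with k(2) show "[u = 1] (mod 2 ^ n)"
    by (rule cong_trans)
qed

lemma even_covering:
  assumes "even c"
  shows "\<exists>u. odd u \<and> aff c u \<in> generate (Hol G) {aff (2 * r) w}"
proof -
  obtain b where b: "c = 2 * b"
    using assms ..
  obtain d where d: "[r * d = b] (mod 2 ^ n)"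
    using cong_mult_odd_solve[OF r] by blast
  obtain k where "[geo w k = d] (mod 2 ^ n)"
    using geo_surj[OF w] by blast
  then have "[2 * (r * geo w k) = 2 * b] (mod 2 ^ n)"
    using cong_trans[OF cong_scalar_left d] by (intro cong_scalar_left)
  then have "aff c (w ^ k) = aff (2 * r * geo w k) (w ^ k)"
    by (simp add: aff_eq_iff b cong_sym mult.assoc)
  then show ?thesis
    by (intro exI[of _ "w ^ k"]) (auto simp: generate_aff)
qed

text \<open>The translation part of the \<open>k\<close>-th power vanishes once
  \<open>2 ^ (n - 1)\<close> divides \<open>geo w k\<close>; the factor of two still missing for
  \<open>w ^ k = 1\<close> is supplied by the even number \<open>w - 1\<close>.\<close>

lemma ord_even_generator: "Hol.ord (aff (2 * r) w) = 2 ^ (n - 1)"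
proof -
  have "aff (2 * r) w [^]\<^bsub>Hol G\<^esub> k = \<one>\<^bsub>Hol G\<^esub> \<longleftrightarrow> 2 ^ (n - 1) dvd k" for k :: nat
  proof -
    have two: "(2 :: int) ^ n = 2 * 2 ^ (n - 1)"
      using n by (simp flip: power_Suc)
    have "2 ^ n dvd 2 * r * geo w k \<longleftrightarrow> 2 ^ (n - 1) dvd r * geo w k"
      unfolding two mult.assoc by simp
    also have "\<dots> \<longleftrightarrow> 2 ^ (n - 1) dvd geo w k"
      using r by (intro coprime_dvd_mult_right_iff) auto
    finally have "[2 * r * geo w k = 0] (mod 2 ^ n) \<longleftrightarrow> 2 ^ (n - 1) dvd geo w k"
      by (simp add: cong_0_iff)
    moreover have "[w ^ k = 1] (mod 2 ^ n)" if "2 ^ (n - 1) dvd geo w k"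
    proof -
      have "2 dvd w - 1"
        using odd_w by simp
      then have "2 * 2 ^ (n - 1) dvd (w - 1) * geo w k"
        using that by (rule mult_dvd_mono)
      then show ?thesis
        by (simp add: cong_iff_dvd_diff power_eq_geo[of w k] two)
    qed
    ultimately show ?thesis
      by (auto simp: nat_pow_aff one_Hol aff_eq_iff simp flip: pow2_dvd_geo_iff[OF w])
  qed
  then show ?thesis
    using Hol.ord_unique[of "aff (2 * r) w" "2 ^ (n - 1)"] by simp
qed

end

section \<open>Two cosets of a cyclic group with even translations\<close>

lemma mem_generate_even:
  assumes "even c" "w mod 4 = 1" "aff d u \<in> generate (Hol G) {aff c w}"
  shows "even d" "u mod 4 = 1"
proof -
  obtain k where k: "[d = c * geo w k] (mod 2 ^ n)" "[u = w ^ k] (mod 2 ^ n)"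
    using assms(2,3) by (auto simp: generate_aff odd_if_mod_4 aff_eq_iff)
  show "even d"
    using cong_even_iff[OF k(1)] assms(1) by simp
  show "u mod 4 = 1"
    using cong_mod_4[OF k(2)] power_mod_4[OF assms(2)] by simp
qed

text \<open>A bare set, with no claim of closure under multiplication: covering and semiregularity
  concern only the listed elements, and the group structure comes from the subgroup it is compared
  with.\<close>

definition two_cosets :: "('a \<Rightarrow> 'a) set \<Rightarrow> ('a \<Rightarrow> 'a) \<Rightarrow> ('a \<Rightarrow> 'a) set" where
  "two_cosets N f = N \<union> (\<lambda>g. g \<otimes>\<^bsub>Hol G\<^esub> f) ` N"

text \<open>Parity of the translation part and the residue of the multiplier modulo 4 each tell the
  second coset from the first. The former test is applied to squares of odd elements, the latter to
  pure translations.\<close>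

lemma mem_second_coset:
  assumes "even c" "w mod 4 = 1" "odd d" "v mod 4 = 3"
    and "aff e u \<in> (\<lambda>g. g \<otimes>\<^bsub>Hol G\<^esub> aff d v) ` generate (Hol G) {aff c w}"
  shows "odd e" "u mod 4 = 3"
proof -
  have "odd v" "odd w"
    using assms(2,4) by presburger+
  obtain k where "aff e u = aff (c * geo w k) (w ^ k) \<otimes>\<^bsub>Hol G\<^esub> aff d v"
    using assms(5) \<open>odd w\<close> by (auto simp: generate_aff)
  then have k: "[e = v * (c * geo w k) + d] (mod 2 ^ n)" "[u = w ^ k * v] (mod 2 ^ n)"
    using \<open>odd v\<close> \<open>odd w\<close> by (simp_all add: aff_eq_iff)
  show "odd e"
    using cong_even_iff[OF k(1)] assms(1,3) by simp
  have "(w ^ k * v) mod 4 = 3"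
    using power_mod_4[OF assms(2), of k] assms(4) by (simp add: mod_mult_eq[of "w ^ k" 4 v, symmetric])
  then show "u mod 4 = 3"
    using cong_mod_4[OF k(2)] by simp
qed

lemma covering_two_cosets:
  assumes "odd r" "w mod 4 = 1" "odd d" "odd v"
  shows "covering (two_cosets (generate (Hol G) {aff (2 * r) w}) (aff d v))"
  unfolding covering_def
proof
  fix c
  let ?N = "generate (Hol G) {aff (2 * r) w}"
  show "\<exists>u. odd u \<and> aff c u \<in> two_cosets ?N (aff d v)"
  proof (cases "even c")
    case True
    then show ?thesis
      using even_covering[OF assms(1,2)] unfolding two_cosets_def by blast
  next
    case False
    \<comment> \<open>Composing a map of translation part \<open>e\<close> with
      \<open>aff d v\<close> gives translation part \<open>v * e + d\<close>. As \<open>c\<close>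
      and \<open>d\<close> are odd, this \<open>e\<close> is even and hence available in the first
      coset.\<close>
    obtain e where e: "[v * e = c - d] (mod 2 ^ n)"
      using cong_mult_odd_solve[OF assms(4)] by blast
    have "even e"
      using cong_even_iff[OF e] False assms(3,4) by simp
    then obtain u where u: "odd u" "aff e u \<in> ?N"
      using even_covering[OF assms(1,2)] by blast
    have "[v * e + d = c] (mod 2 ^ n)"
      using cong_add[OF e cong_refl[of d]] by simp
    then have "aff e u \<otimes>\<^bsub>Hol G\<^esub> aff d v = aff c (u * v)"
      using u assms(4) by (simp add: aff_eq_iff)
    then have "aff c (u * v) \<in> two_cosets ?N (aff d v)"
      using u(2) unfolding two_cosets_def by (metis UnI2 image_eqI)
    then show ?thesis
      using u(1) assms(4) by (intro exI[of _ "u * v"]) simp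
  qed
qed

lemma semiregular_two_cosets:
  assumes "odd r" "w mod 4 = 1" "odd d" "v mod 4 = 3"
  shows "semiregular (two_cosets (generate (Hol G) {aff (2 * r) w}) (aff d v))"
  unfolding semiregular_def
proof (intro allI impI)
  fix u assume "aff 0 u \<in> two_cosets (generate (Hol G) {aff (2 * r) w}) (aff d v)"
  then have "aff 0 u \<in> generate (Hol G) {aff (2 * r) w}"
    using mem_second_coset(1)[of "2 * r" w d v 0 u] assms by (auto simp: two_cosets_def)
  then obtain k where k: "aff 0 u = aff (2 * r) w [^]\<^bsub>Hol G\<^esub> (k :: nat)"
    using assms(2) by (auto simp: generate_aff odd_if_mod_4 nat_pow_aff)
  then have "[2 * r * geo w k = 0] (mod 2 ^ n)" "[u = w ^ k] (mod 2 ^ n)"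
    using assms(2) by (auto simp: nat_pow_aff odd_if_mod_4 aff_eq_iff cong_sym)
  moreover have "(2 :: int) ^ n = 2 * 2 ^ (n - 1)"
    using n by (simp flip: power_Suc)
  ultimately have "2 ^ (n - 1) dvd r * geo w k"
    by (simp add: cong_0_iff mult.assoc)
  then have "2 ^ (n - 1) dvd geo w k"
    using assms(1) by (simp add: coprime_dvd_mult_right_iff)
  then have "2 ^ (n - 1) dvd k"
    by (simp add: pow2_dvd_geo_iff[OF assms(2)])
  then have "aff (2 * r) w [^]\<^bsub>Hol G\<^esub> k = \<one>\<^bsub>Hol G\<^esub>"
    using assms(2) ord_even_generator[OF assms(1,2)]
    by (subst Hol.pow_eq_id) (simp_all add: odd_if_mod_4)
  then show "[u = 1] (mod 2 ^ n)"
    using k by (simp add: one_Hol aff_eq_iff)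
qed

lemma two_cosets_subset:
  assumes "subgroup R (Hol G)" "g \<in> R" "f \<in> R"
  shows "two_cosets (generate (Hol G) {g}) f \<subseteq> R"
proof -
  have "generate (Hol G) {g} \<subseteq> R"
    using assms by (intro Hol.generate_subgroup_incl) auto
  then show ?thesis
    using assms by (auto simp: two_cosets_def subgroup.m_closed)
qed

lemma regular_eq_two_cosets:
  assumes "subgroup R (Hol G)" "regular_on R (carrier G)"
    and "odd r" "w mod 4 = 1" "odd d" "odd v" "aff (2 * r) w \<in> R" "aff d v \<in> R"
  shows "R = two_cosets (generate (Hol G) {aff (2 * r) w}) (aff d v)"
  using covering_subset_eq[OF assms(1) _ two_cosets_subset covering_two_cosets] assms regular_on_iff
  by blast

lemma regular_eq_cyclic:
  assumes "subgroup R (Hol G)" "regular_on R (carrier G)" "odd c" "w mod 4 = 1" "aff c w \<in> R"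
  shows "R = generate (Hol G) {aff c w}"
proof -
  have "generate (Hol G) {aff c w} \<subseteq> R"
    using assms by (intro Hol.generate_subgroup_incl) auto
  then show ?thesis
    using covering_subset_eq[OF assms(1) _ _ covering_cyclic] assms regular_on_iff by blast
qed

lemma generate_two_cosets:
  assumes f: "f \<in> carrier (Hol G)" and "f \<otimes>\<^bsub>Hol G\<^esub> f = \<one>\<^bsub>Hol G\<^esub>" and N: "N \<subseteq> carrier (Hol G)"
  shows "N <#>\<^bsub>Hol G\<^esub> generate (Hol G) {f} = two_cosets N f"
  unfolding Hol.generate_involution[OF assms(1,2)] two_cosets_def set_mult_def
  using N by (auto simp: subset_iff image_iff)

lemma intersection_right_regular:
  assumes "j \<le> n" and "\<And>c. aff c 1 \<in> S \<longleftrightarrow> 2 ^ j dvd c"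
  shows "S \<inter> right_regular G = generate (Hol G) {right_translation G (a [^] ((2 :: nat) ^ j))}"
proof -
  have "a [^] ((2 :: nat) ^ j) = a [^] (2 ^ j :: int)"
    by (simp flip: int_pow_int)
  then have "right_translation G (a [^] ((2 :: nat) ^ j)) = aff (2 ^ j) 1"
    by (simp only: right_translation_eq_aff)
  moreover have "f \<in> S \<inter> right_regular G \<longleftrightarrow> f \<in> generate (Hol G) {aff (2 ^ j) 1}" for f
  proof -
    have "f \<in> S \<inter> right_regular G \<longleftrightarrow> (\<exists>c. f = aff c 1 \<and> 2 ^ j dvd c)"
      using assms(2) by (auto simp: right_regular_eq)
    also have "\<dots> \<longleftrightarrow> f \<in> generate (Hol G) {aff (2 ^ j) 1}"
    proof
      assume f: "f \<in> generate (Hol G) {aff (2 ^ j) 1}"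
      then obtain k :: nat where "f = aff (2 ^ j * geo 1 k) (1 ^ k)"
        unfolding generate_aff[OF odd_one] by blast
      then show "\<exists>c. f = aff c 1 \<and> 2 ^ j dvd c"
        by auto
    qed (use mem_generate_translation[OF assms(1), of _ 1] in auto)
    finally show ?thesis .
  qed
  ultimately show ?thesis
    by auto
qed

lemma mem_two_cosets_mod_4:
  assumes "even c" "w mod 4 = 1" "odd d" "v mod 4 = 3" "u mod 4 = 1"
  shows "aff e u \<in> two_cosets (generate (Hol G) {aff c w}) (aff d v) \<longleftrightarrow>
    aff e u \<in> generate (Hol G) {aff c w}"
  using mem_second_coset(2)[of c w d v e u] assms by (auto simp: two_cosets_def)

lemma mem_two_cosets_even:
  assumes "even c" "w mod 4 = 1" "odd d" "v mod 4 = 3" "even e"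
  shows "aff e u \<in> two_cosets (generate (Hol G) {aff c w}) (aff d v) \<longleftrightarrow>
    aff e u \<in> generate (Hol G) {aff c w}"
  using mem_second_coset(1)[of c w d v e u] assms by (auto simp: two_cosets_def)

section \<open>Structure of a regular subgroup with an even and an odd generator\<close>

context
  fixes S r w d v
  assumes S: "subgroup S (Hol G)" and regular: "regular_on S (carrier G)"
    and r: "odd r" and w: "w mod 4 = 1" and g: "aff (2 * r) w \<in> S"
    and d: "odd d" and v: "v mod 4 = 3" and f: "aff d v \<in> S"
begin

lemma odd_linear: "odd w" "odd v"
  using v w by presburger+

lemma S_eq: "S = two_cosets (generate (Hol G) {aff (2 * r) w}) (aff d v)"
  using regular_eq_two_cosets[OF S regular r w d odd_linear(2) g f] .

lemma mem_S_even: "even e \<Longrightarrow> aff e u \<in> S \<longleftrightarrow> aff e u \<in> generate (Hol G) {aff (2 * r) w}"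
  unfolding S_eq by (rule mem_two_cosets_even) (use w d v in auto)

lemma mem_S_mod_4: "u mod 4 = 1 \<Longrightarrow> aff e u \<in> S \<longleftrightarrow> aff e u \<in> generate (Hol G) {aff (2 * r) w}"
  unfolding S_eq by (rule mem_two_cosets_mod_4) (use w d v in auto)

lemma group_S: "group (Hol G\<lparr>carrier := S\<rparr>)"
  using S by (rule Hol.subgroup_imp_group)

lemma generate_sub: "generate (Hol G) {aff (2 * r) w} \<subseteq> S"
  using S g by (intro Hol.generate_subgroup_incl) auto

text \<open>By \<open>mem_S_even\<close> the cyclic part is cut out of \<open>S\<close> by parity of
  the translation part. Conjugation turns an even \<open>e\<close> into
  \<open>u' * ((z - 1) * c + e)\<close>, which is even because \<open>z\<close> is odd.\<close>

lemma even_part_normal: "generate (Hol G) {aff (2 * r) w} \<lhd> Hol G\<lparr>carrier := S\<rparr>"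
proof -
  let ?N = "generate (Hol G) {aff (2 * r) w}"
  have N: "subgroup ?N (Hol G)"
    using odd_linear by (intro Hol.generate_is_subgroup) simp
  have "x \<otimes>\<^bsub>Hol G\<^esub> h \<otimes>\<^bsub>Hol G\<^esub> inv\<^bsub>Hol G\<^esub> x \<in> ?N" if x: "x \<in> S" and h: "h \<in> ?N" for x h
  proof -
    obtain c u where cu: "x = aff c u" "odd u"
      using subgroup.mem_carrier[OF S x] by (rule Hol_cases)
    obtain e z where ez: "h = aff e z" "odd z"
      using subgroup.mem_carrier[OF N h] by (rule Hol_cases)
    obtain u' where u': "odd u'" "[u * u' = 1] (mod 2 ^ n)"
      using odd_inverse_mod_pow2[OF cu(2)] by blast
    have "even e"
      using mem_generate_even(1)[of "2 * r" w e z] w h ez by simp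
    have eq: "x \<otimes>\<^bsub>Hol G\<^esub> h \<otimes>\<^bsub>Hol G\<^esub> inv\<^bsub>Hol G\<^esub> x = aff (u' * (z * c + e) + - u' * c) (u * z * u')"
      using cu ez u' inv_aff[OF cu(2) u', of c] by simp
    have "x \<otimes>\<^bsub>Hol G\<^esub> h \<otimes>\<^bsub>Hol G\<^esub> inv\<^bsub>Hol G\<^esub> x \<in> S"
      using x h generate_sub by (intro subgroup.m_closed[OF S] subgroup.m_inv_closed[OF S]) auto
    then show ?thesis
      using ez(2) u'(1) \<open>even e\<close> unfolding eq by (subst mem_S_even[symmetric]) auto
  qed
  then show ?thesis
    using generate_sub
    by (auto simp: group.normal_inv_iff[OF group_S] Hol.m_inv_consistent[OF S]
        intro!: Hol.subgroup_incl[OF N S])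
qed

lemma internal_semidirect_S:
  assumes inv: "aff d v \<otimes>\<^bsub>Hol G\<^esub> aff d v = \<one>\<^bsub>Hol G\<^esub>"
  shows "internal_semidirect (Hol G) S (generate (Hol G) {aff (2 * r) w}) (generate (Hol G) {aff d v})"
  unfolding internal_semidirect_def
proof (intro conjI)
  let ?N = "generate (Hol G) {aff (2 * r) w}" and ?K = "generate (Hol G) {aff d v}"
  have f': "aff d v \<in> carrier (Hol G)"
    using odd_linear by simp
  show "?N \<lhd> Hol G\<lparr>carrier := S\<rparr>"
    by (rule even_part_normal)
  have "?K \<subseteq> S"
    using S f by (intro Hol.generate_subgroup_incl) auto
  then show "subgroup ?K (Hol G\<lparr>carrier := S\<rparr>)"
    using f' by (intro Hol.subgroup_incl[OF _ S] Hol.generate_is_subgroup) auto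
  have "aff d v \<notin> ?N"
    using mem_generate_even(1)[of "2 * r" w d v] w d by auto
  then show "?N \<inter> ?K = {\<one>\<^bsub>Hol G\<^esub>}"
    unfolding Hol.generate_involution[OF f' inv] by (auto intro: generate.one)
  show "?N <#>\<^bsub>Hol G\<^esub> ?K = S"
    using generate_sub subgroup.subset[OF S] by (subst generate_two_cosets[OF f' inv]) (auto simp: S_eq[symmetric])
qed

lemma internal_direct_S:
  assumes inv: "aff d v \<otimes>\<^bsub>Hol G\<^esub> aff d v = \<one>\<^bsub>Hol G\<^esub>" and comm: "commuting S"
  shows "internal_direct (Hol G) S (generate (Hol G) {aff (2 * r) w}) (generate (Hol G) {aff d v})"
proof -
  let ?K = "generate (Hol G) {aff d v}"
  have semi: "internal_semidirect (Hol G) S (generate (Hol G) {aff (2 * r) w}) ?K"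
    using inv by (rule internal_semidirect_S)
  then have K: "subgroup ?K (Hol G\<lparr>carrier := S\<rparr>)"
    by (simp add: internal_semidirect_def)
  have "x \<otimes>\<^bsub>Hol G\<^esub> h \<otimes>\<^bsub>Hol G\<^esub> inv\<^bsub>Hol G\<^esub> x = h" if "x \<in> S" "h \<in> S" for x h
  proof -
    have [simp]: "x \<in> carrier (Hol G)" "h \<in> carrier (Hol G)"
      using that subgroup.mem_carrier[OF S] by auto
    have "x \<otimes>\<^bsub>Hol G\<^esub> h = h \<otimes>\<^bsub>Hol G\<^esub> x"
      using comm that unfolding commuting_def by blast
    then show ?thesis
      by (simp add: Hol.m_assoc)
  qed
  moreover have "?K \<subseteq> S"
    using subgroup.subset[OF K] by simp
  ultimately have "?K \<lhd> Hol G\<lparr>carrier := S\<rparr>"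
    using K by (auto simp: group.normal_inv_iff[OF group_S] Hol.m_inv_consistent[OF S] subset_iff)
  with semi show ?thesis
    by (simp add: internal_semidirect_def internal_direct_def)
qed

lemma cyclic_index_two_with_S:
  assumes inv: "aff d v \<otimes>\<^bsub>Hol G\<^esub> aff d v = \<one>\<^bsub>Hol G\<^esub>"
    and rel: "inv\<^bsub>Hol G\<^esub> (aff d v) \<otimes>\<^bsub>Hol G\<^esub> aff (2 * r) w \<otimes>\<^bsub>Hol G\<^esub> aff d v = aff (2 * r) w [^]\<^bsub>Hol G\<^esub> k"
  shows "cyclic_index_two_with n k (Hol G\<lparr>carrier := S\<rparr>)"
proof -
  interpret K: group "Hol G\<lparr>carrier := S\<rparr>"
    by (rule group_S)
  let ?K = "Hol G\<lparr>carrier := S\<rparr>"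
  let ?g = "aff (2 * r) w" and ?f = "aff d v"
  have gen: "generate ?K {x} = generate (Hol G) {x}" if "x \<in> S" for x
    using that by (intro Hol.generate_consistent[OF _ S]) simp
  have order: "order ?K = 2 ^ n"
    using card_regular[OF S regular] by (simp add: order_def)
  have card: "card (generate ?K {?g}) = 2 ^ (n - 1)"
    using ord_even_generator[OF r w] odd_linear g by (simp add: gen Hol.generate_pow_card)
  have "subgroup (generate ?K {?g}) ?K"
    using g by (intro K.generate_is_subgroup) simp
  then have "card (rcosets\<^bsub>?K\<^esub> generate ?K {?g}) * 2 ^ (n - 1) = 2 * 2 ^ (n - 1)"
    using K.lagrange[of "generate ?K {?g}"] n unfolding card order by (simp flip: power_Suc)
  then have rcosets: "card (rcosets\<^bsub>?K\<^esub> generate ?K {?g}) = 2"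
    by simp
  have notin: "?f \<notin> generate ?K {?g}"
    using mem_generate_even(1)[of "2 * r" w d v] w d g by (auto simp: gen)
  have "?f \<noteq> \<one>\<^bsub>Hol G\<^esub>"
    using notin K.generate_is_subgroup[of "{?g}"] g subgroup.one_closed by force
  then have "card {\<one>\<^bsub>Hol G\<^esub>, ?f} = 2"
    by simp
  then have "K.ord ?f = 2"
    using Hol.generate_involution[OF _ inv] odd_linear f
    by (subst K.generate_pow_card) (simp_all add: gen)
  moreover have "inv\<^bsub>?K\<^esub> ?f \<otimes>\<^bsub>?K\<^esub> ?g \<otimes>\<^bsub>?K\<^esub> ?f = ?g [^]\<^bsub>?K\<^esub> k"
    using rel S f g by (simp flip: Hol.int_pow_consistent)
  ultimately show ?thesis
    unfolding cyclic_index_two_with_def using K.is_group order rcosets notin f g by auto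
qed

lemma iso_generalised_quaternion_S:
  assumes square: "aff d v \<otimes>\<^bsub>Hol G\<^esub> aff d v = aff (2 * r) w [^]\<^bsub>Hol G\<^esub> ((2 :: nat) ^ (n - 2))"
    and rel: "inv\<^bsub>Hol G\<^esub> (aff d v) \<otimes>\<^bsub>Hol G\<^esub> aff (2 * r) w \<otimes>\<^bsub>Hol G\<^esub> aff d v = inv\<^bsub>Hol G\<^esub> (aff (2 * r) w)"
  shows "Hol G\<lparr>carrier := S\<rparr> \<cong> generalised_quaternion n"
proof -
  interpret K: group "Hol G\<lparr>carrier := S\<rparr>"
    by (rule group_S)
  let ?K = "Hol G\<lparr>carrier := S\<rparr>"
  let ?g = "aff (2 * r) w" and ?f = "aff d v"
  have g': "?g \<in> carrier (Hol G)"
    using odd_linear by simp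
  have gen: "generate ?K {?g} = generate (Hol G) {?g}"
    using g by (intro Hol.generate_consistent[OF _ S]) simp
  have N: "generate (Hol G) {?g} = range (\<lambda>i :: nat. ?g [^]\<^bsub>Hol G\<^esub> i)"
    using odd_linear by (auto simp: generate_aff nat_pow_aff)
  show ?thesis
  proof (rule K.iso_generalised_quaternion)
    show "K.ord ?g = 2 ^ (n - 1)"
      using ord_even_generator[OF r w] g g' by (simp add: K.generate_pow_card gen Hol.generate_pow_card)
    show "?f \<otimes>\<^bsub>?K\<^esub> ?f = ?g [^]\<^bsub>?K\<^esub> ((2 :: nat) ^ (n - 2))"
      using square by (simp flip: Hol.nat_pow_consistent)
    show "inv\<^bsub>?K\<^esub> ?f \<otimes>\<^bsub>?K\<^esub> ?g \<otimes>\<^bsub>?K\<^esub> ?f = inv\<^bsub>?K\<^esub> ?g"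
      using rel S f g by simp
    show "?f \<notin> generate ?K {?g}"
      using mem_generate_even(1)[of "2 * r" w d v] w d by (auto simp: gen)
    show "carrier ?K \<subseteq> range (\<lambda>i :: nat. ?g [^]\<^bsub>?K\<^esub> i) \<union> range (\<lambda>i :: nat. ?g [^]\<^bsub>?K\<^esub> i \<otimes>\<^bsub>?K\<^esub> ?f)"
      using S_eq by (auto simp: two_cosets_def N simp flip: Hol.nat_pow_consistent)
  qed (use n g f in auto)
qed

end

section \<open>The seven types\<close>

text \<open>A quarter of the modulus. With \<open>2 ^ n = 4 * M\<close>, the congruences below
  become polynomial identities in \<open>M\<close>, and the last argument given to
  \<open>congI\<close> is the explicit quotient by \<open>4 * M\<close>.\<close>

definition M :: int where
  "M = 2 ^ (n - 2)"

lemma pow_n: "(2 :: int) ^ n = 4 * M" "(2 :: int) ^ (n - 1) = 2 * M"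
proof -
  have "4 * M = 2 ^ (2 + (n - 2))" "2 * M = 2 ^ (1 + (n - 2))"
    by (simp_all add: M_def power_add)
  moreover have "2 + (n - 2) = n" "1 + (n - 2) = n - 1"
    using n by simp_all
  ultimately show "(2 :: int) ^ n = 4 * M" "(2 :: int) ^ (n - 1) = 2 * M"
    by metis+
qed

lemma even_M: "even M"
  using n by (simp add: M_def)

lemma four_dvd_M: "4 \<le> n \<Longrightarrow> 4 dvd M"
  using le_imp_power_dvd[of 2 "n - 2" "2 :: int"] by (simp add: M_def)

lemma M_ge: "2 \<le> M"
proof -
  have "(2 :: int) ^ 1 \<le> 2 ^ (n - 2)"
    using n by (intro power_increasing) auto
  then show ?thesis by (simp add: M_def)
qed

lemma congI: "u - v = 4 * M * k \<Longrightarrow> [u = v] (mod 2 ^ n)"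
  by (simp add: cong_iff_dvd_diff pow_n)

text \<open>
  The generators of the theorem, rewritten as affine maps: since \<open>2 ^ n = 4 * M\<close>, the power
  \<open>5 ^ 2 ^ (n - 3)\<close> is \<open>1 + 2 * M\<close>, and the factor \<open>5\<^sup>-\<^sup>1\<close> in types 5 and 6 cancels because
  the translation is applied before \<open>y\<close>.
\<close>
definition regular_type :: "nat \<Rightarrow> ('a \<Rightarrow> 'a) set \<Rightarrow> bool" where
  "regular_type i S \<longleftrightarrow>
      i = 1 \<and> S = right_regular G
    \<or> i = 2 \<and> (\<exists>t :: nat. t \<le> n - 3 \<and> S = generate (Hol G) {aff (5 ^ 2 ^ t) (5 ^ 2 ^ t)} \<and>
        Hol G\<lparr>carrier := S\<rparr> \<cong> integer_mod_group (2 ^ n) \<and>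
        S \<inter> right_regular G =
          generate (Hol G) {right_translation G (a [^] ((2 :: nat) ^ (n - t - 2)))})
    \<or> i = 3 \<and> S = generate (Hol G) {aff 2 1, aff (- 1) (- 1)} \<and> is_dihedral n (Hol G\<lparr>carrier := S\<rparr>)
    \<or> i = 4 \<and> S = generate (Hol G) {aff 2 1, aff (2 * M - 1) (2 * M - 1)} \<and>
        Hol G\<lparr>carrier := S\<rparr> \<cong> generalised_quaternion n
    \<or> i = 5 \<and>
        internal_direct (Hol G) S (generate (Hol G) {aff 2 5}) (generate (Hol G) {aff (- 1) (- 1)}) \<and>
        S \<inter> right_regular G = generate (Hol G) {right_translation G (a [^] ((2 :: nat) ^ (n - 1)))}
    \<or> i = 6 \<and>
        internal_semidirect (Hol G) S (generate (Hol G) {aff (2 + M) 5}) (generate (Hol G) {aff (- 1) (- 1)}) \<and>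
        S \<inter> right_regular G = generate (Hol G) {right_translation G (a [^] ((2 :: nat) ^ (n - 1)))} \<and>
        is_modular n (Hol G\<lparr>carrier := S\<rparr>)
    \<or> i = 7 \<and>
        internal_semidirect (Hol G) S (generate (Hol G) {aff (2 + 4 * M) (1 + 2 * M)}) (generate (Hol G) {aff (- 1) (- 1)}) \<and>
        S \<inter> right_regular G = generate (Hol G) {right_translation G (a [^] (4 :: nat))} \<and>
        is_quasidihedral n (Hol G\<lparr>carrier := S\<rparr>)"

lemma reflection_involution: "aff (- 1) (- 1) \<otimes>\<^bsub>Hol G\<^esub> aff (- 1) (- 1) = \<one>\<^bsub>Hol G\<^esub>"
  by (simp add: one_Hol)

lemma conj_reflection:
  "odd u \<Longrightarrow> inv\<^bsub>Hol G\<^esub> (aff (- 1) (- 1)) \<otimes>\<^bsub>Hol G\<^esub> aff c u \<otimes>\<^bsub>Hol G\<^esub> aff (- 1) (- 1) = aff (u - 1 - c) u"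
  by (simp add: conj_aff)

lemma inv_translation: "inv\<^bsub>Hol G\<^esub> (aff c 1) = aff (- c) 1"
  using inv_aff[of 1 1 c] by simp

text \<open>Both generators satisfy \<open>u = 1 + 2 * c\<close>, and so do all elements of the two
  cosets. On this curve the product has translation part \<open>c + d + 2 * c * d\<close>, which is
  symmetric in \<open>c\<close> and \<open>d\<close>, as is the product of multipliers.\<close>

lemma commuting_two_cosets_5:
  "commuting (two_cosets (generate (Hol G) {aff 2 5}) (aff (- 1) (- 1)))"
proof -
  have *: "two_cosets (generate (Hol G) {aff 2 5}) (aff (- 1) (- 1)) \<subseteq> range (\<lambda>c. aff c (1 + 2 * c))"
  proof -
    have power: "(5 :: int) ^ k = 1 + 4 * geo 5 k" for k
      using power_eq_geo[of 5 k] by simp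
    have "aff (2 * geo 5 k) (5 ^ k) \<in> range (\<lambda>c. aff c (1 + 2 * c))" for k
      by (rule range_eqI[of _ _ "2 * geo 5 k"]) (simp add: power)
    moreover have "aff (2 * geo 5 k) (5 ^ k) \<otimes>\<^bsub>Hol G\<^esub> aff (- 1) (- 1) \<in> range (\<lambda>c. aff c (1 + 2 * c))" for k
      by (rule range_eqI[of _ _ "- 2 * geo 5 k - 1"]) (simp add: power)
    ultimately show ?thesis
      by (auto simp: two_cosets_def generate_aff simp del: mult_aff)
  qed
  have "aff c (1 + 2 * c) \<otimes>\<^bsub>Hol G\<^esub> aff d (1 + 2 * d) = aff d (1 + 2 * d) \<otimes>\<^bsub>Hol G\<^esub> aff c (1 + 2 * c)" for c d
    by (simp add: algebra_simps)
  with * show ?thesis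
    unfolding commuting_def by blast
qed

section \<open>Generators of a regular subgroup determine its type\<close>

context
  fixes S
  assumes S: "subgroup S (Hol G)" and regular: "regular_on S (carrier G)"
begin

lemma regular_type_2:
  assumes t: "t \<le> n - 3" and gen: "aff (5 ^ 2 ^ t) (5 ^ 2 ^ t) \<in> S"
  shows "regular_type 2 S"
proof -
  obtain r where r: "odd r" "(5 :: int) ^ (2 ^ t) = 1 + 2 ^ (t + 2) * r"
    by (rule five_power_pow2)
  have w: "(5 :: int) ^ 2 ^ t mod 4 = 1"
    by (rule power_mod_4) simp
  have eq: "S = generate (Hol G) {aff (5 ^ 2 ^ t) (5 ^ 2 ^ t)}"
    using w gen by (intro regular_eq_cyclic[OF S regular]) (auto simp: odd_if_mod_4)
  have "Hol.ord (aff (5 ^ 2 ^ t) (5 ^ 2 ^ t)) = 2 ^ n"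
    using card_regular[OF S regular] eq by (subst Hol.generate_pow_card) auto
  then have "Hol G\<lparr>carrier := S\<rparr> \<cong> integer_mod_group (2 ^ n)"
    by (subst eq) (rule Hol.generate_iso_integer_mod_group, auto)
  moreover have "S \<inter> right_regular G = generate (Hol G) {right_translation G (a [^] ((2 :: nat) ^ (n - t - 2)))}"
  proof (rule intersection_right_regular)
    fix c
    have "aff c 1 \<in> generate (Hol G) {aff (2 ^ 0 * 5 ^ 2 ^ t) (5 ^ 2 ^ t)} \<longleftrightarrow> 2 ^ (0 + n - (t + 2)) dvd c"
      using r t n by (intro mem_generate_unipotent) auto
    then show "aff c 1 \<in> S \<longleftrightarrow> 2 ^ (n - t - 2) dvd c"
      by (subst eq) simp
  qed simp
  ultimately show ?thesis
    using t eq unfolding regular_type_def by blast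
qed

text \<open>The generated group is squeezed between a covering two-coset set and
  \<open>S\<close>.\<close>

lemma regular_eq_generate_pair:
  assumes "aff 2 1 \<in> S" "aff d v \<in> S" "odd d" "odd v"
  shows "S = generate (Hol G) {aff 2 1, aff d v}"
proof (rule sym, rule covering_subset_eq[OF S])
  let ?T = "generate (Hol G) {aff 2 1, aff d v}"
  have "subgroup ?T (Hol G)"
    using assms by (intro Hol.generate_is_subgroup) auto
  then have "two_cosets (generate (Hol G) {aff 2 1}) (aff d v) \<subseteq> ?T"
    by (intro two_cosets_subset) (auto intro: generate.incl)
  then show "covering ?T"
    using covering_two_cosets[of 1 1 d v] assms by (auto intro: covering_mono)
  show "semiregular S"
    using S regular regular_on_iff by blast
  show "?T \<subseteq> S"
    using assms by (intro Hol.generate_subgroup_incl[OF _ S]) auto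
qed

lemma regular_type_3:
  assumes "aff 2 1 \<in> S" "aff (- 1) (- 1) \<in> S"
  shows "regular_type 3 S"
proof -
  have "aff 2 1 [^]\<^bsub>Hol G\<^esub> (- 1 :: int) = inv\<^bsub>Hol G\<^esub> (aff 2 1)"
    using Hol.int_pow_neg[of "aff 2 1" 1] by simp
  then have "is_dihedral n (Hol G\<lparr>carrier := S\<rparr>)"
    using cyclic_index_two_with_S[OF S regular, of 1 1 "- 1" "- 1" "- 1"] assms reflection_involution
    by (simp add: is_dihedral_def conj_reflection inv_translation)
  then show ?thesis
    using regular_eq_generate_pair assms unfolding regular_type_def by simp
qed

text \<open>With \<open>v = 2 * M - 1\<close> the square of \<open>aff v v\<close> is the
  translation by \<open>v * v + v\<close>, which is \<open>2 * M\<close> modulo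
  \<open>4 * M\<close>. This is the involution of the cyclic part, as in a quaternion group.\<close>

lemma regular_type_4:
  assumes "aff 2 1 \<in> S" "aff (2 * M - 1) (2 * M - 1) \<in> S"
  shows "regular_type 4 S"
proof -
  let ?v = "2 * M - 1"
  have "[?v * ?v = 1] (mod 2 ^ n)"
    by (rule congI[of _ _ "M - 1"]) (simp add: algebra_simps)
  moreover have "[?v * ?v + ?v = 2 * M] (mod 2 ^ n)"
    by (rule congI[of _ _ "M - 1"]) (simp add: algebra_simps)
  ultimately have "aff ?v ?v \<otimes>\<^bsub>Hol G\<^esub> aff ?v ?v = aff 2 1 [^]\<^bsub>Hol G\<^esub> ((2 :: nat) ^ (n - 2))"
    by (simp add: nat_pow_aff aff_eq_iff M_def)
  moreover have "[?v * 2 = - 2] (mod 2 ^ n)"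
    by (rule congI[of _ _ 1]) simp
  then have "inv\<^bsub>Hol G\<^esub> (aff ?v ?v) \<otimes>\<^bsub>Hol G\<^esub> aff 2 1 \<otimes>\<^bsub>Hol G\<^esub> aff ?v ?v = inv\<^bsub>Hol G\<^esub> (aff 2 1)"
    by (simp add: conj_aff inv_translation aff_eq_iff)
  moreover have "?v mod 4 = 3"
    using even_M by presburger
  ultimately have "Hol G\<lparr>carrier := S\<rparr> \<cong> generalised_quaternion n"
    using iso_generalised_quaternion_S[OF S regular, of 1 1 ?v ?v] assms by simp
  then show ?thesis
    using regular_eq_generate_pair assms unfolding regular_type_def by simp
qed

lemma regular_intersection:
  assumes "odd r" "odd r'" "2 \<le> s" "s \<le> n" "w = 1 + 2 ^ s * r'"
    "aff (2 * r) w \<in> S" "aff (- 1) (- 1) \<in> S"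
  shows "S \<inter> right_regular G = generate (Hol G) {right_translation G (a [^] ((2 :: nat) ^ (1 + n - s)))}"
proof (rule intersection_right_regular)
  have "(4 :: int) dvd 2 ^ s"
    using le_imp_power_dvd[OF assms(3), of "2 :: int"] by simp
  then have "w mod 4 = 1"
    using dvd_mult2[of 4 "2 ^ s" r'] assms(5) by presburger
  then have "aff c 1 \<in> S \<longleftrightarrow> aff c 1 \<in> generate (Hol G) {aff (2 * r) w}" for c
    using assms(1,6,7) by (intro mem_S_mod_4[OF S regular, of r w "- 1" "- 1"]) auto
  moreover have "aff c 1 \<in> generate (Hol G) {aff (2 ^ 1 * r) w} \<longleftrightarrow> 2 ^ (1 + n - s) dvd c" for c
    using assms(3) by (intro mem_generate_unipotent[OF assms(1-4) _ assms(5)]) simp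
  ultimately show "aff c 1 \<in> S \<longleftrightarrow> 2 ^ (1 + n - s) dvd c" for c
    by (simp only: power_one_right)
qed (use assms(3) in simp)

lemma regular_type_5:
  assumes "aff 2 5 \<in> S" "aff (- 1) (- 1) \<in> S"
  shows "regular_type 5 S"
proof -
  have comm: "commuting S"
    using regular_eq_two_cosets[OF S regular, of 1 5 "- 1" "- 1"] commuting_two_cosets_5 assms by simp
  have "internal_direct (Hol G) S (generate (Hol G) {aff 2 5}) (generate (Hol G) {aff (- 1) (- 1)})"
    using internal_direct_S[OF S regular, of 1 5 "- 1" "- 1"] assms reflection_involution comm by simp
  moreover have "S \<inter> right_regular G = generate (Hol G) {right_translation G (a [^] ((2 :: nat) ^ (n - 1)))}"
    using regular_intersection[of 1 1 2 5] assms n by simp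
  ultimately show ?thesis
    unfolding regular_type_def by simp
qed

text \<open>The reflection sends the translation part \<open>2 + M\<close> to \<open>2 - M\<close>,
  a change by \<open>2 * M\<close> modulo \<open>4 * M\<close>. Raising to the power
  \<open>1 + 2 ^ (n - 2)\<close> has the same effect: it adds \<open>5 * M * e * (2 + M)\<close>
  with \<open>e\<close> odd, and \<open>M * M\<close> vanishes since 4 divides \<open>M\<close>.
  That divisibility also makes \<open>r = 1 + M div 2\<close> odd.\<close>

lemma regular_type_6:
  assumes n: "4 \<le> n" and "aff (2 + M) 5 \<in> S" "aff (- 1) (- 1) \<in> S"
  shows "regular_type 6 S"
proof -
  obtain r where r: "2 + M = 2 * r" "odd r"
    using four_dvd_M[OF n] by (elim dvdE) (auto intro!: that[of "1 + 2 * (M div 4)"])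
  obtain e where e: "odd e" "geo 5 (2 ^ (n - 2)) = M * e"
    using geo_pow2[of 5 "n - 2"] by (auto simp: M_def)
  define k :: nat where "k = 1 + 2 ^ (n - 2)"
  have geo: "geo 5 k = 1 + 5 * (M * e)"
    unfolding k_def by (subst geo_add) (simp add: e)
  have "5 ^ 2 ^ (n - 2) = 1 + 4 * (M * e)"
    using power_eq_geo[of 5 "2 ^ (n - 2)"] by (simp add: e)
  then have "5 ^ k = 5 * (1 + 4 * (M * e))"
    by (simp add: k_def)
  then have pow: "[(5 :: int) = 5 ^ k] (mod 2 ^ n)"
    by (intro congI[of _ _ "- 5 * e"]) simp
  obtain b where "e = 2 * b + 1"
    using e(1) ..
  moreover obtain l where "M = 4 * l"
    using four_dvd_M[OF n] ..
  ultimately have "[5 - 1 - (2 + M) = (2 + M) * geo 5 k] (mod 2 ^ n)"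
    unfolding geo by (intro congI[of _ _ "- 3 - 5 * b - 5 * l - 10 * l * b"]) (simp add: algebra_simps)
  with pow have "inv\<^bsub>Hol G\<^esub> (aff (- 1) (- 1)) \<otimes>\<^bsub>Hol G\<^esub> aff (2 * r) 5 \<otimes>\<^bsub>Hol G\<^esub> aff (- 1) (- 1)
      = aff (2 * r) 5 [^]\<^bsub>Hol G\<^esub> k"
    unfolding r(1)[symmetric] by (subst conj_reflection) (simp_all add: nat_pow_aff aff_eq_iff)
  also have "\<dots> = aff (2 * r) 5 [^]\<^bsub>Hol G\<^esub> (2 ^ (n - 2) + 1 :: int)"
    by (subst int_pow_int[symmetric]) (simp add: k_def add.commute)
  finally have "is_modular n (Hol G\<lparr>carrier := S\<rparr>)"
    using cyclic_index_two_with_S[OF S regular, of r 5 "- 1" "- 1"] r assms reflection_involution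
    by (simp add: is_modular_def)
  moreover have "internal_semidirect (Hol G) S (generate (Hol G) {aff (2 + M) 5}) (generate (Hol G) {aff (- 1) (- 1)})"
    using internal_semidirect_S[OF S regular, of r 5 "- 1" "- 1"] r assms reflection_involution by simp
  moreover have "S \<inter> right_regular G = generate (Hol G) {right_translation G (a [^] ((2 :: nat) ^ (n - 1)))}"
    using regular_intersection[of r 1 2 5] r assms n by simp
  ultimately show ?thesis
    unfolding regular_type_def by simp
qed

text \<open>Modulo \<open>2 * M\<close> the multiplier is 1, so \<open>geo\<close> collapses to the
  exponent \<open>M - 1\<close>; the even translation part lifts this to a congruence modulo
  \<open>4 * M\<close>, matching the reflected translation part. The multiplier is unchanged because
  it squares to 1 and \<open>M - 1\<close> is odd.\<close>

lemma regular_type_7: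
  assumes n: "4 \<le> n" and "aff (2 + 4 * M) (1 + 2 * M) \<in> S" "aff (- 1) (- 1) \<in> S"
  shows "regular_type 7 S"
proof -
  let ?w = "1 + 2 * M" and ?c = "2 + 4 * M"
  define k :: nat where "k = 2 ^ (n - 2) - 1"
  have k: "int k = M - 1"
    by (simp add: k_def M_def of_nat_diff)
  have c: "?c = 2 * (1 + 2 * M)"
    by simp
  have w: "?w mod 4 = 1"
    using even_M by presburger
  have "[geo ?w k = M - 1] (mod 2 * M)"
    unfolding k[symmetric] by (rule geo_cong) (simp add: cong_iff_dvd_diff)
  then obtain b where b: "geo ?w k = M - 1 + 2 * M * b"
    by (metis cong_iff_dvd_diff dvdE diff_eq_eq add.commute)
  have "[?w - 1 - ?c = ?c * geo ?w k] (mod 2 ^ n)"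
    unfolding b by (rule congI[of _ _ "- M - b - 2 * M * b"]) (simp add: algebra_simps)
  moreover have "[?w = ?w ^ k] (mod 2 ^ n)"
  proof -
    obtain l where l: "M = 2 * l"
      using even_M ..
    have "?w ^ k = 1 + 2 * M * (M - 1 + 2 * M * b)"
      using power_eq_geo[of ?w k] b by simp
    then show ?thesis
      by (intro congI[of _ _ "1 - l - M * b"]) (simp add: l algebra_simps)
  qed
  ultimately have "inv\<^bsub>Hol G\<^esub> (aff (- 1) (- 1)) \<otimes>\<^bsub>Hol G\<^esub> aff ?c ?w \<otimes>\<^bsub>Hol G\<^esub> aff (- 1) (- 1)
      = aff ?c ?w [^]\<^bsub>Hol G\<^esub> k"
    by (subst conj_reflection) (simp_all add: nat_pow_aff aff_eq_iff)
  also have "\<dots> = aff ?c ?w [^]\<^bsub>Hol G\<^esub> (2 ^ (n - 2) - 1 :: int)"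
    using k by (subst int_pow_int[symmetric]) (simp add: M_def)
  finally have "is_quasidihedral n (Hol G\<lparr>carrier := S\<rparr>)"
    using cyclic_index_two_with_S[OF S regular, of ?w ?w "- 1" "- 1"] w assms reflection_involution
    by (simp add: is_quasidihedral_def)
  moreover have "internal_semidirect (Hol G) S (generate (Hol G) {aff ?c ?w}) (generate (Hol G) {aff (- 1) (- 1)})"
    using internal_semidirect_S[OF S regular, of ?w ?w "- 1" "- 1"] w assms reflection_involution by simp
  moreover have "S \<inter> right_regular G = generate (Hol G) {right_translation G (a [^] (4 :: nat))}"
    using regular_intersection[of ?w 1 "n - 1" ?w] assms pow_n by simp
  ultimately show ?thesis
    unfolding regular_type_def by simp
qed

end

text \<open>The order of the tests matters. Types 1 and 2 also lack the multiplier
  \<open>- 1\<close>, so they must be split off before type 4. In types 5 and 6 every odd residue is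
  a multiplier, \<open>1 + 2 * M\<close> included, so \<open>5\<close> is tested before
  \<open>1 + 2 * M\<close>.\<close>

definition type_index :: "('a \<Rightarrow> 'a) set \<Rightarrow> nat" where
  "type_index R =
    (if \<forall>u\<in>linear_parts R. [u = 1] (mod 2 ^ n) then 1
     else if \<forall>u\<in>linear_parts R. u mod 4 = 1 then 2
     else if - 1 \<notin> linear_parts R then 4
     else if 5 \<in> linear_parts R then if commuting R then 5 else 6
     else if 1 + 2 * M \<in> linear_parts R then 7
     else 3)"

lemma type_index_conj:
  "h \<in> carrier (Hol G) \<Longrightarrow> R \<subseteq> carrier (Hol G) \<Longrightarrow> type_index (conjugate h R) = type_index R"
  by (simp add: type_index_def linear_parts_conj commuting_conj)

section \<open>Regularity and multipliers of each type\<close>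

lemma linear_partsI: "aff c u \<in> R \<Longrightarrow> odd u \<Longrightarrow> u \<in> linear_parts R"
  unfolding linear_parts_def by blast

lemma linear_parts_two_cosets:
  assumes "odd w" "odd v" "u \<in> linear_parts (two_cosets (generate (Hol G) {aff c w}) (aff d v))"
  shows "\<exists>k. [u = w ^ k] (mod 2 ^ n) \<or> [u = w ^ k * v] (mod 2 ^ n)"
  using assms by (auto simp: linear_parts_def two_cosets_def generate_aff aff_eq_iff)

lemma regular_two_cosets:
  assumes "subgroup S (Hol G)" "S = two_cosets (generate (Hol G) {aff (2 * r) w}) (aff d v)"
    and "odd r" "w mod 4 = 1" "odd d" "v mod 4 = 3"
  shows "regular_on S (carrier G)" "aff (2 * r) w \<in> S" "aff d v \<in> S"
proof -
  have "odd v"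
    using assms(6) by presburger
  then show "regular_on S (carrier G)"
    using assms covering_two_cosets[of r w d v] semiregular_two_cosets[of r w d v]
    by (simp add: regular_on_iff)
  show "aff (2 * r) w \<in> S"
    unfolding assms(2) two_cosets_def by (simp add: generate.incl)
  have "\<one>\<^bsub>Hol G\<^esub> \<otimes>\<^bsub>Hol G\<^esub> aff d v \<in> S"
    unfolding assms(2) two_cosets_def by (intro UnI2 imageI generate.one)
  then show "aff d v \<in> S"
    using \<open>odd v\<close> by simp
qed

text \<open>Because \<open>v\<close> squares to 1, the rule tying the multiplier to the parity of
  the translation part is stable under products and inverses. The resulting upper bound gives both
  semiregularity and the list of multipliers.\<close>

lemma generate_pair_subset:
  assumes "odd d" "odd v" "[v * v = 1] (mod 2 ^ n)"
  shows "generate (Hol G) {aff 2 1, aff d v} \<subseteq>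
    {aff c u | c u. odd u \<and> (even c \<and> [u = 1] (mod 2 ^ n) \<or> odd c \<and> [u = v] (mod 2 ^ n))}"
    (is "_ \<subseteq> ?D")
proof (rule Hol.generate_subgroup_incl)
  have D: "aff c u \<in> ?D" if "odd u" "even c \<and> [u = 1] (mod 2 ^ n) \<or> odd c \<and> [u = v] (mod 2 ^ n)" for c u
    using that by blast
  show "subgroup ?D (Hol G)"
  proof (rule Hol.subgroupI)
    from D[of 1 0] show "?D \<noteq> {}" by auto
    fix f assume "f \<in> ?D"
    then obtain c u where f: "f = aff c u" "odd u"
      "even c \<and> [u = 1] (mod 2 ^ n) \<or> odd c \<and> [u = v] (mod 2 ^ n)"
      by blast
    have "[u * u = 1] (mod 2 ^ n)"
      using f(3) assms(3) cong_mult[of u 1 "2 ^ n" u 1] cong_trans[OF cong_mult[of u v "2 ^ n" u v]] by auto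
    then have "inv\<^bsub>Hol G\<^esub> f = aff (- u * c) u"
      unfolding f(1) using f(2) by (intro inv_aff)
    also have "\<dots> \<in> ?D"
      using f(2,3) by (intro D) auto
    finally show "inv\<^bsub>Hol G\<^esub> f \<in> ?D" .
    fix g assume "g \<in> ?D"
    then obtain e z where g: "g = aff e z" "odd z"
      "even e \<and> [z = 1] (mod 2 ^ n) \<or> odd e \<and> [z = v] (mod 2 ^ n)"
      by blast
    have "even (z * c + e) \<and> [u * z = 1] (mod 2 ^ n) \<or> odd (z * c + e) \<and> [u * z = v] (mod 2 ^ n)"
      using f(3) g(2,3) assms(3) cong_mult[of u 1 "2 ^ n" z 1] cong_mult[of u 1 "2 ^ n" z v]
        cong_mult[of u v "2 ^ n" z 1] cong_trans[OF cong_mult[of u v "2 ^ n" z v]] by auto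
    with f(2) g(2) have "aff (z * c + e) (u * z) \<in> ?D"
      by (intro D) auto
    then show "f \<otimes>\<^bsub>Hol G\<^esub> g \<in> ?D"
      unfolding f(1) g(1) mult_aff[OF f(2) g(2)] .
  qed auto
  show "{aff 2 1, aff d v} \<subseteq> ?D"
    using D[of 1 2] D[of v d] assms by simp
qed

lemma regular_generate_pair:
  assumes S: "subgroup S (Hol G)" and eq: "S = generate (Hol G) {aff 2 1, aff d v}"
    and "odd d" "odd v" "[v * v = 1] (mod 2 ^ n)"
  shows "regular_on S (carrier G)" "aff d v \<in> S"
    "\<And>u. u \<in> linear_parts S \<Longrightarrow> [u = 1] (mod 2 ^ n) \<or> [u = v] (mod 2 ^ n)"
proof -
  note sub = generate_pair_subset[OF assms(3-5), folded eq]
  have mem: "aff 2 1 \<in> S" "aff d v \<in> S"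
    unfolding eq by (auto intro: generate.incl)
  then show "aff d v \<in> S" by simp
  have "two_cosets (generate (Hol G) {aff (2 * 1) 1}) (aff d v) \<subseteq> S"
    using mem S by (intro two_cosets_subset) auto
  then have "covering S"
    using covering_two_cosets[of 1 1 d v] assms by (auto intro: covering_mono)
  moreover have "semiregular S"
    unfolding semiregular_def
  proof (intro allI impI)
    fix u assume "aff 0 u \<in> S"
    then obtain c z where "aff 0 u = aff c z" "even c \<and> [z = 1] (mod 2 ^ n) \<or> odd c \<and> [z = v] (mod 2 ^ n)"
      using sub by blast
    then show "[u = 1] (mod 2 ^ n)"
      using cong_even_iff[of 0 c] by (auto simp: aff_eq_iff intro: cong_trans)
  qed
  ultimately show "regular_on S (carrier G)"
    using S regular_on_iff by blast
  fix u assume "u \<in> linear_parts S"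
  then obtain c where "aff c u \<in> S"
    by (auto simp: linear_parts_def)
  then obtain e z where "aff c u = aff e z" "[z = 1] (mod 2 ^ n) \<or> [z = v] (mod 2 ^ n)"
    using sub by blast
  then show "[u = 1] (mod 2 ^ n) \<or> [u = v] (mod 2 ^ n)"
    by (auto simp: aff_eq_iff intro: cong_trans)
qed

lemma cong_mod_8:
  assumes "[u = v] (mod 2 ^ n)"
  shows "u mod 8 = v mod (8 :: int)"
proof -
  have "(8 :: int) dvd 2 ^ n"
    using le_imp_power_dvd[of 3 n "2 :: int"] n by simp
  with assms show ?thesis
    by (meson cong_def cong_dvd_modulus)
qed

lemma not_cong_W: "\<not> [1 + 2 * M = 1] (mod 2 ^ n)" "\<not> [1 + 2 * M = - 1] (mod 2 ^ n)"
proof -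
  show "\<not> [1 + 2 * M = 1] (mod 2 ^ n)"
    using M_ge by (auto simp: cong_iff_dvd_diff pow_n dest: zdvd_imp_le)
  show "\<not> [1 + 2 * M = - 1] (mod 2 ^ n)"
  proof
    assume "[1 + 2 * M = - 1] (mod 2 ^ n)"
    then have "(1 + 2 * M) mod 4 = - 1 mod 4"
      by (rule cong_mod_4)
    with even_M show False
      by presburger
  qed
qed

lemma type_index_eq:
  assumes "u \<in> linear_parts S" "u mod 4 = 3"
  shows "type_index S =
    (if - 1 \<notin> linear_parts S then 4
     else if 5 \<in> linear_parts S then if commuting S then 5 else 6
     else if 1 + 2 * M \<in> linear_parts S then 7
     else 3)"
proof -
  have "\<not> (\<forall>u\<in>linear_parts S. [u = 1] (mod 2 ^ n))"
    using assms cong_mod_4[of u 1] by auto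
  moreover have "\<not> (\<forall>u\<in>linear_parts S. u mod 4 = 1)"
  proof
    assume "\<forall>u\<in>linear_parts S. u mod 4 = 1"
    then have "u mod 4 = 1"
      using assms(1) ..
    with assms(2) show False by simp
  qed
  ultimately show ?thesis
    by (simp only: type_index_def if_False)
qed

lemma type_index_semidirect:
  assumes S: "subgroup S (Hol G)" and eq: "S = two_cosets (generate (Hol G) {aff (2 * r) 5}) (aff (- 1) (- 1))"
    and "odd r"
  shows "regular_on S (carrier G)" "type_index S = (if commuting S then 5 else 6)"
proof -
  note * = regular_two_cosets[OF S eq assms(3)]
  show "regular_on S (carrier G)"
    using * by simp
  have "5 \<in> linear_parts S" "- 1 \<in> linear_parts S"
    using linear_partsI * by auto
  then show "type_index S = (if commuting S then 5 else 6)"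
    using type_index_eq[of "- 1" S] by simp
qed

text \<open>In types 5 to 7 the second factor has order two, so the factorisation presents
  \<open>S\<close> as a two-coset set whose regularity is already known. The bound
  \<open>4 \<le> n\<close> comes from \<open>is_quasidihedral\<close> in type 7 and from the
  prescribed intersection in type 6.\<close>

lemma regular_type_imp:
  assumes S: "subgroup S (Hol G)" and type: "regular_type i S"
  shows "regular_on S (carrier G) \<and> type_index S = i"
proof -
  have semidirect: "S = two_cosets (generate (Hol G) {aff c w}) (aff (- 1) (- 1))"
    if "odd w" "generate (Hol G) {aff c w} <#>\<^bsub>Hol G\<^esub> generate (Hol G) {aff (- 1) (- 1)} = S" for c w
    using generate_two_cosets[OF _ reflection_involution, of "generate (Hol G) {aff c w}"] that
      Hol.generate_incl[of "{aff c w}"] by simp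
  consider "i = 1" "S = right_regular G"
    | t where "i = 2" "t \<le> n - 3" "S = generate (Hol G) {aff (5 ^ 2 ^ t) (5 ^ 2 ^ t)}"
    | "i = 3" "S = generate (Hol G) {aff 2 1, aff (- 1) (- 1)}"
    | "i = 4" "S = generate (Hol G) {aff 2 1, aff (2 * M - 1) (2 * M - 1)}"
    | "i = 5" "generate (Hol G) {aff 2 5} <#>\<^bsub>Hol G\<^esub> generate (Hol G) {aff (- 1) (- 1)} = S"
    | "i = 6" "generate (Hol G) {aff (2 + M) 5} <#>\<^bsub>Hol G\<^esub> generate (Hol G) {aff (- 1) (- 1)} = S"
      "S \<inter> right_regular G = generate (Hol G) {right_translation G (a [^] ((2 :: nat) ^ (n - 1)))}"
    | "i = 7" "generate (Hol G) {aff (2 + 4 * M) (1 + 2 * M)} <#>\<^bsub>Hol G\<^esub> generate (Hol G) {aff (- 1) (- 1)} = S"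
      "4 \<le> n"
    using type unfolding regular_type_def internal_semidirect_def internal_direct_def is_quasidihedral_def
    by (elim disjE exE conjE) (rule that; assumption)+
  then show ?thesis
  proof cases
    case 1
    have "covering S"
      unfolding 1(2) covering_def right_regular_eq by (auto intro!: exI[of _ 1])
    moreover have "semiregular S" "\<forall>u\<in>linear_parts S. [u = 1] (mod 2 ^ n)"
      unfolding 1(2) semiregular_def linear_parts_def right_regular_eq
      by (auto simp: aff_eq_iff)
    ultimately show ?thesis
      using S 1(1) by (simp add: regular_on_iff type_index_def)
  next
    case 2
    obtain r where r: "odd r" "(5 :: int) ^ (2 ^ t) = 1 + 2 ^ (t + 2) * r"
      by (rule five_power_pow2)
    define w :: int where "w = 5 ^ 2 ^ t"
    have w: "w mod 4 = 1"
      unfolding w_def by (rule power_mod_4) simp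
    then have "odd w"
      by (rule odd_if_mod_4)
    have eq: "S = generate (Hol G) {aff w w}"
      using 2 by (simp add: w_def)
    \<comment> \<open>The exponent of two in \<open>w - 1\<close> is \<open>t + 2\<close>, which is
      below \<open>n\<close> by the bound on \<open>t\<close>; this separates type 2 from type
      1.\<close>
    have "\<not> [w = 1] (mod 2 ^ n)"
    proof
      assume "[w = 1] (mod 2 ^ n)"
      then have "2 ^ n dvd 2 ^ (t + 2) * r"
        by (simp add: cong_iff_dvd_diff w_def r(2))
      moreover have "t + 2 + (n - (t + 2)) = n"
        using 2(2) n by simp
      then have "2 ^ n = (2 :: int) ^ (t + 2) * 2 ^ (n - (t + 2))"
        by (simp only: power_add[symmetric])
      ultimately have "2 ^ (n - (t + 2)) dvd r"
        by (metis dvd_mult_cancel_left power_not_zero zero_neq_numeral)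
      moreover have "2 dvd (2 :: int) ^ (n - (t + 2))"
        using 2(2) n by simp
      ultimately show False
        using r(1) dvd_trans by blast
    qed
    moreover have "w \<in> linear_parts S"
      using \<open>odd w\<close> by (intro linear_partsI[of w]) (auto simp: eq intro: generate.incl)
    moreover have "u mod 4 = 1" if u: "u \<in> linear_parts S" for u
    proof -
      obtain k where "[u = w ^ k] (mod 2 ^ n)"
        using u \<open>odd w\<close> by (auto simp: linear_parts_def eq generate_aff aff_eq_iff)
      then show ?thesis
        using cong_mod_4 power_mod_4[OF w] by metis
    qed
    ultimately have "type_index S = 2"
      unfolding type_index_def by auto
    then show ?thesis
      using S 2(1) covering_cyclic[OF \<open>odd w\<close> w] semiregular_cyclic[OF \<open>odd w\<close> w]
      by (simp add: regular_on_iff eq[symmetric])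
  next
    case 3
    note * = regular_generate_pair[OF S 3(2)]
    have L: "- 1 \<in> linear_parts S"
      using linear_partsI * by simp
    have "5 \<notin> linear_parts S"
      using *(3)[of 5] cong_mod_8[of 5 1] cong_mod_8[of 5 "- 1"] by auto
    moreover have "1 + 2 * M \<notin> linear_parts S"
      using *(3)[of "1 + 2 * M"] not_cong_W by auto
    ultimately have "type_index S = 3"
      using L type_index_eq[of "- 1" S] by simp
    then show ?thesis
      using * 3(1) by simp
  next
    case 4
    have "[(2 * M - 1) * (2 * M - 1) = 1] (mod 2 ^ n)"
      by (rule congI[of _ _ "M - 1"]) (simp add: algebra_simps)
    note * = regular_generate_pair[OF S 4(2) _ _ this]
    have v: "(2 * M - 1) mod 4 = 3"
      using even_M by presburger
    have L: "2 * M - 1 \<in> linear_parts S"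
      using linear_partsI * by simp
    have "\<not> [- 1 = 2 * M - 1] (mod 2 ^ n)"
      using M_ge by (auto simp: cong_iff_dvd_diff pow_n dest: zdvd_imp_le)
    then have "- 1 \<notin> linear_parts S"
      using *(3)[of "- 1"] cong_mod_4[of "- 1" 1] by auto
    then have "type_index S = 4"
      using type_index_eq[OF L v] by simp
    then show ?thesis
      using * 4(1) by simp
  next
    case 5
    then show ?thesis
      using type_index_semidirect[OF S, of 1] semidirect[of 5 2] commuting_two_cosets_5 by simp
  next
    case 6
    have eq: "S = two_cosets (generate (Hol G) {aff (2 + M) 5}) (aff (- 1) (- 1))"
      using semidirect[of 5 "2 + M"] 6 by simp
    \<comment> \<open>For \<open>n = 3\<close> the generator is an involution, and \<open>S\<close> has only four elements.\<close>
    have n4: "4 \<le> n"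
    proof (rule ccontr)
      assume "\<not> 4 \<le> n"
      then have n3: "n = 3"
        using n by simp
      have M: "M = 2"
        unfolding M_def by (simp add: n3)
      have "a [^] ((2 :: nat) ^ (n - 1)) = a [^] (4 :: int)"
        by (simp add: n3 flip: int_pow_int)
      then have "aff 4 1 \<in> S \<inter> right_regular G"
        unfolding 6(3) by (simp only: right_translation_eq_aff) (simp add: generate.incl)
      then have "aff 4 1 \<in> generate (Hol G) {aff (2 ^ 2 * 1) 5}"
        using mem_two_cosets_mod_4[of "2 + M" 5 "- 1" "- 1" 1 4] eq M by simp
      then show False
        using mem_generate_unipotent[of 1 1 2 2 5 4] n3 by simp
    qed
    obtain r where r: "2 + M = 2 * r" "odd r"
      using four_dvd_M[OF n4] by (elim dvdE) (auto intro!: that[of "1 + 2 * (M div 4)"])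
    note * = type_index_semidirect[OF S eq[unfolded r(1)] r(2)]
      regular_two_cosets[OF S eq[unfolded r(1)] r(2)]
    \<comment> \<open>The two products have translation parts \<open>- 3 - M\<close> and
      \<open>M - 3\<close>, which differ by \<open>2 * M\<close> and hence modulo
      \<open>4 * M\<close>.\<close>
    have "aff (2 * r) 5 \<otimes>\<^bsub>Hol G\<^esub> aff (- 1) (- 1) \<noteq> aff (- 1) (- 1) \<otimes>\<^bsub>Hol G\<^esub> aff (2 * r) 5"
    proof
      assume "aff (2 * r) 5 \<otimes>\<^bsub>Hol G\<^esub> aff (- 1) (- 1) = aff (- 1) (- 1) \<otimes>\<^bsub>Hol G\<^esub> aff (2 * r) 5"
      then have "[- (2 + M) - 1 = 2 + M - 5] (mod 2 ^ n)"
        by (simp add: aff_eq_iff r(1)[symmetric])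
      then show False
        using M_ge by (auto simp: cong_iff_dvd_diff pow_n dest: zdvd_imp_le)
    qed
    moreover have "aff (2 * r) 5 \<in> S" "aff (- 1) (- 1) \<in> S"
      using * by auto
    ultimately have "\<not> commuting S"
      unfolding commuting_def by blast
    then show ?thesis
      using * 6(1) by simp
  next
    case 7
    have eq: "S = two_cosets (generate (Hol G) {aff (2 * (1 + 2 * M)) (1 + 2 * M)}) (aff (- 1) (- 1))"
      using semidirect[of "1 + 2 * M" "2 + 4 * M"] 7 by simp
    have w: "(1 + 2 * M) mod 4 = 1"
      using even_M by presburger
    note * = regular_two_cosets[OF S eq _ w]
    have "- 1 \<in> linear_parts S" "1 + 2 * M \<in> linear_parts S"
      using linear_partsI * by auto
    moreover have "5 \<notin> linear_parts S"
    proof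
      assume "5 \<in> linear_parts S"
      then obtain k where k: "[5 = (1 + 2 * M) ^ k] (mod 2 ^ n) \<or> [5 = (1 + 2 * M) ^ k * - 1] (mod 2 ^ n)"
        using linear_parts_two_cosets[of "1 + 2 * M" "- 1" 5] eq by auto
      \<comment> \<open>For \<open>4 \<le> n\<close> all multipliers are 1 or -1 modulo 8, and 5 is
        neither.\<close>
      have "8 dvd 2 * M"
        using mult_dvd_mono[OF dvd_refl[of 2] four_dvd_M[OF 7(3)]] by simp
      then have "[(1 + 2 * M) ^ k = 1 ^ k] (mod 8)"
        by (intro cong_pow) (simp add: cong_iff_dvd_diff)
      then have "((1 + 2 * M) ^ k) mod 8 = 1"
        by (simp add: cong_def)
      moreover define z where "z = (1 + 2 * M) ^ k"
      moreover have "5 mod 8 = z mod 8 \<or> 5 mod 8 = (z * - 1) mod 8"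
        using k cong_mod_8 unfolding z_def by blast
      ultimately show False
        by presburger
    qed
    ultimately have "type_index S = 7"
      using type_index_eq[of "- 1" S] by simp
    then show ?thesis
      using * 7(1) by simp
  qed
qed

section \<open>Every regular subgroup has a type\<close>

lemma cong_dvd_mod_power:
  assumes "[u = v] (mod 2 ^ n)" "k \<le> n"
  shows "[u = v] (mod (2 :: int) ^ k)"
  using assms by (meson cong_dvd_modulus le_imp_power_dvd)

lemma scale_regular:
  assumes "odd s" "subgroup R (Hol G)" "regular_on R (carrier G)"
  shows "subgroup (conjugate (aff 0 s) R) (Hol G)" "regular_on (conjugate (aff 0 s) R) (carrier G)"
  using assms by (simp_all add: subgroup_conj regular_conj)

lemma scale_mem:
  "odd s \<Longrightarrow> odd u \<Longrightarrow> aff c u \<in> R \<Longrightarrow> aff (s * c) u \<in> conjugate (aff 0 s) R"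
  using aff_mem_conj[of s u c R 0] by simp

lemma mem_cong: "aff c u \<in> R \<Longrightarrow> [c = d] (mod 2 ^ n) \<Longrightarrow> [u = v] (mod 2 ^ n) \<Longrightarrow> aff d v \<in> R"
  by (metis aff_eq_iff)

lemma pow_mem:
  assumes "subgroup R (Hol G)" "odd u" "aff c u \<in> R"
  shows "aff (c * geo u k) (u ^ k) \<in> R"
proof -
  have "generate (Hol G) {aff c u} \<subseteq> R"
    using assms by (intro Hol.generate_subgroup_incl) auto
  then show ?thesis
    using assms(2) by (auto simp: generate_aff)
qed

text \<open>As \<open>v\<close> is 3 modulo 4, \<open>v - 1\<close> contributes just one factor of
  two to \<open>(v - 1) * (v + 1)\<close>. So \<open>2 * M\<close> divides \<open>v + 1\<close>,
  which leaves two residues modulo \<open>4 * M\<close>.\<close>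

lemma sqrt_one_cases:
  assumes "v mod 4 = 3" "[v * v = 1] (mod 2 ^ n)"
  shows "[v = - 1] (mod 2 ^ n) \<or> [v = 2 * M - 1] (mod 2 ^ n)"
proof -
  define b where "b = (v - 1) div 2"
  have b: "v - 1 = 2 * b" "odd b"
    using assms(1) unfolding b_def by presburger+
  have "2 * (2 * M) dvd 2 * (b * (v + 1))"
    using assms(2) b(1) by (simp add: cong_iff_dvd_diff pow_n) (simp add: algebra_simps flip: b(1))
  then have "2 ^ (n - 1) dvd b * (v + 1)"
    unfolding pow_n by (metis dvd_mult_cancel_left zero_neq_numeral)
  then have "2 ^ (n - 1) dvd v + 1"
    using b(2) by (simp add: coprime_dvd_mult_right_iff)
  then obtain l where l: "v + 1 = 2 * M * l"
    unfolding pow_n ..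
  show ?thesis
  proof (cases "even l")
    case True
    then obtain j where "l = 2 * j" ..
    then have "[v = - 1] (mod 2 ^ n)"
      using l by (intro congI[of _ _ j]) simp
    then show ?thesis ..
  next
    case False
    then obtain j where "l = 2 * j + 1" ..
    then have "[v = 2 * M - 1] (mod 2 ^ n)"
      using l by (intro congI[of _ _ j]) (simp add: algebra_simps)
    then show ?thesis ..
  qed
qed

context
  fixes R
  assumes R: "subgroup R (Hol G)" and regular: "regular_on R (carrier G)"
begin

lemma covering_R: obtains u where "odd u" "aff c u \<in> R"
  using R regular regular_on_iff unfolding covering_def by blast

text \<open>If \<open>u - 1\<close> contains exactly \<open>2 ^ s\<close>, then some power of
  \<open>u\<close> equals \<open>w = 5 ^ 2 ^ (s - 2)\<close>. The same power of
  \<open>aff c u\<close> keeps an odd translation part, which a scaling turns into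
  \<open>w\<close>.\<close>

lemma exists_type_cyclic:
  assumes c: "odd c" and u: "u mod 4 = 1" and mem: "aff c u \<in> R"
  shows "\<exists>s i. odd s \<and> regular_type i (conjugate (aff 0 s) R)"
proof (cases "[u = 1] (mod 2 ^ n)")
  case True
  have eq: "R = generate (Hol G) {aff c 1}"
    using mem_cong[OF mem cong_refl True] c by (intro regular_eq_cyclic[OF R regular]) auto
  have "R = right_regular G"
  proof
    show "R \<subseteq> right_regular G"
      unfolding right_regular_eq by (subst eq) (auto simp: generate_aff)
    show "right_regular G \<subseteq> R"
    proof
      fix f assume "f \<in> right_regular G"
      then obtain d where d: "f = aff d 1"
        by (auto simp: right_regular_eq)
      obtain v where v: "odd v" "aff d v \<in> R"
        by (rule covering_R)
      then have "[v = 1] (mod 2 ^ n)"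
        by (subst (asm) eq) (auto simp: generate_aff aff_eq_iff)
      then show "f \<in> R"
        using mem_cong[OF v(2) cong_refl] d by simp
    qed
  qed
  moreover have "conjugate (aff 0 1) R = R"
    using subgroup.subset[OF R] unfolding one_Hol[symmetric] conjugate_set_def by (auto simp: image_iff subset_iff)
  ultimately have "regular_type 1 (conjugate (aff 0 1) R)"
    by (simp add: regular_type_def)
  then show ?thesis
    using odd_one by blast
next
  case False
  have "odd u"
    using u by (rule odd_if_mod_4)
  have "u - 1 \<noteq> 0"
    using False by auto
  then obtain s r where sr: "u - 1 = 2 ^ s * r" "odd r"
    by (rule pow2_decompose)
  have "4 dvd u - 1"
    using u by presburger
  have s2: "2 \<le> s"
  proof (rule ccontr)
    assume "\<not> 2 \<le> s"
    then have "s = 0 \<or> s = 1"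
      by linarith
    then show False
      using \<open>4 dvd u - 1\<close> sr by (auto elim!: dvdE)
  qed
  have sn: "s < n"
  proof (rule ccontr)
    assume "\<not> s < n"
    then have "(2 :: int) ^ n dvd u - 1"
      using le_imp_power_dvd[of n s "2 :: int"] sr(1) by simp
    with False show False
      by (simp add: cong_iff_dvd_diff)
  qed
  define t where "t = s - 2"
  have t: "t + 2 = s" "t \<le> n - 3"
    using s2 sn by (auto simp: t_def)
  define w :: int where "w = 5 ^ 2 ^ t"
  obtain r' where r': "odd r'" "w = 1 + 2 ^ s * r'"
    using five_power_pow2[of t] t(1) unfolding w_def by metis
  obtain k where k: "[u ^ k = w] (mod 2 ^ n)"
    using pow2_power_cong_surj[of r s w n] sr s2 r'(2) by (auto simp: algebra_simps)
  \<comment> \<open>Both \<open>u - 1\<close> and \<open>w - 1\<close> contain exactly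
    \<open>2 ^ s\<close>, and \<open>geo u k\<close> is the quotient of \<open>u ^ k - 1\<close> by
    \<open>u - 1\<close>.\<close>
  have "odd (geo u k)"
  proof
    assume "even (geo u k)"
    then have "2 ^ Suc s dvd u ^ k - 1"
      unfolding power_eq_geo[of u k] sr(1) by (auto elim!: evenE)
    moreover have "(2 :: int) ^ Suc s dvd 2 ^ n"
      using sn by (intro le_imp_power_dvd) simp
    ultimately have "2 ^ Suc s dvd w - 1"
      using cong_dvd_iff[OF cong_dvd_modulus[OF cong_diff[OF k cong_refl[of 1]]]] by blast
    then show False
      using r' by simp
  qed
  then have odd: "odd (c * geo u k)" and "odd w"
    using c by (auto simp: w_def)
  have mem': "aff (c * geo u k) w \<in> R"
    using mem_cong[OF pow_mem[OF R \<open>odd u\<close> mem] cong_refl k] .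
  obtain z where z: "[c * geo u k * z = w] (mod 2 ^ n)"
    using cong_mult_odd_solve[OF odd] by blast
  have "odd z"
    using cong_even_iff[OF z] \<open>odd w\<close> by simp
  let ?S = "conjugate (aff 0 z) R"
  have "aff w w \<in> ?S"
    using z by (intro mem_cong[OF scale_mem[OF \<open>odd z\<close> \<open>odd w\<close> mem'] _ cong_refl])
      (simp add: ac_simps)
  then have "regular_type 2 ?S"
    using scale_regular[OF \<open>odd z\<close> R regular] t(2) unfolding w_def by (intro regular_type_2)
  with \<open>odd z\<close> show ?thesis by blast
qed

text \<open>The square of \<open>aff 1 v\<close> has even translation part, hence is a translation,
  and so \<open>v\<close> squares to 1. Scaling by \<open>v\<close> itself gives
  \<open>aff v v\<close>, the second generator in types 3 and 4.\<close>

lemma exists_type_translation: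
  assumes "aff 2 1 \<in> R" "aff 1 v \<in> R" "v mod 4 = 3"
  shows "\<exists>s i. odd s \<and> regular_type i (conjugate (aff 0 s) R)"
proof -
  have "odd v"
    using assms(3) by presburger
  have "aff 1 v \<otimes>\<^bsub>Hol G\<^esub> aff 1 v \<in> R"
    using R assms(2) by (intro subgroup.m_closed)
  then have "aff (v + 1) (v * v) \<in> R"
    using \<open>odd v\<close> by simp
  then have "aff (v + 1) (v * v) \<in> generate (Hol G) {aff (2 * 1) 1}"
    using \<open>odd v\<close> assms by (subst (asm) mem_S_even[OF R regular, of 1 1 1 v]) auto
  then have "[v * v = 1] (mod 2 ^ n)"
    by (auto simp: generate_aff aff_eq_iff)
  then have v: "[v = - 1] (mod 2 ^ n) \<or> [v = 2 * M - 1] (mod 2 ^ n)"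
    using sqrt_one_cases assms(3) by blast
  let ?S = "conjugate (aff 0 v) R"
  note S = scale_regular[OF \<open>odd v\<close> R regular]
  have "aff v v \<in> ?S"
    using scale_mem[OF \<open>odd v\<close> \<open>odd v\<close> assms(2)] by simp
  moreover have "aff 2 1 \<in> ?S"
  proof -
    \<comment> \<open>Scaling by \<open>v\<close> multiplies translations by \<open>v\<close>;
      starting from \<open>2 * v\<close> yields \<open>2\<close>, because \<open>v\<close> is its
      own inverse.\<close>
    have "aff (2 * v) 1 \<in> R"
      using pow_mem[OF R _ assms(1), of "nat (v mod 2 ^ n)"]
      by (rule mem_cong) (simp_all add: cong_def mod_mult_right_eq)
    then have "aff (v * (2 * v)) 1 \<in> ?S"
      using \<open>odd v\<close> by (intro scale_mem) auto
    moreover have "[v * (2 * v) = 2] (mod 2 ^ n)"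
      using cong_scalar_left[OF \<open>[v * v = 1] (mod 2 ^ n)\<close>, of 2] by (simp add: ac_simps)
    ultimately show ?thesis
      by (rule mem_cong) simp
  qed
  ultimately have "regular_type 3 ?S \<or> regular_type 4 ?S"
    using v regular_type_3[OF S] regular_type_4[OF S] mem_cong by blast
  with \<open>odd v\<close> show ?thesis by blast
qed

lemma exists_reflection:
  assumes c: "odd c" and mem: "aff c (- 1) \<in> R"
  obtains s where "odd s" "aff (- 1) (- 1) \<in> conjugate (aff 0 s) R"
proof -
  obtain s where s: "[c * s = - 1] (mod 2 ^ n)"
    using cong_mult_odd_solve[OF c] by blast
  then have "odd s"
    using cong_even_iff[OF s] by simp
  then have "aff (s * c) (- 1) \<in> conjugate (aff 0 s) R"
    using mem by (intro scale_mem) auto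
  moreover have "[s * c = - 1] (mod 2 ^ n)"
    using s by (simp add: mult.commute)
  ultimately have "aff (- 1) (- 1) \<in> conjugate (aff 0 s) R"
    by (rule mem_cong) simp
  with \<open>odd s\<close> show ?thesis
    using that by blast
qed

text \<open>Again \<open>v\<close> must square to 1. If \<open>v\<close> is not \<open>- 1\<close>,
  then it is \<open>2 * M - 1\<close>, and multiplying by the even generator turns it into
  \<open>- 1\<close>. Scaling then normalises the reflection, and a power of the even generator
  acquires the translation part required by type 7.\<close>

lemma exists_type_quasidihedral:
  assumes n: "4 \<le> n" and "aff 2 (1 + 2 * M) \<in> R" "aff 1 v \<in> R" and v: "v mod 4 = 3"
  shows "\<exists>s i. odd s \<and> regular_type i (conjugate (aff 0 s) R)"
proof -
  define w where "w = 1 + 2 * M"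
  have w4: "w mod 4 = 1"
    using even_M unfolding w_def by presburger
  have odd: "odd w" "odd v"
    using w4 v by presburger+
  have mem: "aff 2 w \<in> R"
    using assms(2) by (simp add: w_def)
  have ww: "[w * w = 1] (mod 2 ^ n)"
    by (rule congI[of _ _ "1 + M"]) (simp add: w_def algebra_simps)
  have pow_even: "[w ^ (2 * k) = 1] (mod 2 ^ n)" for k
    using cong_pow[OF ww, of k] by (simp add: power_mult power2_eq_square)
  have "aff 1 v \<otimes>\<^bsub>Hol G\<^esub> aff 1 v \<in> R"
    using R assms(3) by (intro subgroup.m_closed)
  then have "aff (v + 1) (v * v) \<in> R"
    using odd by simp
  then have "aff (v + 1) (v * v) \<in> generate (Hol G) {aff (2 * 1) w}"
    using odd mem assms w4 by (subst (asm) mem_S_even[OF R regular, of 1 w 1 v]) auto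
  then obtain i where i: "[v + 1 = 2 * geo w i] (mod 2 ^ n)" "[v * v = w ^ i] (mod 2 ^ n)"
    using odd by (auto simp: generate_aff aff_eq_iff)
  \<comment> \<open>\<open>v + 1\<close> is divisible by 4, so the geometric sum, and with it
    \<open>i\<close>, is even; even powers of \<open>w\<close> are 1.\<close>
  have "even (geo w i)"
    using cong_mod_4[OF i(1)] v by presburger
  then obtain k where "i = 2 * k"
    using even_geo_iff[OF odd(1)] by (auto elim: evenE)
  then have "[v * v = 1] (mod 2 ^ n)"
    using i(2) pow_even cong_trans by blast
  then have "[v = - 1] (mod 2 ^ n) \<or> [v = 2 * M - 1] (mod 2 ^ n)"
    using sqrt_one_cases v by blast
  then obtain c where "odd c" "aff c (- 1) \<in> R"
  proof
    assume "[v = - 1] (mod 2 ^ n)"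
    then show ?thesis
      using mem_cong[OF assms(3) cong_refl] that[of 1] by simp
  next
    assume v: "[v = 2 * M - 1] (mod 2 ^ n)"
    have "aff 2 w \<otimes>\<^bsub>Hol G\<^esub> aff 1 v \<in> R"
      using R mem assms(3) by (intro subgroup.m_closed)
    then have "aff (v * 2 + 1) (w * v) \<in> R"
      using odd by simp
    moreover have "[w * (2 * M - 1) = - 1] (mod 2 ^ n)"
      by (rule congI[of _ _ M]) (simp add: w_def algebra_simps)
    then have "[w * v = - 1] (mod 2 ^ n)"
      using cong_trans[OF cong_scalar_left[OF v]] by blast
    ultimately show ?thesis
      using mem_cong[OF _ cong_refl] that[of "v * 2 + 1"] by simp
  qed
  then obtain s where s: "odd s" "aff (- 1) (- 1) \<in> conjugate (aff 0 s) R"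
    by (rule exists_reflection)
  let ?S = "conjugate (aff 0 s) R"
  note S = scale_regular[OF s(1) R regular]
  have mem_S: "aff (s * 2) w \<in> ?S"
    using mem s(1) odd by (intro scale_mem)
  \<comment> \<open>The scaled generator is \<open>aff (s * 2) w\<close>. Its \<open>i\<close>-th
    power has translation part \<open>2 * w\<close>, which is \<open>2 + 4 * M\<close>; oddness of
    \<open>i\<close> preserves the multiplier.\<close>
  obtain e where e: "[s * e = w] (mod 2 ^ n)"
    using cong_mult_odd_solve[OF s(1)] by blast
  obtain i where i: "[geo w i = e] (mod 2 ^ n)"
    using geo_surj[OF w4] by blast
  have eq: "[s * geo w i = w] (mod 2 ^ n)"
    using cong_trans[OF cong_scalar_left[OF i] e] .
  then have "[2 * (s * geo w i) = 2 * w] (mod 2 ^ n)"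
    by (rule cong_scalar_left)
  have "odd (s * geo w i)"
    using cong_even_iff[OF eq] odd(1) by simp
  then have "odd i"
    using even_geo_iff[OF odd(1)] by simp
  then obtain k where "i = 2 * k + 1" ..
  then have "[w ^ i = w] (mod 2 ^ n)"
    using cong_scalar_right[OF pow_even, of k w] by (simp add: mult.commute)
  then have "aff (2 * w) w \<in> ?S"
    using \<open>[2 * (s * geo w i) = 2 * w] (mod 2 ^ n)\<close>
    by (intro mem_cong[OF pow_mem[OF S(1) odd(1) mem_S, of i]]) (simp_all add: ac_simps)
  then have "regular_type 7 ?S"
    using regular_type_7[OF S n] s(2) by (simp add: w_def)
  with s(1) show ?thesis by blast
qed

end

text \<open>The commutator of the reflection and \<open>aff (2 * r) 5\<close> is a translation by a
  unit times \<open>4 - 4 * r\<close>, and the translations in \<open>S\<close> are the multiples of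
  \<open>2 * M\<close>. Hence \<open>2 * r = 2 - M * b\<close>, and the parity of \<open>b\<close>
  decides between the generators of types 5 and 6.\<close>

lemma type_5_or_6:
  assumes S: "subgroup S (Hol G)" and regular: "regular_on S (carrier G)"
    and r: "odd r" and mem: "aff (2 * r) 5 \<in> S" and refl: "aff (- 1) (- 1) \<in> S"
  shows "regular_type 5 S \<or> regular_type 6 S"
proof -
  obtain v :: int where v: "odd v" "[5 * v = 1] (mod 2 ^ n)"
    using odd_inverse_mod_pow2[of 5 n] by auto
  have mem_iff: "aff c 1 \<in> S \<longleftrightarrow> 2 * M dvd c" for c
  proof -
    have "aff c 1 \<in> S \<longleftrightarrow> aff c 1 \<in> generate (Hol G) {aff (2 * r) 5}"
      using refl by (intro mem_S_mod_4[OF S regular r _ mem, of "- 1" "- 1"]) auto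
    moreover have "aff c 1 \<in> generate (Hol G) {aff (2 ^ 1 * r) 5} \<longleftrightarrow> 2 ^ (1 + n - 2) dvd c"
      using n by (intro mem_generate_unipotent[of r 1]) (simp_all add: r)
    moreover have "1 + n - 2 = n - 1"
      by simp
    ultimately show ?thesis
      by (simp only: power_one_right pow_n(2))
  qed
  have "inv\<^bsub>Hol G\<^esub> (aff (- 1) (- 1)) \<otimes>\<^bsub>Hol G\<^esub> aff (2 * r) 5 \<otimes>\<^bsub>Hol G\<^esub> aff (- 1) (- 1)
      \<otimes>\<^bsub>Hol G\<^esub> inv\<^bsub>Hol G\<^esub> (aff (2 * r) 5) \<in> S"
    using mem refl by (intro subgroup.m_closed[OF S] subgroup.m_inv_closed[OF S])
  then have "aff (v * (4 - 2 * r) + - v * (2 * r)) (5 * v) \<in> S"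
    using v by (simp add: conj_reflection inv_aff)
  then have "aff (v * (4 - 4 * r)) 1 \<in> S"
    using v(2) by (elim mem_cong) (simp_all add: algebra_simps)
  then have "2 ^ (n - 1) dvd v * (4 - 4 * r)"
    unfolding mem_iff pow_n .
  then have "2 * M dvd 4 - 4 * r"
    using v(1) unfolding pow_n(2)[symmetric] by (subst (asm) coprime_dvd_mult_right_iff) auto
  then obtain b where b: "4 - 4 * r = 2 * M * b" ..
  \<comment> \<open>Translation by \<open>2 * M\<close> lies in \<open>S\<close>, so translation
    parts of elements with multiplier 5 matter only modulo \<open>2 * M\<close>.\<close>
  have shift: "aff (c + 2 * M) 5 \<in> S" if "aff c 5 \<in> S" for c
  proof -
    have "aff c 5 \<otimes>\<^bsub>Hol G\<^esub> aff (2 * M) 1 \<in> S"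
      using that mem_iff by (intro subgroup.m_closed[OF S]) auto
    then show ?thesis by simp
  qed
  have mem': "aff d 5 \<in> S" if "[d = 2 * r] (mod 2 ^ n) \<or> [d = 2 * r + 2 * M] (mod 2 ^ n)" for d
    using that mem shift[OF mem] mem_cong cong_refl cong_sym by blast
  show ?thesis
  proof (cases "even b")
    case True
    then obtain b' where b': "b = 2 * b'" ..
    then have r2: "2 * r = 2 - 2 * M * b'"
      using b by simp
    have "[2 = 2 * r] (mod 2 ^ n) \<or> [2 = 2 * r + 2 * M] (mod 2 ^ n)"
    proof (cases "even b'")
      case True
      then obtain j where "b' = 2 * j" ..
      then have "[2 = 2 * r] (mod 2 ^ n)"
        using r2 by (intro congI[of _ _ j]) simp
      then show ?thesis ..
    next
      case False
      then obtain j where "b' = 2 * j + 1" ..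
      then have "[2 = 2 * r + 2 * M] (mod 2 ^ n)"
        using r2 by (intro congI[of _ _ j]) (simp add: algebra_simps)
      then show ?thesis ..
    qed
    then have "aff 2 5 \<in> S"
      by (rule mem')
    then show ?thesis
      using regular_type_5[OF S regular] refl by blast
  next
    case False
    then obtain b' where b': "b = 2 * b' + 1" ..
    then have r2: "2 * r = 2 - M - 2 * M * b'"
      using b by (simp add: algebra_simps)
    \<comment> \<open>At \<open>n = 3\<close> an odd \<open>b\<close> would make \<open>r\<close>
      even.\<close>
    have n4: "4 \<le> n"
    proof (rule ccontr)
      assume "\<not> 4 \<le> n"
      then have "n = 3"
        using n by simp
      then have "M = 2"
        unfolding M_def by simp
      then have "r = - 2 * b'"
        using r2 by simp
      with r show False by simp
    qed
    have "[2 + M = 2 * r] (mod 2 ^ n) \<or> [2 + M = 2 * r + 2 * M] (mod 2 ^ n)"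
    proof (cases "even b'")
      case True
      then obtain j where "b' = 2 * j" ..
      then have "[2 + M = 2 * r + 2 * M] (mod 2 ^ n)"
        using r2 by (intro congI[of _ _ j]) (simp add: algebra_simps)
      then show ?thesis ..
    next
      case False
      then obtain j where "b' = 2 * j + 1" ..
      then have "[2 + M = 2 * r] (mod 2 ^ n)"
        using r2 by (intro congI[of _ _ "j + 1"]) (simp add: algebra_simps)
      then show ?thesis ..
    qed
    then have "aff (2 + M) 5 \<in> S"
      by (rule mem')
    then show ?thesis
      using regular_type_6[OF S regular n4] refl by blast
  qed
qed

context
  fixes R
  assumes R: "subgroup R (Hol G)" and regular: "regular_on R (carrier G)"
begin

text \<open>The multiplier \<open>1 + 4 * r\<close> is 5 modulo 8, so its powers exhaust the
  residues that are 1 modulo 4. One power turns the multiplier of the odd generator into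
  \<open>- 1\<close>, another has multiplier 5.\<close>

lemma exists_type_full:
  assumes r: "odd r" and "aff 2 (1 + 4 * r) \<in> R" "aff 1 v \<in> R" and v: "v mod 4 = 3"
  shows "\<exists>s i. odd s \<and> regular_type i (conjugate (aff 0 s) R)"
proof -
  define w where "w = 1 + 4 * r"
  have w: "w = 1 + 2 ^ 2 * r" and w4: "w mod 4 = 1" and mem: "aff 2 w \<in> R"
    using assms(2) by (auto simp: w_def)
  have odd: "odd w" "odd v"
    using w4 v by presburger+
  obtain v' where v': "odd v'" "[v * v' = 1] (mod 2 ^ n)"
    using odd_inverse_mod_pow2[OF odd(2)] by blast
  have "(v * v') mod 4 = 1"
    using cong_mod_4[OF v'(2)] by simp
  then have "(3 * v') mod 4 = 1"
    using mod_mult_left_eq[of v 4 v'] v by simp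
  \<comment> \<open>The inverse of \<open>v\<close> is again 3 modulo 4, so its negative is a power
    of \<open>w\<close>; multiplying \<open>v\<close> by that power gives
    \<open>- 1\<close>.\<close>
  then have "4 dvd - v' - 1"
    by presburger
  then have "2 ^ 2 dvd - v' - 1"
    by simp
  then obtain i where i: "[w ^ i = - v'] (mod 2 ^ n)"
    using pow2_power_cong_surj[of r 2 "- v'" n] r unfolding w by auto
  have "aff 1 v \<otimes>\<^bsub>Hol G\<^esub> aff (2 * geo w i) (w ^ i) \<in> R"
    using R assms(3) pow_mem[OF R odd(1) mem] by (intro subgroup.m_closed)
  then have "aff (w ^ i + 2 * geo w i) (v * w ^ i) \<in> R"
    using odd by simp
  moreover have "[v * w ^ i = - 1] (mod 2 ^ n)"
    using cong_trans[OF cong_scalar_left[OF i, of v]] v'(2) by (simp add: cong_minus_minus_iff)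
  ultimately have "aff (w ^ i + 2 * geo w i) (- 1) \<in> R"
    using mem_cong[OF _ cong_refl] by blast
  moreover have "odd (w ^ i + 2 * geo w i)"
    using odd by simp
  ultimately obtain s where s: "odd s" "aff (- 1) (- 1) \<in> conjugate (aff 0 s) R"
    using exists_reflection[OF R regular] by blast
  let ?S = "conjugate (aff 0 s) R"
  note S = scale_regular[OF s(1) R regular]
  obtain j where j: "[w ^ j = 5] (mod 2 ^ n)"
    using pow2_power_cong_surj[of r 2 5 n] r unfolding w by auto
  have "odd (geo w j)"
  proof
    assume "even (geo w j)"
    then have "w ^ j mod 8 = 1"
      unfolding power_eq_geo[of w j] by (auto simp: w_def elim!: evenE)
    moreover have "[w ^ j = 5] (mod 2 ^ 3)"
      using cong_dvd_mod_power[OF j n] .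
    ultimately show False
      by (simp add: cong_def)
  qed
  have "aff (2 * geo w j) 5 \<in> R"
    using mem_cong[OF pow_mem[OF R odd(1) mem] cong_refl j] .
  then have "aff (s * (2 * geo w j)) 5 \<in> ?S"
    using s(1) by (intro scale_mem) auto
  then have "aff (2 * (s * geo w j)) 5 \<in> ?S"
    by (simp add: ac_simps)
  then have "regular_type 5 ?S \<or> regular_type 6 ?S"
    using \<open>odd (geo w j)\<close> s by (intro type_5_or_6[OF S]) auto
  with s(1) show ?thesis by blast
qed

lemma exists_type: "\<exists>s i. odd s \<and> regular_type i (conjugate (aff 0 s) R)"
proof (cases "\<exists>c u. odd c \<and> u mod 4 = 1 \<and> aff c u \<in> R")
  case True
  then show ?thesis
    using exists_type_cyclic[OF R regular] by blast
next
  case False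
  have odd_part: "u mod 4 = 3" if "odd c" "odd u" "aff c u \<in> R" for c u
  proof -
    have "u mod 4 \<noteq> 1"
      using False that by blast
    with that(2) show ?thesis
      by presburger
  qed
  obtain v where v: "odd v" "aff 1 v \<in> R"
    by (rule covering_R[OF R regular])
  then have v4: "v mod 4 = 3"
    using odd_part odd_one by blast
  obtain w0 where w0: "odd w0" "aff 2 w0 \<in> R"
    by (rule covering_R[OF R regular])
  \<comment> \<open>This product has an odd translation part, so its multiplier is 3 modulo 4; as
    \<open>v\<close> is too, \<open>w0\<close> must be 1 modulo 4.\<close>
  have "aff 2 w0 \<otimes>\<^bsub>Hol G\<^esub> aff 1 v \<in> R"
    using R w0 v by (intro subgroup.m_closed)
  then have "(w0 * v) mod 4 = 3"
    using v w0 by (intro odd_part[of "v * 2 + 1"]) auto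
  then have w0_4: "w0 mod 4 = 1"
    using mod_mult_right_eq[of w0 v 4] v4 by simp presburger
  obtain s r where sr: "2 \<le> s" "s \<le> n" "odd r" "aff 2 (1 + 2 ^ s * r) \<in> R"
  proof (cases "[w0 = 1] (mod 2 ^ n)")
    case True
    \<comment> \<open>The trivial multiplier is encoded by \<open>s = n\<close> and
      \<open>r = 1\<close>, so it is treated together with the others.\<close>
    then have "[w0 = 1 + 2 ^ n * 1] (mod 2 ^ n)"
      by (simp add: cong_def)
    then show ?thesis
      using that[of n 1] mem_cong[OF w0(2) cong_refl] n by auto
  next
    case False
    then have "w0 - 1 \<noteq> 0"
      by auto
    then obtain s r where sr: "w0 - 1 = 2 ^ s * r" "odd r"
      by (rule pow2_decompose)
    have "4 dvd w0 - 1"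
      using w0_4 by presburger
    have "2 \<le> s"
    proof (rule ccontr)
      assume "\<not> 2 \<le> s"
      then have "s = 0 \<or> s = 1"
        by linarith
      then show False
        using \<open>4 dvd w0 - 1\<close> sr by (auto elim!: dvdE)
    qed
    moreover have "s \<le> n"
    proof (rule ccontr)
      assume "\<not> s \<le> n"
      then have "(2 :: int) ^ n dvd w0 - 1"
        using le_imp_power_dvd[of n s "2 :: int"] sr(1) by simp
      with False show False
        by (simp add: cong_iff_dvd_diff)
    qed
    moreover have "w0 = 1 + 2 ^ s * r"
      using sr(1) by simp
    ultimately show ?thesis
      using that sr(2) w0(2) by blast
  qed
  define w where "w = 1 + 2 ^ s * r"
  have mem: "aff 2 w \<in> R"
    using sr by (simp add: w_def)
  have "(4 :: int) dvd 2 ^ s"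
    using le_imp_power_dvd[OF sr(1), of "2 :: int"] by simp
  then have w4: "w mod 4 = 1"
    using dvd_mult2[of 4 "2 ^ s" r] unfolding w_def by presburger
  then have "odd w"
    by (rule odd_if_mod_4)
  then obtain w' where w': "odd w'" "[w * w' = 1] (mod 2 ^ n)"
    using odd_inverse_mod_pow2 by blast
  have "inv\<^bsub>Hol G\<^esub> (aff 1 v) \<otimes>\<^bsub>Hol G\<^esub> aff 2 w \<otimes>\<^bsub>Hol G\<^esub> aff 1 v \<otimes>\<^bsub>Hol G\<^esub> inv\<^bsub>Hol G\<^esub> (aff 2 w) \<in> R"
    using mem v by (intro subgroup.m_closed[OF R] subgroup.m_inv_closed[OF R])
  then have "aff (w' * (v * 2 + (1 - w)) + - w' * 2) (w * w') \<in> R"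
    using v w' \<open>odd w\<close> by (simp add: conj_aff inv_aff)
  then have "aff (w' * (2 * v - 1 - w)) 1 \<in> R"
    using w'(2) by (elim mem_cong) (simp_all add: algebra_simps)
  then have "aff (w' * (2 * v - 1 - w)) 1 \<in> generate (Hol G) {aff (2 ^ 1 * 1) w}"
    using mem_S_mod_4[OF R regular, of 1 w 1 v 1] w4 mem v v4 by simp
  then have "2 ^ (1 + n - s) dvd w' * (2 * v - 1 - w)"
    using mem_generate_unipotent[of 1 r s 1 w] sr by (simp add: w_def)
  then have dvd: "2 ^ (1 + n - s) dvd 2 * v - 1 - w"
    using w'(1) by (subst (asm) coprime_dvd_mult_right_iff) auto
  consider "s = 2" | "3 \<le> s" "s \<le> n - 2" | "3 \<le> s" "s = n - 1" | "s = n"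
    using sr by linarith
  then show ?thesis
  proof cases
    case 1
    then show ?thesis
      using exists_type_full[of r v] sr v v4 by simp
  next
    case 2
    \<comment> \<open>In the middle range both \<open>2 * v - 1 - w\<close> and \<open>w - 1\<close>
      are divisible by 8, so \<open>v\<close> would be 1 modulo 4.\<close>
    have "(8 :: int) dvd 2 ^ (1 + n - s)" "(8 :: int) dvd 2 ^ s"
      using le_imp_power_dvd[of 3 "1 + n - s" "2 :: int"] le_imp_power_dvd[of 3 s "2 :: int"] 2 n by simp_all
    then have "8 dvd 2 * v - 1 - w" "8 dvd w - 1"
      using dvd dvd_trans by (auto simp: w_def)
    then have "8 dvd 2 * v - 2"
      by presburger
    then show ?thesis
      using v4 by presburger
  next
    case 3
    obtain b where "r = 2 * b + 1"
      using sr(3) ..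
    moreover have "2 ^ s = 2 * M"
      using pow_n(2) 3(2) by blast
    ultimately have "[1 + 2 ^ s * r = 1 + 2 * M] (mod 2 ^ n)"
      by (intro congI[of _ _ b]) (simp add: algebra_simps)
    then have "aff 2 (1 + 2 * M) \<in> R"
      using mem_cong[OF sr(4) cong_refl] by blast
    then show ?thesis
      using exists_type_quasidihedral[OF R regular _ _ v(2) v4] 3 by simp
  next
    case 4
    then have "[1 + 2 ^ s * r = 1] (mod 2 ^ n)"
      by (simp add: cong_iff_dvd_diff)
    then have "aff 2 1 \<in> R"
      using mem_cong[OF sr(4) cong_refl] by blast
    then show ?thesis
      using exists_type_translation[OF R regular _ v(2) v4] by blast
  qed
qed

end

section \<open>Existence and uniqueness of the type combined\<close>

lemma regular_iff_unique_type:
  assumes R: "subgroup R (Hol G)"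
  shows "regular_on R (carrier G) \<longleftrightarrow> (\<exists>!i. \<exists>h\<in>carrier (Hol G). regular_type i (conjugate h R))"
proof
  assume "regular_on R (carrier G)"
  then obtain s i where "odd s" "regular_type i (conjugate (aff 0 s) R)"
    using exists_type[OF R] by blast
  moreover have "i = type_index R" if "h \<in> carrier (Hol G)" "regular_type i (conjugate h R)" for h i
    using that regular_type_imp[OF subgroup_conj[OF that(1) R] that(2)]
      type_index_conj[OF that(1) subgroup.subset[OF R]] by simp
  ultimately show "\<exists>!i. \<exists>h\<in>carrier (Hol G). regular_type i (conjugate h R)"
    using aff_in_Hol by blast
next
  assume "\<exists>!i. \<exists>h\<in>carrier (Hol G). regular_type i (conjugate h R)"
  then obtain i h where h: "h \<in> carrier (Hol G)" "regular_type i (conjugate h R)"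
    by blast
  then have "regular_on (conjugate h R) (carrier G)"
    using regular_type_imp subgroup_conj[OF h(1) R] by blast
  then have "regular_on (conjugate (inv\<^bsub>Hol G\<^esub> h) (conjugate h R)) (carrier G)"
    by (rule regular_conj[OF Hol.inv_closed[OF h(1)] subgroup_conj[OF h(1) R]])
  then show "regular_on R (carrier G)"
    using conj_inv[OF h(1) subgroup.subset[OF R]] by simp
qed

end

theorem theorem1p4:
  fixes G :: "('a, 'b) monoid_scheme"
    and a :: 'a and n :: nat
    and x y :: "'a \<Rightarrow> 'a" and R :: "('a \<Rightarrow> 'a) set"
  defines "H \<equiv> Hol G"
    and "\<rho> \<equiv> right_translation G"
    and "m \<equiv> modular_inverse (2 ^ n) (5 :: int)"
  assumes "group G" and "a \<in> carrier G" and "carrier G = generate G {a}"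
    and "G \<cong> integer_mod_group (2 ^ n)" and "3 \<le> n"
    and "x \<in> auto G" and "x a = inv\<^bsub>G\<^esub> a"
    and "y \<in> auto G" and "y a = a [^]\<^bsub>G\<^esub> (5 :: nat)"
    and "subgroup R H"
  shows "regular_on R (carrier G) \<longleftrightarrow>
    (\<exists>!i :: nat. \<exists>h \<in> carrier H. let S = conjugate_set H h R in
        i = 1 \<and>
          S = right_regular G
      \<or> i = 2 \<and>
          (\<exists>t :: nat. t \<le> n - 3 \<and>
             S = generate H {\<rho> a \<otimes>\<^bsub>H\<^esub> y [^]\<^bsub>H\<^esub> ((2 :: nat) ^ t)} \<and>
             H\<lparr>carrier := S\<rparr> \<cong> integer_mod_group (2 ^ n) \<and>
             S \<inter> right_regular G = generate H {\<rho> (a [^]\<^bsub>G\<^esub> ((2 :: nat) ^ (n - t - 2)))})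
      \<or> i = 3 \<and>
          S = generate H {\<rho> (a [^]\<^bsub>G\<^esub> (2 :: nat)), \<rho> a \<otimes>\<^bsub>H\<^esub> x} \<and>
          is_dihedral n (H\<lparr>carrier := S\<rparr>)
      \<or> i = 4 \<and>
          S = generate H {\<rho> (a [^]\<^bsub>G\<^esub> (2 :: nat)),
                          \<rho> a \<otimes>\<^bsub>H\<^esub> x \<otimes>\<^bsub>H\<^esub> y [^]\<^bsub>H\<^esub> ((2 :: nat) ^ (n - 3))} \<and>
          H\<lparr>carrier := S\<rparr> \<cong> generalised_quaternion n
      \<or> i = 5 \<and>
          internal_direct H S
            (generate H {\<rho> (a [^]\<^bsub>G\<^esub> (2 * m)) \<otimes>\<^bsub>H\<^esub> y})
            (generate H {\<rho> a \<otimes>\<^bsub>H\<^esub> x}) \<and>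
          S \<inter> right_regular G = generate H {\<rho> (a [^]\<^bsub>G\<^esub> ((2 :: nat) ^ (n - 1)))}
      \<or> i = 6 \<and>
          internal_semidirect H S
            (generate H {\<rho> (a [^]\<^bsub>G\<^esub> (2 * m + 2 ^ (n - 2))) \<otimes>\<^bsub>H\<^esub> y})
            (generate H {\<rho> a \<otimes>\<^bsub>H\<^esub> x}) \<and>
          S \<inter> right_regular G = generate H {\<rho> (a [^]\<^bsub>G\<^esub> ((2 :: nat) ^ (n - 1)))} \<and>
          is_modular n (H\<lparr>carrier := S\<rparr>)
      \<or> i = 7 \<and>
          internal_semidirect H S
            (generate H {\<rho> (a [^]\<^bsub>G\<^esub> (2 :: nat)) \<otimes>\<^bsub>H\<^esub> y [^]\<^bsub>H\<^esub> ((2 :: nat) ^ (n - 3))})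
            (generate H {\<rho> a \<otimes>\<^bsub>H\<^esub> x}) \<and>
          S \<inter> right_regular G = generate H {\<rho> (a [^]\<^bsub>G\<^esub> (4 :: nat))} \<and>
          is_quasidihedral n (H\<lparr>carrier := S\<rparr>))"
proof -
  interpret cyclic_two_group G a n
    by (intro cyclic_two_group.intro cyclic_two_group_axioms.intro) (use assms in auto)
  have "x a = a [^]\<^bsub>G\<^esub> (- 1 :: int)" "y a = a [^]\<^bsub>G\<^esub> (5 :: int)"
    using \<open>x a = _\<close> \<open>y a = _\<close> int_pow_neg[of a 1] int_pow_int[of G a 5] by simp_all
  then have x: "x = aff 0 (- 1)" and y: "y = aff 0 5"
    using auto_eq_aff(1) \<open>x \<in> auto G\<close> \<open>y \<in> auto G\<close> by blast+
  have y_pow: "y [^]\<^bsub>Hol G\<^esub> k = aff 0 (5 ^ k)" for k :: nat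
    by (simp add: y nat_pow_aff)
  have \<rho>: "right_translation G a = aff 1 1" "right_translation G (a [^]\<^bsub>G\<^esub> (2 :: nat)) = aff 2 1"
    using right_translation_eq_aff[of 1] right_translation_eq_aff[of 2] int_pow_int[of G a 2] by simp_all
  \<comment> \<open>The exponent of two in \<open>5 ^ 2 ^ (n - 3) - 1\<close> is
    \<open>n - 1\<close>, so this power is \<open>1 + 2 * M\<close> modulo
    \<open>4 * M\<close>.\<close>
  obtain r :: int where r: "odd r" "(5 :: int) ^ (2 ^ (n - 3)) = 1 + 2 ^ (n - 3 + 2) * r"
    by (rule five_power_pow2)
  obtain b where "r = 2 * b + 1"
    using r(1) ..
  moreover have "n - 3 + 2 = n - 1"
    using n by simp
  ultimately have five: "(5 :: int) ^ (2 ^ (n - 3)) = 1 + 2 * M + 4 * M * b"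
    using r(2) pow_n(2) by (simp add: algebra_simps)
  have "[5 * m = 1] (mod 2 ^ n)"
    unfolding m_def by (rule cong_modular_inverse1) simp
  then have m: "[2 * (5 * m) = 2] (mod 2 ^ n)"
    using cong_scalar_left[of "5 * m" 1 "2 ^ n" 2] by simp
  \<comment> \<open>The extra summand \<open>2 ^ (n - 2)\<close> of type 6 is unaffected by
    \<open>y\<close>, because \<open>5 * M - M\<close> is the modulus.\<close>
  have M: "[5 * M = M] (mod 2 ^ n)"
    by (rule congI[of _ _ 1]) simp
  have eq2: "right_translation G a \<otimes>\<^bsub>Hol G\<^esub> y [^]\<^bsub>Hol G\<^esub> ((2 :: nat) ^ t) = aff (5 ^ 2 ^ t) (5 ^ 2 ^ t)" for t
    by (simp add: \<rho> y_pow)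
  have eq3: "right_translation G a \<otimes>\<^bsub>Hol G\<^esub> x = aff (- 1) (- 1)"
    by (simp add: \<rho> x)
  have eq4: "aff (- 1) (- 1) \<otimes>\<^bsub>Hol G\<^esub> y [^]\<^bsub>Hol G\<^esub> ((2 :: nat) ^ (n - 3)) = aff (2 * M - 1) (2 * M - 1)"
  proof -
    have "[- (5 ^ 2 ^ (n - 3)) = 2 * M - 1] (mod 2 ^ n)"
      unfolding five by (rule congI[of _ _ "- b - 1"]) (simp add: algebra_simps)
    then show ?thesis
      by (simp add: y_pow aff_eq_iff)
  qed
  have eq5: "right_translation G (a [^]\<^bsub>G\<^esub> (2 * m)) \<otimes>\<^bsub>Hol G\<^esub> y = aff 2 5"
    using m by (simp add: right_translation_eq_aff y aff_eq_iff mult.left_commute)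
  have eq6: "right_translation G (a [^]\<^bsub>G\<^esub> (2 * m + 2 ^ (n - 2))) \<otimes>\<^bsub>Hol G\<^esub> y = aff (2 + M) 5"
    using cong_add[OF m M]
    by (simp add: right_translation_eq_aff y aff_eq_iff distrib_left mult.left_commute flip: M_def)
  have eq7: "aff 2 1 \<otimes>\<^bsub>Hol G\<^esub> y [^]\<^bsub>Hol G\<^esub> ((2 :: nat) ^ (n - 3)) = aff (2 + 4 * M) (1 + 2 * M)"
  proof -
    have "[5 ^ 2 ^ (n - 3) * 2 = 2 + 4 * M] (mod 2 ^ n)" "[5 ^ 2 ^ (n - 3) = 1 + 2 * M] (mod 2 ^ n)"
      unfolding five by (rule congI[of _ _ "2 * b"], simp) (rule congI[of _ _ b], simp)
    then show ?thesis
      by (simp add: y_pow aff_eq_iff)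
  qed
  have "regular_on R (carrier G) \<longleftrightarrow> (\<exists>!i. \<exists>h\<in>carrier (Hol G). regular_type i (conjugate h R))"
    using \<open>subgroup R H\<close> unfolding H_def by (rule regular_iff_unique_type)
  then show ?thesis
    unfolding regular_type_def Let_def H_def \<rho>_def eq3 eq4 eq5 eq6 \<rho>(2) eq7 eq2 .
qed

end
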